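(* There is a deterministic algorithm $\textsc{LowConductanceCutOrCertify}(G,\phi,b)$ which, given an undirected graph $G$ with $n$ vertices and $m$ edges, a conductance parameter $\phi\in(0,1]$ and a balance parameter $b\in[1/n,1/4]$, runs in time $\widetilde{O}(m^2/\phi)$ and does one of the following: 1. it finds a cut $(S,\overline{S})$ with $\mathrm{vol}_G(S),\mathrm{vol}_G(\overline{S})\ge b\cdot\mathrm{vol}(G)$ and conductance $\Phi_G(S)\le\phi$; or 2. it certifies (i.e. correctly asserts) that every cut $(X,\overline{X})$ with $\mathrm{vol}_G(X),\mathrm{vol}_G(\overline{X})=\Omega(b\cdot\mathrm{vol}(G))$ has conductance at least $$\phi\cdot\Omega\left(\frac{1}{\log n\cdot\log(1/b)\cdot\log(\log(n)/(\phi b))}\right).$$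
   Context: For an undirected graph $G=(V,E)$ and $S\subseteq V$, $\overline{S}=V\setminus S$, $\mathrm{vol}_G(S)$ is the sum of the degrees of the vertices in $S$, $\mathrm{vol}(G)=\mathrm{vol}_G(V)$, and $E_G(S,\overline S)$ is the set of edges with exactly one endpoint in $S$. A cut is a pair $(S,\overline S)$ with $\emptyset\ne S\subsetneq V$. The conductance of the cut is $\Phi_G(S)=\frac{|E_G(S,\overline{S})|}{\min\{\mathrm{vol}_G(S),\mathrm{vol}_G(\overline{S})\}}$. All constants hidden in $\Omega(\cdot)$ are universal; in item 2, "every cut with volumes $\Omega(b\cdot \mathrm{vol}(G))$" means every cut with both volumes at least $c\, b\cdot\mathrm{vol}(G)$ for some universal constant $c>0$. $\widetilde{O}(\cdot)$ hides polylogarithmic factors. *)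

theory Defs
  imports Complex_Main
begin

section \<open>Graphs, volumes, cuts and conductance\<close>

definition ugraph :: "'a set \<Rightarrow> 'a set set \<Rightarrow> bool" where
  "ugraph V E \<longleftrightarrow> finite V \<and> (\<forall>e\<in>E. \<exists>u\<in>V. \<exists>v\<in>V. u \<noteq> v \<and> e = {u, v})"

definition degree :: "'a set set \<Rightarrow> 'a \<Rightarrow> nat" where
  "degree E v = card {e \<in> E. v \<in> e}"

definition vol :: "'a set set \<Rightarrow> 'a set \<Rightarrow> nat" where
  "vol E S = (\<Sum>v\<in>S. degree E v)"

definition is_cut :: "'a set \<Rightarrow> 'a set \<Rightarrow> bool" where
  "is_cut V S \<longleftrightarrow> S \<noteq> {} \<and> S \<subset> V"

definition cut_edges :: "'a set set \<Rightarrow> 'a set \<Rightarrow> 'a set set" where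
  "cut_edges E S = {e \<in> E. card (e \<inter> S) = 1}"

text \<open>If one of the two sides has volume 0, the quotient is 0 by the convention for division
  by zero in HOL.  For a graph with at least one edge and \<open>b > 0\<close> this never concerns a cut
  both of whose sides have volume at least \<open>b\<close> times the total volume.\<close>

definition conductance :: "'a set \<Rightarrow> 'a set set \<Rightarrow> 'a set \<Rightarrow> real" where
  "conductance V E S = real (card (cut_edges E S)) / real (min (vol E S) (vol E (V - S)))"

section \<open>A deterministic word RAM with real parameters\<close>

text \<open>Algorithms are programs of a small imperative language over words of \<open>w\<close> bits, i.e.
  natural numbers below \<open>2 ^ w\<close>.  The memory consists of arrays of words; \<open>Cell a i\<close> is the
  content of array \<open>a\<close> at the address given by the expression \<open>i\<close>.  A program refers to
  finitely many arrays only, so they could equally well be interleaved in a single memory.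
  Scalar variables are cells with a constant address.

  Real parameters are read-only, and can only be accessed by comparing them with a quotient of
  two words: \<open>ParamLe p x y\<close> tests whether \<open>x\<close> times parameter number \<open>p\<close> is at most \<open>y\<close>.
  For a parameter that is itself a quotient of two words, this is a constant number of word
  operations.  There is no arithmetic on real numbers.\<close>

type_synonym memory = "nat \<Rightarrow> nat \<Rightarrow> nat"

datatype exp =
    Const nat
  | Cell nat exp
  | Add exp exp
  | Sub exp exp
  | Mul exp exp
  | Div exp exp
  | Mod exp exp

datatype test =
    Less exp exp
  | ParamLe nat exp exp
  | Not test
  | And test test

datatype com =
    Skip
  | Store nat exp exp
  | Seq com com
  | If test com com
  | While test com

primrec eval :: "nat \<Rightarrow> memory \<Rightarrow> exp \<Rightarrow> nat" where
  "eval w s (Const k) = k mod 2 ^ w"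
| "eval w s (Cell a i) = s a (eval w s i)"
| "eval w s (Add x y) = (eval w s x + eval w s y) mod 2 ^ w"
| "eval w s (Sub x y) = eval w s x - eval w s y"
| "eval w s (Mul x y) = (eval w s x * eval w s y) mod 2 ^ w"
| "eval w s (Div x y) = eval w s x div eval w s y"
| "eval w s (Mod x y) = eval w s x mod eval w s y"

primrec holds :: "nat \<Rightarrow> (nat \<Rightarrow> real) \<Rightarrow> memory \<Rightarrow> test \<Rightarrow> bool" where
  "holds w \<rho> s (Less x y) \<longleftrightarrow> eval w s x < eval w s y"
| "holds w \<rho> s (ParamLe p x y) \<longleftrightarrow> real (eval w s x) * \<rho> p \<le> real (eval w s y)"
| "holds w \<rho> s (Not c) \<longleftrightarrow> \<not> holds w \<rho> s c"
| "holds w \<rho> s (And c d) \<longleftrightarrow> holds w \<rho> s c \<and> holds w \<rho> s d"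

text \<open>\<open>exec w \<rho> c s t s'\<close>: started in memory \<open>s\<close>, the program \<open>c\<close> terminates in memory
  \<open>s'\<close> after \<open>t\<close> steps.  Every assignment and every evaluation of a test is one step; as the
  expressions of a program have constant size, this is the number of elementary operations up
  to a constant factor that depends on the program only.\<close>

inductive exec ::
  "nat \<Rightarrow> (nat \<Rightarrow> real) \<Rightarrow> com \<Rightarrow> memory \<Rightarrow> nat \<Rightarrow> memory \<Rightarrow> bool"
  for w :: nat and \<rho> :: "nat \<Rightarrow> real" where
  Skip: "exec w \<rho> Skip s 1 s"
| Store: "exec w \<rho> (Store a i x) s 1 (s(a := (s a)(eval w s i := eval w s x)))"
| Seq: "exec w \<rho> c s t s' \<Longrightarrow> exec w \<rho> d s' t' s'' \<Longrightarrow> exec w \<rho> (Seq c d) s (t + t') s''"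
| IfTrue: "holds w \<rho> s b \<Longrightarrow> exec w \<rho> c s t s' \<Longrightarrow> exec w \<rho> (If b c d) s (1 + t) s'"
| IfFalse: "\<not> holds w \<rho> s b \<Longrightarrow> exec w \<rho> d s t s' \<Longrightarrow> exec w \<rho> (If b c d) s (1 + t) s'"
| WhileFalse: "\<not> holds w \<rho> s b \<Longrightarrow> exec w \<rho> (While b c) s 1 s"
| WhileTrue: "holds w \<rho> s b \<Longrightarrow> exec w \<rho> c s t s' \<Longrightarrow> exec w \<rho> (While b c) s' t' s'' \<Longrightarrow>
    exec w \<rho> (While b c) s (1 + t + t') s''"

inductive_cases SkipE: "exec w \<rho> Skip s t s'"
inductive_cases StoreE: "exec w \<rho> (Store a i x) s t s'"
inductive_cases SeqE: "exec w \<rho> (Seq c d) s t s'"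
inductive_cases IfE: "exec w \<rho> (If b c d) s t s'"
inductive_cases WhileE: "exec w \<rho> (While b c) s t s'"

lemma exec_deterministic:
  assumes "exec w \<rho> c s t s'" and "exec w \<rho> c s u s''"
  shows "u = t \<and> s'' = s'"
  using assms
proof (induction arbitrary: u s'' rule: exec.induct)
  case Skip
  then show ?case by (auto elim: SkipE)
next
  case Store
  then show ?case by (auto elim: StoreE)
next
  case (Seq c s t s' d t' s'')
  from Seq.prems show ?case by (rule SeqE) (metis Seq.IH)
next
  case (IfTrue s b c t s' d)
  from IfTrue.prems show ?case by (rule IfE) (metis IfTrue.IH plus_1_eq_Suc add_Suc, metis IfTrue.hyps(1))
next
  case (IfFalse s b d t s' c)
  from IfFalse.prems show ?case by (rule IfE) (metis IfFalse.hyps(1), metis IfFalse.IH plus_1_eq_Suc add_Suc)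
next
  case (WhileFalse s b c)
  from WhileFalse.prems show ?case by (rule WhileE) (simp, metis WhileFalse.hyps(1))
next
  case (WhileTrue s b c t s' t' s'')
  from WhileTrue.prems show ?case
    by (rule WhileE) (metis WhileTrue.hyps(1), metis WhileTrue.IH plus_1_eq_Suc add_Suc)
qed

section \<open>Input and output\<close>

text \<open>A graph with vertices \<open>0, \<dots>, n - 1\<close> is given by a list of its edges in arbitrary order,
  each edge occurring once, in an arbitrary orientation.\<close>

definition edge_list :: "nat set set \<Rightarrow> (nat \<times> nat) list \<Rightarrow> bool" where
  "edge_list E es \<longleftrightarrow> set (map (\<lambda>(u, v). {u, v}) es) = E \<and> length es = card E"

text \<open>Array 0 holds the numbers of vertices and edges, arrays 1 and 2 the endpoints of the
  edges.  All other cells are 0.\<close>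

definition input_memory :: "nat \<Rightarrow> (nat \<times> nat) list \<Rightarrow> memory" where
  "input_memory n es = (\<lambda>a i.
     if a = 0 \<and> i = 0 then n
     else if a = 0 \<and> i = 1 then length es
     else if a = 1 \<and> i < length es then fst (es ! i)
     else if a = 2 \<and> i < length es then snd (es ! i)
     else 0)"

definition input_params :: "real \<Rightarrow> real \<Rightarrow> nat \<Rightarrow> real" where
  "input_params \<phi> b = (\<lambda>p. if p = 0 then \<phi> else b)"

text \<open>The first cell of array 3 tells whether the program outputs a cut or a certificate; array
  4 is the characteristic vector of the cut.\<close>

definition outputs_cut :: "memory \<Rightarrow> bool" where
  "outputs_cut s \<longleftrightarrow> s 3 0 \<noteq> 0"

definition output_set :: "nat \<Rightarrow> memory \<Rightarrow> nat set" where
  "output_set n s = {v \<in> {..<n}. s 4 v \<noteq> 0}"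

end

theory Submission
  imports Defs
begin

text \<open>The algorithm maintains edge weights, which define integer edge lengths of total \<open>O(m)\<close>,
  and grows a ball around an arbitrary root.  As long as the ball has less than half of the volume,
  either its boundary is small compared with the length it covers, and the ball is cut off, or the
  covered length grows by a factor \<open>1 + \<Omega>(\<phi>)\<close>; hence \<open>O(log m / \<phi>)\<close> steps lead to a
  decision.  If the pieces cut off reach a constant fraction of the volume, they form a sparse cut.
  Beyond half of the volume the step width is inversely proportional to the outer volume; either the
  outer side is a sparse cut, or again \<open>O(log m / \<phi>)\<close> steps reach all but a fraction \<open>b\<close> of
  the volume.  In the latter case every edge end in the ball sends one unit of flow to the root.
  This flow costs only \<open>O(m log m / \<phi>)\<close> with respect to the lengths, so multiplying the
  weights by \<open>1 + C / 2m\<close>, where \<open>C\<close> is the flow on the edge, increases the total weight slowly.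
  On the other hand every cut whose sides have volume at least \<open>4bm\<close> carries flow of the order of
  its smaller volume each time.  When the total weight has grown by a factor \<open>4m\<close>, such a cut must
  therefore have conductance \<open>\<Omega>(\<phi> / log n)\<close>, which is even better than required.\<close>

section \<open>Weakest preconditions with time\<close>

text \<open>Sparsity of the pieces cut off is measured against edge lengths, and every reweighting
  changes the lengths. The unit of length is therefore frozen until the total weight has doubled: in
  between, lengths only grow, so the pieces stay sparse, and only at a doubling are they given up.
  Each attempt that does not end the search makes lasting progress: it removes positive volume, or
  it raises the logarithm of the total weight by at least \<open>1 / (4 * m)\<close>. This leaves
  O(m log m) attempts of O(m log m / \<phi>) steps each. The single logarithm in the certificate is
  the result of a cancellation. Growth of the total weight by a factor \<open>4 * m\<close> needs at
  least \<open>m * ln (4 * m) / (nsteps + 2)\<close> routings, while one edge can absorb only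
  \<open>2 * ln (4 * m)\<close> in the logarithm of its weight; what remains is the number of
  growing steps. A second obstacle is the word length: it depends on \<open>n\<close> only, whereas
  \<phi> may be arbitrarily small. Distances stay polynomial because boundaries are integers, so
  that a ball which is allowed to grow does so by a factor of at least
  \<open>1 + 1 / (6 * m)\<close>.\<close>

definition wp :: "nat \<Rightarrow> (nat \<Rightarrow> real) \<Rightarrow> com \<Rightarrow> (nat \<Rightarrow> memory \<Rightarrow> bool) \<Rightarrow> memory \<Rightarrow> bool" where
  "wp w \<rho> c Q s \<longleftrightarrow> (\<exists>t s'. exec w \<rho> c s t s' \<and> Q t s')"

lemma wp_Skip [simp]: "wp w \<rho> Skip Q s = Q 1 s"
  unfolding wp_def by (metis SkipE exec.Skip)

lemma wp_Store [simp]: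
  "wp w \<rho> (Store a x y) Q s = Q 1 (s(a := (s a)(eval w s x := eval w s y)))"
  unfolding wp_def by (metis StoreE exec.Store)

lemma wp_Seq [simp]: "wp w \<rho> (Seq c d) Q s = wp w \<rho> c (\<lambda>t. wp w \<rho> d (\<lambda>t'. Q (t + t'))) s"
  unfolding wp_def by (blast intro: exec.Seq elim: SeqE)

lemma exec_If:
  "exec w \<rho> (If b c d) s t s' \<longleftrightarrow>
    (\<exists>u. t = 1 + u \<and> exec w \<rho> (if holds w \<rho> s b then c else d) s u s')"
  by (auto intro: exec.IfTrue[unfolded plus_1_eq_Suc] exec.IfFalse[unfolded plus_1_eq_Suc] elim!: IfE)

lemma wp_If [simp]:
  "wp w \<rho> (If b c d) Q s =
    (if holds w \<rho> s b then wp w \<rho> c (\<lambda>t. Q (1 + t)) s else wp w \<rho> d (\<lambda>t. Q (1 + t)) s)"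
  unfolding wp_def exec_If by auto

lemma wp_mono: "wp w \<rho> c Q s \<Longrightarrow> (\<And>t s'. Q t s' \<Longrightarrow> R t s') \<Longrightarrow> wp w \<rho> c R s"
  unfolding wp_def by blast

text \<open>The invariant carries the number \<open>k\<close> of iterations done, so the single
  bound \<open>k \<le> N\<close> yields both termination and the running time.\<close>

lemma wp_While:
  assumes step: "\<And>k s. I k s \<Longrightarrow> holds w \<rho> s b \<Longrightarrow> wp w \<rho> c (\<lambda>t s'. t \<le> \<tau> \<and> I (Suc k) s') s"
    and bound: "\<And>k s. I k s \<Longrightarrow> k \<le> N"
    and init: "I k s"
    and final: "\<And>k t s. I k s \<Longrightarrow> \<not> holds w \<rho> s b \<Longrightarrow> t \<le> 1 + N * (\<tau> + 1) \<Longrightarrow> Q t s"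
  shows "wp w \<rho> (While b c) Q s"
proof -
  have "\<exists>t s'. exec w \<rho> (While b c) s t s' \<and> t \<le> 1 + (N - k) * (\<tau> + 1) \<and>
      (\<exists>k. I k s') \<and> \<not> holds w \<rho> s' b" if "I k s" for k s
    using that
  proof (induction "N - k" arbitrary: k s rule: less_induct)
    case less
    show ?case
    proof (cases "holds w \<rho> s b")
      case True
      obtain t s' where 1: "exec w \<rho> c s t s'" "t \<le> \<tau>" "I (Suc k) s'"
        using step[OF less.prems True] by (auto simp: wp_def)
      have k: "Suc k \<le> N" using bound[OF 1(3)] .
      obtain t' s'' where 2: "exec w \<rho> (While b c) s' t' s''"
        "t' \<le> 1 + (N - Suc k) * (\<tau> + 1)" "\<exists>k. I k s''" "\<not> holds w \<rho> s'' b"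
        using less.hyps[OF _ 1(3)] k by (meson diff_less_mono2 lessI less_le_trans)
      have "N - k = Suc (N - Suc k)" using k by simp
      hence "1 + t + t' \<le> 1 + (N - k) * (\<tau> + 1)" using 1(2) 2(2) by simp
      thus ?thesis using exec.WhileTrue[OF True 1(1) 2(1)] 2(3,4) by blast
    next
      case False
      thus ?thesis using exec.WhileFalse[OF False, of c] less.prems by force
    qed
  qed
  from this[OF init] obtain t s' k' where "exec w \<rho> (While b c) s t s'"
    "t \<le> 1 + (N - k) * (\<tau> + 1)" "I k' s'" "\<not> holds w \<rho> s' b" by blast
  moreover have "(N - k) * (\<tau> + 1) \<le> N * (\<tau> + 1)" by (rule mult_right_mono) auto
  ultimately show ?thesis unfolding wp_def using final by (meson add_left_mono le_trans)
qed

section \<open>The program\<close>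

abbreviation var :: "nat \<Rightarrow> exp" where "var a \<equiv> Cell a (Const 0)"
abbreviation set_var :: "nat \<Rightarrow> exp \<Rightarrow> com" where "set_var a x \<equiv> Store a (Const 0) x"
abbreviation incr :: "nat \<Rightarrow> com" where "incr a \<equiv> set_var a (Add (var a) (Const 1))"
notation Seq (infixr \<open>;;\<close> 60)

text \<open>Memory layout.  A label 0 in \<open>lab_a\<close> means that the vertex has not been reached;
  otherwise it is the distance from the root plus 1.  \<open>par_a\<close> holds the edge through which a
  vertex was reached, \<open>ord_a\<close> the vertices in the order in which they were reached.
  \<open>rem_a\<close> is the output array 4; during the run it marks the vertices that have been cut off.
  The length of an edge is its weight divided by \<open>unit_a\<close>, plus 1.\<close>

abbreviation (input) inp_a :: nat where "inp_a \<equiv> 0"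
abbreviation (input) eu_a :: nat where "eu_a \<equiv> 1"
abbreviation (input) ev_a :: nat where "ev_a \<equiv> 2"
abbreviation (input) flag_a :: nat where "flag_a \<equiv> 3"
abbreviation (input) rem_a :: nat where "rem_a \<equiv> 4"
abbreviation (input) lab_a :: nat where "lab_a \<equiv> 5"
abbreviation (input) par_a :: nat where "par_a \<equiv> 6"
abbreviation (input) ord_a :: nat where "ord_a \<equiv> 7"
abbreviation (input) sub_a :: nat where "sub_a \<equiv> 8"
abbreviation (input) con_a :: nat where "con_a \<equiv> 9"
abbreviation (input) wt_a :: nat where "wt_a \<equiv> 10"
abbreviation (input) ix_a :: nat where "ix_a \<equiv> 11"
abbreviation (input) out_a :: nat where "out_a \<equiv> 12"
abbreviation (input) cut_a :: nat where "cut_a \<equiv> 13"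
abbreviation (input) cutr_a :: nat where "cutr_a \<equiv> 14"
abbreviation (input) g_a :: nat where "g_a \<equiv> 15"
abbreviation (input) cc_a :: nat where "cc_a \<equiv> 16"
abbreviation (input) f_a :: nat where "f_a \<equiv> 17"
abbreviation (input) rad_a :: nat where "rad_a \<equiv> 18"
abbreviation (input) cnt_a :: nat where "cnt_a \<equiv> 19"
abbreviation (input) mode_a :: nat where "mode_a \<equiv> 20"
abbreviation (input) root_a :: nat where "root_a \<equiv> 21"
abbreviation (input) j_a :: nat where "j_a \<equiv> 22"
abbreviation (input) y_a :: nat where "y_a \<equiv> 23"
abbreviation (input) pe_a :: nat where "pe_a \<equiv> 24"
abbreviation (input) tw_a :: nat where "tw_a \<equiv> 25"
abbreviation (input) pw_a :: nat where "pw_a \<equiv> 26"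
abbreviation (input) unit_a :: nat where "unit_a \<equiv> 27"
abbreviation (input) hv_a :: nat where "hv_a \<equiv> 28"

abbreviation (input) "mX \<equiv> Cell inp_a (Const 1)"
abbreviation (input) "uX \<equiv> Cell eu_a (var ix_a)"
abbreviation (input) "vX \<equiv> Cell ev_a (var ix_a)"
abbreviation (input) "pos x \<equiv> Less (Const 0) x"
abbreviation (input) "lenX \<equiv> Add (Div (Cell wt_a (var ix_a)) (var unit_a)) (Const 1)"

text \<open>All loops run over the edges, since isolated vertices can make the number of vertices
  larger than the time bound.\<close>

definition for_edges :: "com \<Rightarrow> com" where
  "for_edges c = set_var ix_a (Const 0) ;; While (Less (var ix_a) mX) (c ;; incr ix_a)"

definition prog_scan :: com where
  "prog_scan =
    set_var out_a (Const 0) ;; set_var cut_a (Const 0) ;; set_var cutr_a (Const 0) ;;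
    for_edges
     (If (pos (Cell lab_a uX)) Skip (incr out_a) ;;
      If (pos (Cell lab_a vX)) Skip (incr out_a) ;;
      If (And (Not (And (pos (Cell lab_a uX)) (pos (Cell lab_a vX))))
              (Not (And (Not (pos (Cell lab_a uX))) (Not (pos (Cell lab_a vX))))))
       (incr cut_a ;;
        If (And (Not (pos (Cell rem_a uX))) (Not (pos (Cell rem_a vX)))) (incr cutr_a) Skip)
       Skip)"

definition prog_label :: "exp \<Rightarrow> com" where
  "prog_label y = Store par_a y (var ix_a) ;; Store ord_a (var cnt_a) y ;; incr cnt_a ;; Store lab_a y (var rad_a)"

text \<open>Removed vertices are closed only while more than half of the volume is outside: pieces
  that are cut off must be disjoint, whereas the flow has to certify cuts of the whole
  graph.\<close>

abbreviation (input) "can_label x y \<equiv>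
  And (And (pos (Cell lab_a x)) (Not (pos (Cell lab_a y))))
   (And (Not (And (pos (Cell rem_a y)) (Less mX (var out_a))))
        (Not (Less (var rad_a) (Add (Cell lab_a x) lenX))))"

text \<open>One pass over the edges in any order suffices: a vertex reached in this pass is labelled
  with the new radius, and since lengths are positive it cannot reach another vertex in the same
  pass.\<close>

definition prog_relax :: com where
  "prog_relax =
    set_var rad_a (Add (var rad_a) (Div (Mul (Const 2) mX) (var out_a))) ;;
    for_edges
     (If (can_label uX vX) (prog_label vX) (If (can_label vX uX) (prog_label uX) Skip))"

text \<open>Values of \<open>mode_a\<close>: 0 keep growing, 1 cut off the ball, 2 route flow, 3
  emit the sparse outer side. The variables \<open>g_a\<close> and \<open>cc_a\<close> receive the
  two quantities to be compared, so that one test serves both stages. The covered length is not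
  computed but bounded from below by \<open>f_a\<close>, which accumulates boundary sizes.\<close>

definition prog_grow_step :: com where
  "prog_grow_step =
    prog_scan ;;
    If (And (Not (Less mX (var out_a))) (Not (ParamLe 1 (Mul (Const 2) mX) (var out_a))))
     (set_var mode_a (Const 2))
     (If (Less mX (var out_a))
       (set_var g_a (var f_a) ;; set_var cc_a (var cutr_a) ;; set_var f_a (Add (var f_a) (var cutr_a)))
       (set_var g_a (var out_a) ;; set_var cc_a (var cut_a)) ;;
      If (ParamLe 0 (var g_a) (Mul (Const 16) (var cc_a)))
       prog_relax
       (If (Less mX (var out_a)) (set_var mode_a (Const 1)) (set_var mode_a (Const 3))))"

definition prog_start :: com where
  "prog_start =
    for_edges
     (Store lab_a uX (Const 0) ;; Store lab_a vX (Const 0) ;;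
      If (pos (Cell rem_a uX)) Skip (set_var root_a uX) ;;
      If (pos (Cell rem_a vX)) Skip (set_var root_a vX)) ;;
    Store lab_a (var root_a) (Const 1) ;; Store ord_a (Const 0) (var root_a) ;;
    set_var cnt_a (Const 1) ;; set_var rad_a (Const 1) ;; set_var f_a (Const 1) ;;
    set_var mode_a (Const 0)"

definition prog_remove :: com where
  "prog_remove =
    for_edges
     (If (pos (Cell lab_a uX)) (Store rem_a uX (Const 1)) Skip ;;
      If (pos (Cell lab_a vX)) (Store rem_a vX (Const 1)) Skip) ;;
    set_var hv_a (Const 0) ;;
    for_edges
     (If (pos (Cell rem_a uX)) (incr hv_a) Skip ;;
      If (pos (Cell rem_a vX)) (incr hv_a) Skip) ;;
    If (Less (Mul (Const 2) (var hv_a)) mX) Skip (set_var flag_a (Const 1))"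

definition prog_emit :: com where
  "prog_emit =
    for_edges (Store rem_a uX (Cell lab_a uX) ;; Store rem_a vX (Cell lab_a vX)) ;;
    set_var flag_a (Const 1)"

text \<open>Position 0 of \<open>ord_a\<close> is the root, which has no parent edge, so the loop
  stops at \<open>j = 1\<close>. The sum of the two ends minus \<open>y\<close> is the other end,
  whatever the orientation of the edge.\<close>

definition prog_push :: com where
  "prog_push =
    set_var j_a (var cnt_a) ;;
    While (Less (Const 1) (var j_a))
     (set_var j_a (Sub (var j_a) (Const 1)) ;;
      set_var y_a (Cell ord_a (var j_a)) ;;
      set_var pe_a (Cell par_a (var y_a)) ;;
      Store con_a (var pe_a) (Cell sub_a (var y_a)) ;;
      set_var y_a (Sub (Add (Cell eu_a (var pe_a)) (Cell ev_a (var pe_a))) (var y_a)) ;;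
      Store sub_a (var y_a) (Add (Cell sub_a (var y_a)) (Cell con_a (var pe_a))))"

definition prog_degrees :: com where
  "prog_degrees =
    for_edges
     (Store sub_a uX (Const 0) ;; Store sub_a vX (Const 0) ;; Store con_a (var ix_a) (Const 0)) ;;
    for_edges
     (Store sub_a uX (Add (Cell sub_a uX) (Const 1)) ;;
      Store sub_a vX (Add (Cell sub_a vX) (Const 1)))"

definition prog_reweight :: com where
  "prog_reweight =
    set_var tw_a (Const 0) ;;
    for_edges
     (Store wt_a (var ix_a) (Add (Add (Cell wt_a (var ix_a))
         (Div (Mul (Cell wt_a (var ix_a)) (Add (Cell con_a (var ix_a)) (Const 1))) (Mul (Const 2) mX)))
         (Const 1)) ;;
      set_var tw_a (Add (var tw_a) (Cell wt_a (var ix_a)))) ;;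
    If (Less (var tw_a) (Mul (Const 2) (var pw_a)))
     Skip
     (set_var pw_a (var tw_a) ;; set_var unit_a (Div (var tw_a) mX) ;;
      for_edges (Store rem_a uX (Const 0) ;; Store rem_a vX (Const 0)))"

definition prog_attempt :: com where
  "prog_attempt =
    prog_start ;;
    While (Less (var mode_a) (Const 1)) prog_grow_step ;;
    If (Less (var mode_a) (Const 2)) prog_remove
     (If (Less (var mode_a) (Const 3)) (prog_degrees ;; prog_push ;; prog_reweight) prog_emit)"

definition prog_init :: com where
  "prog_init =
    for_edges (Store wt_a (var ix_a) (Mul (Const 2) mX)) ;;
    set_var tw_a (Mul mX (Mul (Const 2) mX)) ;; set_var pw_a (var tw_a) ;;
    set_var unit_a (Mul (Const 2) mX)"

text \<open>The threshold \<open>8 * m * m * m\<close> is \<open>4 * m\<close> times the initial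
  total weight \<open>2 * m * m\<close>.\<close>

definition balanced_cut_prog :: com where
  "balanced_cut_prog =
    If (Less (Const 0) mX)
     (prog_init ;;
      While (And (Less (var flag_a) (Const 1))
                 (Less (var tw_a) (Mul (Mul (Const 8) mX) (Mul mX mX))))
       prog_attempt)
     (Store rem_a (Const 0) (Const 1) ;; set_var flag_a (Const 1))"

definition frame :: "nat set \<Rightarrow> memory \<Rightarrow> memory \<Rightarrow> bool" where
  "frame A s s' \<longleftrightarrow> (\<forall>a. a \<notin> A \<longrightarrow> s' a = s a)"

text \<open>Hypothesis \<open>ix\<close> makes the invariant insensitive to the loop counter, so
  resetting and incrementing it are dealt with here once and for all.\<close>

lemma wp_for_edges:
  assumes m: "s 0 1 = m" "m < 2 ^ w" "0 < w"
    and init: "I 0 s"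
    and ix: "\<And>k s x. I k s \<Longrightarrow> I k (s(ix_a := x))"
    and step: "\<And>k s. I k s \<Longrightarrow> k < m \<Longrightarrow> s ix_a 0 = k \<Longrightarrow> s 0 1 = m \<Longrightarrow>
      wp w \<rho> c (\<lambda>t s'. t \<le> \<tau> \<and> s' ix_a 0 = k \<and> s' 0 1 = m \<and> I (Suc k) s') s"
    and final: "\<And>t s. I m s \<Longrightarrow> t \<le> 2 + m * (\<tau> + 2) \<Longrightarrow> Q t s"
  shows "wp w \<rho> (for_edges c) Q s"
proof -
  let ?I = "\<lambda>k s. I k s \<and> k \<le> m \<and> s ix_a 0 = k \<and> s 0 1 = m"
  show ?thesis
    unfolding for_edges_def wp_Seq wp_Store
  proof (rule wp_While[where I = ?I and N = m and \<tau> = "\<tau> + 1"])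
    fix k s assume "?I k s" "holds w \<rho> s (Less (var ix_a) mX)"
    hence I: "I k s" "k < m" "s ix_a 0 = k" "s 0 1 = m" using m by auto
    show "wp w \<rho> (c ;; incr ix_a) (\<lambda>t s'. t \<le> \<tau> + 1 \<and> ?I (Suc k) s') s"
      unfolding wp_Seq
      by (rule wp_mono[OF step[OF I]]) (use I m ix in auto)
  next
    show "?I 0 (s(ix_a := (s ix_a)(eval w s (Const 0) := eval w s (Const 0))))"
      using init ix m by auto
  next
    fix k t s assume "?I k s" "\<not> holds w \<rho> s (Less (var ix_a) mX)" "t \<le> 1 + m * (\<tau> + 1 + 1)"
    thus "Q (1 + t) s" using final[of s "1+t"] m by auto
  qed simp
qed

section \<open>Growing a ball\<close>

lemma ln_1_plus_ge: 
  fixes x :: real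
  assumes "0 \<le> x" "x \<le> 1"
  shows "x / 2 \<le> ln (1 + x)"
proof -
  have "ln (1 / (1 + x)) \<le> 1 / (1 + x) - 1" using assms by (intro ln_le_minus_one) auto
  moreover have "ln (1 / (1 + x)) = - ln (1 + x)" using assms by (simp add: ln_div)
  moreover have "1 / (1 + x) - 1 = - (x / (1 + x))" using assms by (simp add: field_simps)
  moreover have "x / 2 \<le> x / (1 + x)" using assms by (intro divide_left_mono) auto
  ultimately show ?thesis by linarith
qed

section \<open>Volumes, boundaries and discovery trees of a list of edges\<close>

locale edges =
  fixes m :: nat and eu ev :: "nat \<Rightarrow> nat"
  assumes m: "0 < m" and loopfree: "\<And>i. i < m \<Longrightarrow> eu i \<noteq> ev i"
begin

text \<open>Volumes are counted as numbers of edge ends, so that nothing depends on the degrees.\<close>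

definition vl :: "nat set \<Rightarrow> nat" where
  "vl S = (\<Sum>i<m. of_bool (eu i \<in> S) + of_bool (ev i \<in> S))"

definition ct :: "nat set \<Rightarrow> nat" where
  "ct S = (\<Sum>i<m. of_bool ((eu i \<in> S) \<noteq> (ev i \<in> S)))"

text \<open>Edges that touch \<open>R\<close> are left out because they have been charged when
  \<open>R\<close> was cut off: an edge leaving \<open>R \<union> S\<close> either leaves
  \<open>R\<close>, or avoids \<open>R\<close> and leaves \<open>S\<close>.\<close>

definition ctr :: "nat set \<Rightarrow> nat set \<Rightarrow> nat" where
  "ctr R S = (\<Sum>i<m. of_bool ((eu i \<in> S) \<noteq> (ev i \<in> S) \<and> eu i \<notin> R \<and> ev i \<notin> R))"

definition ends :: "nat set" where
  "ends = eu ` {..<m} \<union> ev ` {..<m}"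

definition labelled :: "(nat \<Rightarrow> nat) \<Rightarrow> nat set" where
  "labelled D = {v. D v \<noteq> 0}"

lemma vl_Un: "S \<inter> T = {} \<Longrightarrow> vl (S \<union> T) = vl S + vl T"
  unfolding vl_def sum.distrib[symmetric] by (rule sum.cong) auto

lemma vl_mono: "S \<subseteq> T \<Longrightarrow> vl S \<le> vl T"
  unfolding vl_def by (rule sum_mono) auto

lemma vl_le: "vl S \<le> 2 * m"
proof -
  have "vl S \<le> (\<Sum>i<m. 2)" unfolding vl_def by (rule sum_mono) auto
  thus ?thesis by simp
qed

lemma vl_compl: "vl S + vl (- S) = 2 * m"
proof -
  have "vl S + vl (- S) = (\<Sum>i<m. 2)" unfolding vl_def sum.distrib[symmetric] by (rule sum.cong) auto
  thus ?thesis by simp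
qed

lemma vl_cong: "(\<And>v. v \<in> ends \<Longrightarrow> v \<in> S \<longleftrightarrow> v \<in> T) \<Longrightarrow> vl S = vl T"
  unfolding vl_def by (rule sum.cong) (auto simp: ends_def)

lemma ct_cong: "(\<And>v. v \<in> ends \<Longrightarrow> v \<in> S \<longleftrightarrow> v \<in> T) \<Longrightarrow> ct S = ct T"
  unfolding ct_def by (rule sum.cong) (auto simp: ends_def)

lemma vl_pos: "v \<in> ends \<Longrightarrow> v \<in> S \<Longrightarrow> 0 < vl S"
  unfolding vl_def ends_def by (auto intro!: sum_pos2)

lemma vl_empty [simp]: "vl {} = 0"
  by (simp add: vl_def)

lemma ct_empty [simp]: "ct {} = 0"
  by (simp add: ct_def)

lemma vl_sum:
  assumes "finite S" shows "vl S = (\<Sum>x\<in>S. vl {x})"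
  using assms
proof (induction S)
  case (insert x S)
  have "vl (insert x S) = vl ({x} \<union> S)" by simp
  also have "\<dots> = vl {x} + vl S" using insert by (intro vl_Un) auto
  finally show ?case using insert by simp
qed simp

text \<open>Labels are the radii in force when the vertices were reached, which may exceed the true
  distances when steps are wide; hence only the inequality \<open>D p + l \<le> D\<close> is kept
  along a parent edge. It is the direction that bounds the cost of flow sent towards the
  root.\<close>

definition tree ::
  "(nat \<Rightarrow> nat) \<Rightarrow> nat \<Rightarrow> (nat \<Rightarrow> nat) \<Rightarrow> (nat \<Rightarrow> nat) \<Rightarrow> (nat \<Rightarrow> nat) \<Rightarrow> nat \<Rightarrow> bool" where
  "tree l rt D P O' c \<longleftrightarrow> 0 < c \<and> O' 0 = rt \<and> rt \<in> ends \<and> inj_on O' {..<c} \<and>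
    O' ` {..<c} = labelled D \<and>
    (\<forall>j. 0 < j \<and> j < c \<longrightarrow> P (O' j) < m \<and>
      (\<exists>p. p \<in> O' ` {..<j} \<and> {eu (P (O' j)), ev (P (O' j))} = {O' j, p} \<and>
        D p + l (P (O' j)) \<le> D (O' j)))"

lemma tree_insert:
  assumes t: "tree l rt D P O' c" and D: "D x \<noteq> 0" "D y = 0" "D x + l i \<le> r" "0 < r"
    and i: "i < m" "{eu i, ev i} = {x, y}"
  shows "tree l rt (D(y := r)) (P(y := i)) (O'(c := y)) (Suc c)"
proof -
  have im: "O' ` {..<c} = labelled D" and inj: "inj_on O' {..<c}" and c: "0 < c" "O' 0 = rt" "rt \<in> ends"
    using t by (auto simp: tree_def)
  have y: "y \<notin> O' ` {..<c}" using im D by (auto simp: labelled_def)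
  have im2: "(O'(c := y)) ` {..<Suc c} = insert y (O' ` {..<c})"
    by (auto simp: lessThan_Suc)
  have *: "(O'(c := y)) ` {..<j} = O' ` {..<j}" if "j \<le> c" for j using that by auto
  show ?thesis
    unfolding tree_def
  proof (intro conjI allI impI)
    show "inj_on (O'(c := y)) {..<Suc c}"
      using inj y by (auto simp: lessThan_Suc inj_on_def)
    show "(O'(c := y)) ` {..<Suc c} = labelled (D(y := r))"
      unfolding im2 im using D by (auto simp: labelled_def)
    fix j assume j: "0 < j \<and> j < Suc c"
    show "(P(y := i)) ((O'(c := y)) j) < m"
      using j t i y by (auto simp: tree_def)
    show "\<exists>p. p \<in> (O'(c := y)) ` {..<j} \<and>
        {eu ((P(y := i)) ((O'(c := y)) j)), ev ((P(y := i)) ((O'(c := y)) j))} = {(O'(c := y)) j, p} \<and>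
        (D(y := r)) p + l ((P(y := i)) ((O'(c := y)) j)) \<le> (D(y := r)) ((O'(c := y)) j)"
    proof (cases "j = c")
      case True
      have "x \<in> O' ` {..<c}" using im D by (auto simp: labelled_def)
      thus ?thesis using True * D i by (intro exI[of _ x]) auto
    next
      case False
      hence jc: "j < c" using j by simp
      then obtain p where p: "p \<in> O' ` {..<j}" "{eu (P (O' j)), ev (P (O' j))} = {O' j, p}"
        "D p + l (P (O' j)) \<le> D (O' j)" using t j unfolding tree_def by blast
      have "O' j \<noteq> y" "p \<noteq> y" using p y jc by auto
      thus ?thesis using p jc * False by (intro exI[of _ p]) auto
    qed
  qed (use c in auto)
qed

lemma tree_labelled_ends:
  assumes "tree l rt D P O' c" shows "labelled D \<subseteq> ends"
proof
  fix v assume "v \<in> labelled D"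
  then obtain j where j: "j < c" "v = O' j" using assms by (auto simp: tree_def)
  show "v \<in> ends"
  proof (cases "j = 0")
    case False
    then obtain p where "P v < m" "{eu (P v), ev (P v)} = {v, p}"
      using assms j unfolding tree_def by auto
    hence "v = eu (P v) \<or> v = ev (P v)" by auto
    thus ?thesis using \<open>P v < m\<close> by (auto simp: ends_def)
  qed (use assms j in \<open>auto simp: tree_def\<close>)
qed

lemma tree_root:
  assumes "tree l rt D P O' c" shows "rt \<in> labelled D"
  using assms unfolding tree_def by (metis image_eqI lessThan_iff)

text \<open>Two vertices with the same parent edge would be parents of each other, and with positive
  lengths each label would be smaller than the other. Consequently an edge carries flow from one
  vertex only.\<close>

lemma tree_parent_inj:
  assumes t: "tree l rt D P O' c" and l: "\<And>i. 0 < l i"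
    and j: "0 < j" "j < c" and k: "0 < k" "k < c" and e: "P (O' j) = P (O' k)"
  shows "j = k"
proof -
  let ?i = "P (O' j)"
  obtain p where p: "{eu ?i, ev ?i} = {O' j, p}" "D p + l ?i \<le> D (O' j)"
    using t j by (auto simp: tree_def)
  obtain p' where p': "{eu ?i, ev ?i} = {O' k, p'}" "D p' + l ?i \<le> D (O' k)"
    using t k e by (auto simp: tree_def)
  have "O' j = O' k"
  proof (rule ccontr)
    assume "O' j \<noteq> O' k"
    hence "p = O' k" "p' = O' j" using p(1) p'(1) by (metis doubleton_eq_iff)+
    thus False using p(2) p'(2) l[of ?i] by simp
  qed
  thus ?thesis using t j k by (auto simp: tree_def inj_on_def)
qed

end

section \<open>The number of steps in which a ball can grow\<close>

locale growth = edges +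
  fixes \<psi> :: real
  assumes psi: "0 < \<psi>" "\<psi> \<le> 1"
begin

text \<open>The length of edge \<open>i\<close> covered by the ball of radius \<open>r\<close>, and the length not yet covered.\<close>

definition used :: "(nat \<Rightarrow> nat) \<Rightarrow> nat set \<Rightarrow> (nat \<Rightarrow> nat) \<Rightarrow> nat \<Rightarrow> nat \<Rightarrow> nat" where
  "used l R D r i =
    (if eu i \<in> R \<or> ev i \<in> R then 0
     else if D (eu i) \<noteq> 0 \<and> D (ev i) \<noteq> 0 then l i
     else if D (eu i) \<noteq> 0 then r - D (eu i)
     else if D (ev i) \<noteq> 0 then r - D (ev i) else 0)"

definition rest :: "(nat \<Rightarrow> nat) \<Rightarrow> (nat \<Rightarrow> nat) \<Rightarrow> nat \<Rightarrow> nat \<Rightarrow> nat" where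
  "rest l D r i =
    (if D (eu i) \<noteq> 0 \<and> D (ev i) \<noteq> 0 then 0
     else if D (eu i) \<noteq> 0 then D (eu i) + l i - r
     else if D (ev i) \<noteq> 0 then D (ev i) + l i - r else l i)"

text \<open>Strictness leaves an uncovered unit on every boundary edge outside \<open>R\<close>. A
  step of width 1 therefore covers at least one more unit on each of them, which is how the boundary
  size turns into covered length.\<close>

definition saturated :: "(nat \<Rightarrow> nat) \<Rightarrow> nat set \<Rightarrow> (nat \<Rightarrow> nat) \<Rightarrow> nat \<Rightarrow> bool" where
  "saturated l R D r \<longleftrightarrow> (\<forall>i<m. eu i \<notin> R \<and> ev i \<notin> R \<longrightarrow>
    (D (eu i) \<noteq> 0 \<and> D (ev i) = 0 \<longrightarrow> r < D (eu i) + l i) \<and>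
    (D (ev i) \<noteq> 0 \<and> D (eu i) = 0 \<longrightarrow> r < D (ev i) + l i))"

abbreviation "out D \<equiv> vl (- labelled D)"

text \<open>The budget of both stages together. In the first, \<open>f \<le> 6 * m\<close>, being at
  most 1 plus the total length. In the second, the uncovered length divided by \<open>m\<close> is
  at most 5 and the outer volume is at most \<open>m\<close>. The sixth unit pays for the step that
  leads from one stage to the other.\<close>

definition potl :: real where
  "potl = ln (6 * m) + 6 + ln (3 * m)"

text \<open>While the ball \<open>labelled D\<close> has less than half of the volume, it stays outside the removed
  set \<open>R\<close>, and \<open>f\<close> grows by the factor \<open>1 + \<psi>\<close> in each of the \<open>q\<close> steps.  Afterwards
  the potential is the length not yet covered, divided by \<open>m\<close>, plus the logarithm of the outer
  volume.  A step of width \<open>2m div out D\<close> adds at most \<open>2m\<close> to the sum of all distances,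
  however few vertices are left outside.\<close>

definition grow ::
  "(nat \<Rightarrow> nat) \<Rightarrow> nat set \<Rightarrow> nat \<Rightarrow> (nat \<Rightarrow> nat) \<Rightarrow> (nat \<Rightarrow> nat) \<Rightarrow> (nat \<Rightarrow> nat) \<Rightarrow> nat \<Rightarrow> nat \<Rightarrow> nat \<Rightarrow> nat
    \<Rightarrow> bool" where
  "grow l R rt D P O' c r f q \<longleftrightarrow>
    tree l rt D P O' c \<and> (\<forall>v. D v \<le> r) \<and> 0 < r \<and>
    (\<Sum>i<m. D (eu i) + D (ev i)) + out D * r \<le> 2 * m * (q + 1) \<and>
    r \<le> 1 + 2 * m * q \<and>
    0 < f \<and>
    (m < out D \<longrightarrow> labelled D \<inter> R = {} \<and> saturated l R D r \<and>
      f \<le> 1 + (\<Sum>i<m. used l R D r i) \<and> q * \<psi> / 2 \<le> ln f) \<and>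
    (out D \<le> m \<longrightarrow> q * \<psi> / 2 \<le> potl - real (\<Sum>i<m. rest l D r i) / m - ln (1 + real (out D)))"

lemma used_le: "saturated l R D r \<Longrightarrow> i < m \<Longrightarrow> used l R D r i \<le> l i"
  unfolding saturated_def used_def by (auto simp: less_imp_le_nat)

lemma sum_used_le: "saturated l R D r \<Longrightarrow> (\<Sum>i<m. used l R D r i) \<le> (\<Sum>i<m. l i)"
  by (intro sum_mono used_le) auto

lemma rest_le: "(\<And>v. D v \<le> r) \<Longrightarrow> (\<Sum>i<m. rest l D r i) \<le> (\<Sum>i<m. l i)"
  by (intro sum_mono) (auto simp: rest_def le_diff_conv)

lemma grow_f_le:
  assumes "grow l R rt D P O' c r f q" "m < out D" "(\<Sum>i<m. l i) \<le> 5 * m"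
  shows "f \<le> 6 * m"
proof -
  have "f \<le> 1 + (\<Sum>i<m. l i)" using assms sum_used_le[of l R D r] by (auto simp: grow_def)
  thus ?thesis using assms m by linarith
qed

lemma grow_bound:
  assumes g: "grow l R rt D P O' c r f q" and l: "(\<Sum>i<m. l i) \<le> 5 * m"
  shows "q * \<psi> / 2 \<le> potl"
proof (cases "m < out D")
  case True
  have "ln (real f) \<le> ln (6 * m)" using grow_f_le[OF g True l] g by (auto simp: grow_def)
  moreover have "0 \<le> ln (3 * real m)" using m by simp
  ultimately show ?thesis using g True by (auto simp: grow_def potl_def)
next
  case False
  have "0 \<le> real (\<Sum>i<m. rest l D r i) / m" "0 \<le> ln (1 + real (out D))"
    by (auto intro!: divide_nonneg_nonneg sum_nonneg)
  thus ?thesis using g False unfolding grow_def by linarith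
qed

lemma grow_init:
  assumes D: "D = (\<lambda>v. if v = rt then 1 else 0)" "O' 0 = rt" "rt \<in> ends" "rt \<notin> R"
    and l: "\<And>i. 0 < l i" "(\<Sum>i<m. l i) \<le> 5 * m"
  shows "grow l R rt D P O' 1 1 1 0"
proof -
  have lab: "labelled D = {rt}" using D by (auto simp: labelled_def)
  have s: "(\<Sum>i<m. D (eu i) + D (ev i)) = vl {rt}"
    unfolding vl_def by (rule sum.cong) (auto simp: D)
  have sat: "saturated l R D 1" using l by (auto simp: saturated_def D)
  have r: "real (\<Sum>i<m. rest l D 1 i) \<le> 5 * m" 
  proof -
    have "(\<Sum>i<m. rest l D 1 i) \<le> 5 * m" 
      using rest_le[of D 1 l] l(2) by (metis D(1) le_refl le_trans zero_le_one)
    thus ?thesis by (simp only: of_nat_le_iff)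
  qed
  have m0: "0 \<le> ln (real (6 * m))" using m by simp
  have "ln (1 + real (out D)) \<le> ln (3 * m)" if "out D \<le> m" using that m by simp
  moreover have "real (\<Sum>i<m. rest l D 1 i) / m \<le> 5" using r m by (simp add: field_simps)
  ultimately have "0 \<le> potl - real (\<Sum>i<m. rest l D 1 i) / m - ln (1 + real (out D))"
    if "out D \<le> m"
    using m0 that unfolding potl_def by linarith
  moreover have "vl {rt} + out D = 2 * m" using vl_compl[of "{rt}"] lab by simp
  ultimately show ?thesis
    unfolding grow_def s using D sat lab by (auto simp: tree_def lessThan_Suc)
qed

text \<open>In the first stage each boundary edge counted by \<open>ctr\<close> gains a covered
  unit, so \<open>f\<close> may grow by \<open>ctr\<close>, a fraction of at least \<psi>. In the
  second stage a boundary edge either stays on the boundary and loses a full step of uncovered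
  length, or its outer end joins the ball and lowers the outer volume. The sums \<open>?a\<close>
  and \<open>?c\<close> count the two kinds, and the two terms of the potential pay for
  them.\<close>

lemma grow_step:
  assumes g: "grow l R rt D P O' c r f q"
    and l: "\<And>i. 0 < l i" "(\<Sum>i<m. l i) \<le> 5 * m"
    and u: "0 < out D"
    and r': "r' = r + 2 * m div out D"
    and f': "f' = (if m < out D then f + ctr R (labelled D) else f)"
    and go: "if m < out D then \<psi> * f \<le> ctr R (labelled D) else \<psi> * out D \<le> ct (labelled D)"
    and tr: "tree l rt D' P' O2 c'"
    and old: "\<And>v. D v \<noteq> 0 \<Longrightarrow> D' v = D v"
    and new: "\<And>v. D v = 0 \<Longrightarrow> D' v = 0 \<or> D' v = r' \<and> (m < out D \<longrightarrow> v \<notin> R)"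
    and relaxed: "\<And>i x y. i < m \<Longrightarrow> (x = eu i \<and> y = ev i \<or> x = ev i \<and> y = eu i) \<Longrightarrow> D x \<noteq> 0 \<Longrightarrow>
       (m < out D \<Longrightarrow> y \<notin> R) \<Longrightarrow> D x + l i \<le> r' \<Longrightarrow> D' y \<noteq> 0"
  shows "grow l R rt D' P' O2 c' r' f' (q + 1)"
proof -
  let ?s = "2 * m div out D" and ?u = "out D" and ?u' = "out D'"
  have Dr: "\<And>v. D v \<le> r" and r0: "0 < r"
    and cost: "(\<Sum>i<m. D (eu i) + D (ev i)) + ?u * r \<le> 2 * m * (q + 1)"
    and rq: "r \<le> 1 + 2 * m * q" and f0: "0 < f"
    using g by (auto simp: grow_def)
  have s1: "1 \<le> ?s" using vl_le[of "- labelled D"] u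
    by (metis One_nat_def Suc_leI div_greater_zero_iff)
  have lab_mono: "labelled D \<subseteq> labelled D'" using old by (auto simp: labelled_def)
  have u'u: "?u' \<le> ?u" using lab_mono by (intro vl_mono) auto
  have D'r: "D' v \<le> r'" for v using old[of v] new[of v] Dr[of v] r' by (cases "D v = 0") (auto intro: le_trans)
  have L: "\<And>v. v \<in> labelled D \<longleftrightarrow> D v \<noteq> 0" "\<And>v. v \<in> labelled D' \<longleftrightarrow> D' v \<noteq> 0"
    by (auto simp: labelled_def)
  have rr: "r + 1 \<le> r'" using r' s1 by simp
  \<comment> \<open>Unlabelled vertices are charged the current radius, which is exactly the label
    they would receive now. So labelling leaves the total unchanged and only the increase of the
    radius costs.\<close>
  have pt: "D' v + of_bool (v \<in> - labelled D') * r' = D v + of_bool (v \<in> - labelled D) * r'" for v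
    using old[of v] new[of v] rr by (auto simp: L)
  have "(\<Sum>i<m. D' (eu i) + D' (ev i)) + ?u' * r' = (\<Sum>i<m. D (eu i) + D (ev i)) + ?u * r'"
    unfolding vl_def sum_distrib_right sum.distrib[symmetric]
  proof (rule sum.cong[OF refl])
    fix i
    show "D' (eu i) + D' (ev i) + (of_bool (eu i \<in> - labelled D') + of_bool (ev i \<in> - labelled D')) * r' =
       D (eu i) + D (ev i) + (of_bool (eu i \<in> - labelled D) + of_bool (ev i \<in> - labelled D)) * r'"
      using pt[of "eu i"] pt[of "ev i"] unfolding distrib_right by linarith
  qed
  also have "\<dots> = (\<Sum>i<m. D (eu i) + D (ev i)) + ?u * r + ?u * ?s" by (simp add: r' distrib_left)
  also have "\<dots> \<le> 2 * m * (q + 1) + 2 * m"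
    using cost times_div_less_eq_dividend[of ?u "2 * m"] by linarith
  finally have cost': "(\<Sum>i<m. D' (eu i) + D' (ev i)) + ?u' * r' \<le> 2 * m * (q + 1 + 1)" by simp
  have "?s \<le> 2 * m" by simp
  hence rq': "r' \<le> 1 + 2 * m * (q + 1)" using rq r' by (simp only: distrib_left)
  have rst: "real (\<Sum>i<m. rest l D' r' i) / m \<le> 5"
  proof -
    have "real (\<Sum>i<m. rest l D' r' i) \<le> 5 * m"
      using rest_le[of D' r' l] D'r l(2) by (metis le_trans of_nat_le_iff)
    thus ?thesis using m by (simp add: field_simps)
  qed
  have stage1: "labelled D' \<inter> R = {} \<and> saturated l R D' r' \<and>
      f' \<le> 1 + (\<Sum>i<m. used l R D' r' i) \<and> (q + 1) * \<psi> / 2 \<le> ln f'" if "m < ?u'"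
  proof (intro conjI)
    have mu: "m < ?u" using that u'u by simp
    hence s: "?s = 1" using vl_le[of "- labelled D"] by (simp add: div_nat_eqI)
    have sat: "saturated l R D r" and dis: "labelled D \<inter> R = {}"
      and f: "f \<le> 1 + (\<Sum>i<m. used l R D r i)" and qf: "q * \<psi> / 2 \<le> ln f"
      using g mu by (auto simp: grow_def)
    show "labelled D' \<inter> R = {}" using dis old new mu by (force simp: labelled_def)
    show "saturated l R D' r'"
      unfolding saturated_def
    proof (intro allI impI)
      fix i assume i: "i < m" "eu i \<notin> R \<and> ev i \<notin> R"
      have *: "r' < D' x + l i" if "x = eu i \<and> y = ev i \<or> x = ev i \<and> y = eu i" "D' x \<noteq> 0" "D' y = 0" for x y
      proof (cases "D x = 0")
        case True
        thus ?thesis using new[OF True] that l(1)[of i] by auto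
      next
        case False
        have "y \<notin> R" using that(1) i by auto
        hence "\<not> D x + l i \<le> r'" using relaxed[OF i(1) that(1) False] that(3) by auto
        thus ?thesis using old[OF False] by simp
      qed
      show "(D' (eu i) \<noteq> 0 \<and> D' (ev i) = 0 \<longrightarrow> r' < D' (eu i) + l i) \<and>
            (D' (ev i) \<noteq> 0 \<and> D' (eu i) = 0 \<longrightarrow> r' < D' (ev i) + l i)"
        using *[of "eu i" "ev i"] *[of "ev i" "eu i"] by auto
    qed
    have "used l R D r i + of_bool ((eu i \<in> labelled D) \<noteq> (ev i \<in> labelled D) \<and> eu i \<notin> R \<and> ev i \<notin> R)
        \<le> used l R D' r' i" if i: "i < m" for i
    proof (cases "eu i \<notin> R \<and> ev i \<notin> R")
      case True
      have "D (eu i) \<noteq> 0 \<Longrightarrow> D (ev i) = 0 \<Longrightarrow> r < D (eu i) + l i"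
           "D (ev i) \<noteq> 0 \<Longrightarrow> D (eu i) = 0 \<Longrightarrow> r < D (ev i) + l i"
        using sat True i by (auto simp: saturated_def)
      thus ?thesis
        using True old[of "eu i"] old[of "ev i"] new[of "eu i"] new[of "ev i"] s r' Dr[of "eu i"] Dr[of "ev i"]
        by (cases "D (eu i) = 0"; cases "D (ev i) = 0") (auto simp: used_def L)
    qed (auto simp: used_def)
    hence "(\<Sum>i<m. used l R D r i) + ctr R (labelled D) \<le> (\<Sum>i<m. used l R D' r' i)"
      unfolding ctr_def sum.distrib[symmetric] by (intro sum_mono) auto
    thus "f' \<le> 1 + (\<Sum>i<m. used l R D' r' i)" using f f' mu by simp
    have "real f * (1 + \<psi>) \<le> f'" using go mu by (simp add: f' algebra_simps)
    hence "ln (real f * (1 + \<psi>)) \<le> ln (real f')" using f0 psi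
      by (subst ln_le_cancel_iff) (auto simp: f')
    moreover have "ln (real f * (1 + \<psi>)) = ln f + ln (1 + \<psi>)" using f0 psi by (simp add: ln_mult)
    ultimately show "(q + 1) * \<psi> / 2 \<le> ln f'" using qf ln_1_plus_ge[of \<psi>] psi by (simp add: algebra_simps)
  qed
  have stage2: "(q + 1) * \<psi> / 2 \<le> potl - real (\<Sum>i<m. rest l D' r' i) / m - ln (1 + real ?u')" if u'm: "?u' \<le> m"
  proof (cases "m < ?u")
    case True
    \<comment> \<open>This step crosses half of the volume. The uncovered length is bounded afresh
      by \<open>5 * m\<close>, and the reserve in \<open>potl\<close> also absorbs the \<psi> / 2 of
      the step itself.\<close>
    have "q * \<psi> / 2 \<le> ln f" using g True by (auto simp: grow_def)
    moreover have "ln (real f) \<le> ln (6 * m)" using grow_f_le[OF g True l(2)] f0 by auto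
    moreover have "ln (1 + real ?u') \<le> ln (3 * m)" using u'm m by simp
    ultimately show ?thesis using rst psi unfolding potl_def by (simp add: algebra_simps add_divide_distrib)
  next
    case False
    let ?a = "\<Sum>i<m. of_bool ((eu i \<in> labelled D) \<noteq> (ev i \<in> labelled D) \<and> \<not> (D' (eu i) \<noteq> 0 \<and> D' (ev i) \<noteq> 0)) :: nat"
    let ?c = "\<Sum>i<m. of_bool ((eu i \<in> labelled D) \<noteq> (ev i \<in> labelled D) \<and> D' (eu i) \<noteq> 0 \<and> D' (ev i) \<noteq> 0) :: nat"
    have ac: "ct (labelled D) = ?a + ?c"
      unfolding ct_def sum.distrib[symmetric] by (rule sum.cong) auto
    have "of_bool (eu i \<in> - labelled D') + of_bool (ev i \<in> - labelled D') +
       of_bool ((eu i \<in> labelled D) \<noteq> (ev i \<in> labelled D) \<and> D' (eu i) \<noteq> 0 \<and> D' (ev i) \<noteq> 0)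
        \<le> (of_bool (eu i \<in> - labelled D) + of_bool (ev i \<in> - labelled D) :: nat)" if "i < m" for i
      using old[of "eu i"] old[of "ev i"] by (auto simp: L)
    hence c: "?u' + ?c \<le> ?u"
      unfolding vl_def sum.distrib[symmetric] by (intro sum_mono) auto
    have a1: "rest l D' r' i + ?s * of_bool ((eu i \<in> labelled D) \<noteq> (ev i \<in> labelled D) \<and> \<not> (D' (eu i) \<noteq> 0 \<and> D' (ev i) \<noteq> 0))
         \<le> rest l D r i" if i: "i < m" for i
    proof -
      have 1: "D (eu i) \<noteq> 0 \<Longrightarrow> D' (ev i) = 0 \<Longrightarrow> r' < D (eu i) + l i"
        using relaxed[of i "eu i" "ev i"] i False by force
      have 2: "D (ev i) \<noteq> 0 \<Longrightarrow> D' (eu i) = 0 \<Longrightarrow> r' < D (ev i) + l i"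
        using relaxed[of i "ev i" "eu i"] i False by force
      have 3: "D (eu i) = 0 \<Longrightarrow> D' (eu i) = 0 \<or> D' (eu i) = r'" "D (ev i) = 0 \<Longrightarrow> D' (ev i) = 0 \<or> D' (ev i) = r'"
        using new by blast+
      show ?thesis
        using 1 2 3 old[of "eu i"] old[of "ev i"] r'
        by (cases "D (eu i) = 0"; cases "D (ev i) = 0") (auto simp: rest_def L)
    qed
    have a: "(\<Sum>i<m. rest l D' r' i) + ?s * ?a \<le> (\<Sum>i<m. rest l D r i)"
      unfolding sum_distrib_left sum.distrib[symmetric] by (intro sum_mono a1) auto
    \<comment> \<open>Rounding down \<open>2 * m div ?u\<close> costs at most a factor 2, because
      the quotient is at least 1. Hence the step width is at least \<open>m / ?u\<close>.\<close>
    have half: "k \<le> n * d" if "2 * k < n * (d + 1)" "1 \<le> d" for k n d :: nat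
    proof -
      have "n * (d + 1) \<le> n * (d + d)" using that by (intro mult_left_mono) auto
      also have "\<dots> = 2 * (n * d)" by simp
      finally show ?thesis using that(1) by linarith
    qed
    have "2 * m < ?u * (?s + 1)" using dividend_less_times_div[OF u, of "2 * m"] by simp
    hence "m \<le> ?u * ?s" using s1 by (rule half)
    hence "real m \<le> real ?u * real ?s" unfolding of_nat_mult[symmetric] by (rule of_nat_mono)
    hence "1 / real ?u \<le> real ?s / m" using u m by (simp add: field_simps)
    hence "real ?a * (1 / ?u) \<le> real ?a * (real ?s / m)" by (intro mult_left_mono) auto
    also have "\<dots> \<le> real (\<Sum>i<m. rest l D r i) / m - real (\<Sum>i<m. rest l D' r' i) / m"
    proof -
      have "real (\<Sum>i<m. rest l D' r' i) + real ?s * real ?a \<le> real (\<Sum>i<m. rest l D r i)"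
        using of_nat_mono[OF a, where 'a = real] by (simp only: of_nat_add of_nat_mult)
      thus ?thesis using m by (simp add: field_simps)
    qed
    finally have A: "real ?a / ?u \<le> real (\<Sum>i<m. rest l D r i) / m - real (\<Sum>i<m. rest l D' r' i) / m"
      by simp
    \<comment> \<open>The drop of the logarithm is at least the relative loss of volume. The summand
      1 keeps it defined at outer volume 0 and costs a factor 2 only, as \<open>?u\<close> is at
      least 1.\<close>
    have "ln ((1 + real ?u') / (1 + ?u)) \<le> (1 + real ?u') / (1 + ?u) - 1"
      by (intro ln_le_minus_one) auto
    hence "ln (1 + real ?u') - ln (1 + real ?u) \<le> (1 + real ?u') / (1 + ?u) - 1"
      by (simp add: ln_div)
    also have "\<dots> = - ((real ?u - ?u') / (1 + ?u))" by (simp add: field_simps)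
    finally have "(real ?u - ?u') / (1 + ?u) \<le> ln (1 + real ?u) - ln (1 + real ?u')" by simp
    moreover have "real ?c / (2 * ?u) \<le> (real ?u - ?u') / (1 + ?u)"
    proof (rule frac_le)
      show "real ?c \<le> real ?u - ?u'" using c by linarith
    qed (use u u'u in auto)
    ultimately have C: "real ?c / (2 * ?u) \<le> ln (1 + real ?u) - ln (1 + real ?u')" by simp
    have "\<psi> * real ?u \<le> real ?a + real ?c" using go False ac by simp
    hence "\<psi> / 2 \<le> real ?a / (2 * ?u) + real ?c / (2 * ?u)" using u by (simp add: field_simps)
    moreover have "real ?a / (2 * ?u) \<le> real ?a / ?u" using u by (simp add: field_simps)
    ultimately have "\<psi> / 2 \<le> (real (\<Sum>i<m. rest l D r i) / m - real (\<Sum>i<m. rest l D' r' i) / m)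
        + (ln (1 + real ?u) - ln (1 + real ?u'))" using A C by linarith
    moreover have "q * \<psi> / 2 \<le> potl - real (\<Sum>i<m. rest l D r i) / m - ln (1 + real ?u)"
      using g False by (auto simp: grow_def)
    ultimately show ?thesis by (simp add: algebra_simps add_divide_distrib)
  qed
  have "0 < f'" using f0 f' by simp
  moreover have "0 < r'" using rr by simp
  ultimately show ?thesis
    unfolding grow_def using tr D'r cost' rq' stage1 stage2 by blast
qed

end

section \<open>Routing all edge ends of the ball to the root\<close>

context edges
begin

text \<open>Every edge end sends one unit to the root.  The vertices are processed in reverse order
  of discovery; \<open>S\<close> holds the flow collected at the unprocessed vertices, \<open>C\<close> the flow on the
  edges.\<close>

abbreviation cross :: "nat set \<Rightarrow> nat \<Rightarrow> nat" where
  "cross X i \<equiv> of_bool ((eu i \<in> X) \<noteq> (ev i \<in> X))"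

definition pushed ::
  "(nat \<Rightarrow> nat) \<Rightarrow> (nat \<Rightarrow> nat) \<Rightarrow> (nat \<Rightarrow> nat) \<Rightarrow> (nat \<Rightarrow> nat) \<Rightarrow> nat \<Rightarrow> nat \<Rightarrow> (nat \<Rightarrow> nat) \<Rightarrow>
    (nat \<Rightarrow> nat) \<Rightarrow> bool" where
  "pushed l D P O' c j S C \<longleftrightarrow>
    (\<forall>X. vl (X \<inter> labelled D) \<le> (\<Sum>i<m. cross X i * C i) + (\<Sum>x \<in> O' ` {..<j} \<inter> X. S x)) \<and>
    (\<Sum>i<m. C i * l i) + (\<Sum>x \<in> O' ` {..<j}. S x * D x) \<le> (\<Sum>i<m. D (eu i) + D (ev i)) \<and>
    (\<Sum>x \<in> O' ` {..<j}. S x) \<le> 2 * m \<and>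
    (\<forall>i<m. C i \<le> 2 * m \<and> (C i \<noteq> 0 \<longrightarrow> (\<exists>k. j \<le> k \<and> k < c \<and> i = P (O' k))))"

lemma sum_labels:
  assumes "finite (labelled D)"
  shows "(\<Sum>x\<in>labelled D. vl {x} * D x) = (\<Sum>i<m. D (eu i) + D (ev i))"
proof -
  have *: "(\<Sum>x\<in>labelled D. of_bool (v = x) * D x) = D v" for v
  proof -
    have "(\<Sum>x\<in>labelled D. of_bool (v = x) * D x) = (\<Sum>x\<in>labelled D. if v = x then D x else 0)"
      by (rule sum.cong) auto
    also have "\<dots> = D v" using assms by (auto simp: labelled_def)
    finally show ?thesis .
  qed
  have "(\<Sum>x\<in>labelled D. vl {x} * D x) =
      (\<Sum>x\<in>labelled D. \<Sum>i<m. of_bool (eu i = x) * D x + of_bool (ev i = x) * D x)"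
    by (simp add: vl_def sum_distrib_right distrib_right del: of_bool_eq_iff)
  also have "\<dots> = (\<Sum>i<m. \<Sum>x\<in>labelled D. of_bool (eu i = x) * D x + of_bool (ev i = x) * D x)"
    by (rule sum.swap)
  also have "\<dots> = (\<Sum>i<m. D (eu i) + D (ev i))" by (simp add: sum.distrib *)
  finally show ?thesis .
qed

lemma pushed_init:
  assumes t: "tree l rt D P O' c" and S: "\<And>x. x \<in> ends \<Longrightarrow> S x = vl {x}" and C: "\<And>i. i < m \<Longrightarrow> C i = 0"
  shows "pushed l D P O' c c S C"
proof -
  have L: "O' ` {..<c} = labelled D" using t by (auto simp: tree_def)
  hence fin: "finite (labelled D)" by (metis finite_imageI finite_lessThan)
  have S': "S x = vl {x}" if "x \<in> labelled D" for x
    using S tree_labelled_ends[OF t] that by blast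
  have "(\<Sum>x\<in>labelled D \<inter> X. S x) = vl (labelled D \<inter> X)" for X
    using fin S' by (subst vl_sum) auto
  moreover have "(\<Sum>x\<in>labelled D. S x) = vl (labelled D)"
    using fin S' by (subst vl_sum) auto
  moreover have "(\<Sum>x\<in>labelled D. S x * D x) = (\<Sum>i<m. D (eu i) + D (ev i))"
    unfolding sum_labels[OF fin, symmetric] using S' by (intro sum.cong) auto
  ultimately show ?thesis
    unfolding pushed_def L using vl_le[of "labelled D"] C by (simp add: Int_commute)
qed

lemma sum_upd:
  fixes C g :: "nat \<Rightarrow> nat"
  assumes "e < m" "C e = 0"
  shows "(\<Sum>i<m. g i * (C(e := v)) i) = (\<Sum>i<m. g i * C i) + g e * v"
proof -
  have "(\<Sum>i<m. g i * (C(e := v)) i) = (\<Sum>i<m. g i * C i + (if i = e then g i * v else 0))"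
    using assms by (intro sum.cong) auto
  thus ?thesis using assms by (simp add: sum.distrib)
qed

text \<open>The flow collected at \<open>y\<close> moves over the parent edge to \<open>x\<close>.
  If \<open>y\<close> is in \<open>X\<close>, the flow either stays in \<open>X\<close> or pays on a
  crossing edge; and its cost \<open>l e\<close> is covered by the decrease of the label from
  \<open>y\<close> to \<open>x\<close>.\<close>

lemma pushed_step:
  assumes t: "tree l rt D P O' c" and l: "\<And>i. 0 < l i" and p: "pushed l D P O' c (Suc j) S C"
    and j: "0 < j" "j < c"
    and defs: "y = O' j" "e = P y" "C' = C(e := S y)" "q = eu e + ev e - y" "S' = S(q := S q + S y)"
  shows "pushed l D P O' c j S' C'" "e < m" "y < eu e + ev e + 1" "y \<in> {eu e, ev e}"
proof -
  let ?A = "O' ` {..<j}"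
  have e: "e < m" using t j defs by (auto simp: tree_def)
  obtain x where x: "x \<in> ?A" "{eu e, ev e} = {y, x}" "D x + l e \<le> D y"
    using t j defs unfolding tree_def by blast
  have xy: "x = ev e \<and> y = eu e \<or> x = eu e \<and> y = ev e"
    using x(2) by (metis doubleton_eq_iff)
  thus "e < m" "y < eu e + ev e + 1" "y \<in> {eu e, ev e}" using e by auto
  have q: "q = x" using xy defs by auto
  have inj: "inj_on O' {..<c}" using t by (auto simp: tree_def)
  have y: "y \<notin> ?A"
  proof
    assume "y \<in> ?A"
    then obtain k where "k < j" "O' j = O' k" using defs(1) by auto
    thus False using inj_onD[OF inj, of j k] j by simp
  qed
  have im: "O' ` {..<Suc j} = insert y ?A" using defs by (auto simp: lessThan_Suc)
  \<comment> \<open>The edge has not been used before, so overwriting its flow in \<open>C'\<close>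
    is the same as adding to it.\<close>
  have Ce: "C e = 0"
  proof (rule ccontr)
    assume "C e \<noteq> 0"
    then obtain k where "Suc j \<le> k" "k < c" "P (O' j) = P (O' k)"
      using p e defs unfolding pushed_def by metis
    thus False using tree_parent_inj[OF t l, of j k] j by simp
  qed
  have S': "(\<Sum>v\<in>?A \<inter> X. S' v * g v) = (\<Sum>v\<in>?A \<inter> X. S v * g v) + of_bool (x \<in> X) * S y * g x"
    for X and g :: "nat \<Rightarrow> nat"
  proof -
    have "(\<Sum>v\<in>?A \<inter> X. S' v * g v) = (\<Sum>v\<in>?A \<inter> X. S v * g v + (if v = x then S y * g v else 0))"
      by (rule sum.cong) (auto simp: defs(5) q algebra_simps)
    also have "\<dots> = (\<Sum>v\<in>?A \<inter> X. S v * g v) + of_bool (x \<in> X) * S y * g x"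
      using x(1) by (simp add: sum.distrib)
    finally show ?thesis .
  qed
  show "pushed l D P O' c j S' C'"
    unfolding pushed_def
  proof (intro conjI allI impI)
    fix X
    have "(\<Sum>v\<in>insert y ?A \<inter> X. S v) = of_bool (y \<in> X) * S y + (\<Sum>v\<in>?A \<inter> X. S v)"
      using y by auto
    moreover have "vl (X \<inter> labelled D) \<le> (\<Sum>i<m. cross X i * C i) + (\<Sum>v\<in>insert y ?A \<inter> X. S v)"
      using p im unfolding pushed_def by auto
    moreover have "(\<Sum>i<m. cross X i * C' i) = (\<Sum>i<m. cross X i * C i) + cross X e * S y"
      unfolding defs(3) using sum_upd[where e = e and C = C, OF e Ce] .
    moreover have "(\<Sum>v\<in>?A \<inter> X. S' v) = (\<Sum>v\<in>?A \<inter> X. S v) + of_bool (x \<in> X) * S y"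
      using S'[where X = X and g = "\<lambda>_. 1"] by simp
    moreover have "of_bool (y \<in> X) * S y \<le> cross X e * S y + of_bool (x \<in> X) * S y"
      using xy by auto
    ultimately show "vl (X \<inter> labelled D) \<le> (\<Sum>i<m. cross X i * C' i) + (\<Sum>v\<in>?A \<inter> X. S' v)"
      by linarith
  next
    have "(\<Sum>i<m. C' i * l i) = (\<Sum>i<m. C i * l i) + S y * l e"
      using sum_upd[where e = e and C = C and g = l and v = "S y", OF e Ce] by (simp only: defs(3) mult.commute)
    moreover have "(\<Sum>v\<in>?A. S' v * D v) = (\<Sum>v\<in>?A. S v * D v) + S y * D x"
      using S'[where X = UNIV and g = D] by simp
    moreover have "S y * D x + S y * l e \<le> S y * D y"
      unfolding distrib_left[symmetric] using x(3) by (intro mult_left_mono) auto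
    moreover have "(\<Sum>i<m. C i * l i) + (\<Sum>v\<in>insert y ?A. S v * D v) \<le> (\<Sum>i<m. D (eu i) + D (ev i))"
      using p im unfolding pushed_def by auto
    moreover have "(\<Sum>v\<in>insert y ?A. S v * D v) = S y * D y + (\<Sum>v\<in>?A. S v * D v)"
      using y by simp
    ultimately show "(\<Sum>i<m. C' i * l i) + (\<Sum>v\<in>?A. S' v * D v) \<le> (\<Sum>i<m. D (eu i) + D (ev i))"
      by linarith
  next
    have "(\<Sum>v\<in>?A. S' v) = (\<Sum>v\<in>?A. S v) + S y" using S'[where X = UNIV and g = "\<lambda>_. 1"] by simp
    moreover have "(\<Sum>v\<in>insert y ?A. S v) \<le> 2 * m" using p im unfolding pushed_def by auto
    ultimately show "(\<Sum>v\<in>?A. S' v) \<le> 2 * m" using y by simp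
  next
    fix i assume i: "i < m"
    have "(\<Sum>v\<in>insert y ?A. S v) \<le> 2 * m" using p im unfolding pushed_def by auto
    hence "S y \<le> 2 * m" using y by simp
    thus "C' i \<le> 2 * m" using p i unfolding pushed_def defs(3) by simp
    assume "C' i \<noteq> 0"
    show "\<exists>k\<ge>j. k < c \<and> i = P (O' k)"
    proof (cases "i = e")
      case True
      thus ?thesis using j defs by auto
    next
      case False
      hence "C i \<noteq> 0" using \<open>C' i \<noteq> 0\<close> defs(3) by simp
      thus ?thesis using p i unfolding pushed_def by (meson Suc_leD)
    qed
  qed
qed

definition routed :: "(nat \<Rightarrow> nat) \<Rightarrow> nat set \<Rightarrow> nat \<Rightarrow> (nat \<Rightarrow> nat) \<Rightarrow> bool" where
  "routed l L q C \<longleftrightarrow>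
    (\<forall>X. min (vl (X \<inter> L)) (vl (- X \<inter> L)) \<le> (\<Sum>i<m. cross X i * C i)) \<and>
    (\<Sum>i<m. C i * l i) \<le> 2 * m * (q + 1) \<and> (\<forall>i<m. C i \<le> 2 * m)"

text \<open>In the end all flow sits at the root. The side of a cut that avoids the root has nothing
  left, so all of its units have crossed; as the root may be on either side, only the minimum is
  guaranteed.\<close>

lemma pushed_final:
  assumes t: "tree l rt D P O' c" and p: "pushed l D P O' c 1 S C"
    and q: "(\<Sum>i<m. D (eu i) + D (ev i)) \<le> 2 * m * (q + 1)"
  shows "routed l (labelled D) q C"
  unfolding routed_def
proof (intro conjI allI impI)
  have im: "O' ` {..<1} = {rt}" using t by (auto simp: tree_def)
  have *: "vl (X \<inter> labelled D) \<le> (\<Sum>i<m. cross X i * C i)" if "rt \<notin> X" for X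
  proof -
    have "vl (X \<inter> labelled D) \<le> (\<Sum>i<m. cross X i * C i) + (\<Sum>x \<in> {rt} \<inter> X. S x)"
      using p unfolding pushed_def im by blast
    thus ?thesis using that by simp
  qed
  fix X
  have "(\<Sum>i<m. cross (- X) i * C i) = (\<Sum>i<m. cross X i * C i)" by (rule sum.cong) auto
  thus "min (vl (X \<inter> labelled D)) (vl (- X \<inter> labelled D)) \<le> (\<Sum>i<m. cross X i * C i)"
    using *[of X] *[of "- X"] by (cases "rt \<in> X") auto
next
  show "(\<Sum>i<m. C i * l i) \<le> 2 * m * (q + 1)" using p q unfolding pushed_def by linarith
qed (use p in \<open>auto simp: pushed_def\<close>)

end

section \<open>Multiplicative weights\<close>

locale cut_instance = edges +
  fixes \<phi> b :: real
  assumes phi: "0 < \<phi>" "\<phi> \<le> 1" and b: "0 < b" "b \<le> 1 / 4"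
begin

text \<open>The first term is the rate tested by the program. The second holds by integrality: a
  nonempty boundary is at least \<open>1 / (6 * m)\<close> times a quantity of at most
  \<open>6 * m\<close>. It bounds the number of steps independently of \<phi>, so that distances fit
  into words.\<close>

definition \<psi> :: real where "\<psi> = max (\<phi> / 16) (1 / (6 * m))"

sublocale growth m eu ev \<psi>
  by unfold_locales (use phi m in \<open>auto simp: \<psi>_def field_simps\<close>)

definition nsteps :: real where "nsteps = 2 * potl / \<psi>"

lemma grow_q_le:
  assumes "grow l R rt D P O' c r f q" "(\<Sum>i<m. l i) \<le> 5 * m"
  shows "q \<le> nsteps"
  using grow_bound[OF assms] psi by (simp add: nsteps_def field_simps)

abbreviation touch :: "nat set \<Rightarrow> nat \<Rightarrow> nat" where
  "touch R i \<equiv> of_bool (eu i \<in> R \<or> ev i \<in> R)"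

text \<open>Balls pay for their boundary with covered length, so lengths are charged besides the
  volume. Volume and lengths add up to at most \<open>7 * m\<close>; once both sides of the cut have
  volume at least \<open>m / 2\<close>, the factor 16 makes this at most \<phi> times the smaller
  volume.\<close>

definition sparse :: "(nat \<Rightarrow> nat) \<Rightarrow> nat set \<Rightarrow> bool" where
  "sparse l R \<longleftrightarrow> 16 * real (ct R) \<le> \<phi> * real (vl R + (\<Sum>i<m. touch R i * l i))"

definition good_cut :: "nat set \<Rightarrow> bool" where
  "good_cut S \<longleftrightarrow> 2 * b * m \<le> vl S \<and> 2 * b * m \<le> vl (- S) \<and>
    real (ct S) \<le> \<phi> * real (min (vl S) (vl (- S))) \<and> 0 < vl S \<and> 0 < vl (- S)"

text \<open>No length is charged twice, because \<open>used\<close> vanishes on edges that touch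
  \<open>R\<close>. The summand 1 in the bound for \<open>f\<close> is paid by the positive volume
  of the ball.\<close>

lemma sparse_Un:
  assumes R: "sparse l R" and g: "grow l R rt D P O' c r f q" and u: "m < out D"
    and c: "16 * real (ctr R (labelled D)) \<le> \<phi> * f"
  shows "sparse l (R \<union> labelled D)" "vl (R \<union> labelled D) = vl R + vl (labelled D)"
    "0 < vl (labelled D)" "vl (labelled D) < m"
proof -
  let ?B = "labelled D"
  have t: "tree l rt D P O' c" and dis: "?B \<inter> R = {}" and sat: "saturated l R D r"
    and f: "f \<le> 1 + (\<Sum>i<m. used l R D r i)"
    using g u by (auto simp: grow_def)
  show v: "vl (R \<union> ?B) = vl R + vl ?B" using dis by (intro vl_Un) auto
  show pos: "0 < vl ?B" using tree_root[OF t] tree_labelled_ends[OF t] by (intro vl_pos[of rt]) auto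
  show "vl ?B < m" using vl_compl[of ?B] u by simp
  have "ct (R \<union> ?B) \<le> ct R + ctr R ?B"
    unfolding ct_def ctr_def sum.distrib[symmetric] by (rule sum_mono) auto
  moreover have "(\<Sum>i<m. touch R i * l i) + (\<Sum>i<m. used l R D r i) \<le> (\<Sum>i<m. touch (R \<union> ?B) i * l i)"
    unfolding sum.distrib[symmetric]
  proof (rule sum_mono)
    fix i assume "i \<in> {..<m}"
    thus "touch R i * l i + used l R D r i \<le> touch (R \<union> ?B) i * l i"
      using used_le[OF sat, of i] by (auto simp: used_def labelled_def split: if_splits)
  qed
  hence "vl R + (\<Sum>i<m. touch R i * l i) + f \<le> vl (R \<union> ?B) + (\<Sum>i<m. touch (R \<union> ?B) i * l i)"
    using f pos v by linarith
  hence "\<phi> * real (vl R + (\<Sum>i<m. touch R i * l i) + f)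
      \<le> \<phi> * real (vl (R \<union> ?B) + (\<Sum>i<m. touch (R \<union> ?B) i * l i))"
    using phi by (intro mult_left_mono of_nat_mono) auto
  ultimately show "sparse l (R \<union> ?B)"
    using R c unfolding sparse_def of_nat_add distrib_left by linarith
qed

text \<open>The upper bound arises from a set of volume below \<open>m / 2\<close> to which a ball
  of volume below \<open>m\<close> is added. It leaves more than \<open>m / 2\<close> on the other
  side, that is, a quarter of the total, which is why \<open>b\<close> may be as large as
  1/4.\<close>

lemma good_cut_sparse:
  assumes R: "sparse l R" and l: "(\<Sum>i<m. l i) \<le> 5 * m" and v: "m \<le> 2 * vl R" "2 * vl R < 3 * m"
  shows "good_cut R"
proof -
  have c: "m < 2 * vl (- R)" using vl_compl[of R] v by linarith
  have "(\<Sum>i<m. touch R i * l i) \<le> (\<Sum>i<m. l i)" by (intro sum_mono) auto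
  hence "vl R + (\<Sum>i<m. touch R i * l i) \<le> 7 * m" using vl_le[of R] l by linarith
  hence "real (vl R + (\<Sum>i<m. touch R i * l i)) \<le> 16 * real (min (vl R) (vl (- R)))"
    using v c by linarith
  hence "\<phi> * real (vl R + (\<Sum>i<m. touch R i * l i)) \<le> \<phi> * (16 * real (min (vl R) (vl (- R))))"
    using phi by (intro mult_left_mono) auto
  hence "real (ct R) \<le> \<phi> * real (min (vl R) (vl (- R)))" using R unfolding sparse_def by linarith
  moreover have "b * real m \<le> 1 / 4 * real m" using b by (intro mult_right_mono) auto
  ultimately show ?thesis using v c m unfolding good_cut_def by linarith
qed

lemma good_cut_outer:
  assumes "out D \<le> m" "2 * m * b \<le> out D" "16 * real (ct (labelled D)) \<le> \<phi> * out D"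
  shows "good_cut (labelled D)"
proof -
  have v: "vl (labelled D) + out D = 2 * m" by (rule vl_compl)
  hence "min (vl (labelled D)) (out D) = out D" using assms by simp
  moreover have "0 < 2 * m * b" using m b by simp
  ultimately show ?thesis
    using assms v unfolding good_cut_def by (auto simp: mult_ac)
qed

section \<open>Weights, lengths and the effect of reweighting\<close>

definition len :: "(nat \<Rightarrow> nat) \<Rightarrow> nat \<Rightarrow> nat \<Rightarrow> nat" where
  "len wt un i = wt i div un + 1"

text \<open>\<open>PW\<close> is the total weight at the time when the unit was fixed. The unit
  follows \<open>PW\<close> and not \<open>W\<close>, because a growing unit could shorten edges and
  spoil the sparsity of \<open>R\<close>. The lower bound on the weights makes rounding errors of 1
  per edge affordable.\<close>

definition wts :: "(nat \<Rightarrow> nat) \<Rightarrow> nat \<Rightarrow> nat \<Rightarrow> nat \<Rightarrow> nat set \<Rightarrow> bool" where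
  "wts wt W PW un R \<longleftrightarrow> W = (\<Sum>i<m. wt i) \<and> (\<forall>i<m. 2 * m \<le> wt i) \<and> 2 * m * m \<le> PW \<and> PW \<le> W \<and>
    W < 2 * PW \<and> un = PW div m \<and> 2 * vl R < m \<and> R \<subseteq> ends \<and> sparse (len wt un) R"

text \<open>\<open>T\<close> is the number of routings so far: each one multiplies the total weight by at most
  \<open>1 + (nsteps + 2) / m\<close>, but sends a large flow across every balanced cut.\<close>

definition progress :: "(nat \<Rightarrow> nat) \<Rightarrow> nat \<Rightarrow> bool" where
  "progress wt W \<longleftrightarrow> (\<exists>T\<ge>0. ln W \<le> ln (2 * real m * m) + T * (nsteps + 2) / m \<and>
    (\<forall>X. T * (min (vl X) (vl (- X)) - 2 * b * m) / (4 * m)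
      \<le> (\<Sum>i<m. cross X i * (ln (wt i) - ln (2 * real m)))))"

text \<open>Increases by at least 1 in every attempt.  The removed set is reset only when the total
  weight has doubled, which pays for the loss of \<open>vl R\<close>.\<close>

definition clock :: "nat \<Rightarrow> nat \<Rightarrow> nat set \<Rightarrow> real" where
  "clock W PW R = 4 * m * ln W + 4 * m * ln PW + vl R - 8 * m * ln (2 * real m * m)"

lemma wts_unit:
  assumes "wts wt W PW un R"
  shows "0 < un" "W < 4 * m * un" "un * m \<le> W"
proof -
  have un: "un = PW div m" and PW: "2 * m * m \<le> PW" "PW \<le> W" "W < 2 * PW"
    using assms by (auto simp: wts_def)
  have 2: "2 * m \<le> un" unfolding un using PW(1) m by (simp add: less_eq_div_iff_mult_less_eq)
  thus "0 < un" using m by simp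
  show "un * m \<le> W" unfolding un using PW(2) by (meson div_times_less_eq_dividend le_trans)
  have "PW < m * un + m" using dividend_less_times_div[OF m, of PW] by (simp add: un)
  also have "\<dots> \<le> m * un + m * un" using 2 m by (intro add_left_mono) simp
  finally show "W < 4 * m * un" using PW(3) by simp
qed

text \<open>Less than \<open>4 * m\<close> comes from the rounded weights and \<open>m\<close> from
  the 1 added to each length. That 1 makes lengths positive and \<open>un * len\<close> an upper
  bound for the weight.\<close>

lemma sum_len_le:
  assumes "wts wt W PW un R"
  shows "(\<Sum>i<m. len wt un i) \<le> 5 * m"
proof -
  have "(\<Sum>i<m. wt i div un) * un \<le> (\<Sum>i<m. wt i)"
    unfolding sum_distrib_right by (intro sum_mono) (rule div_times_less_eq_dividend)
  also have "\<dots> < 4 * m * un" using wts_unit(2)[OF assms] assms by (simp add: wts_def)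
  finally have "(\<Sum>i<m. wt i div un) < 4 * m" by simp
  thus ?thesis unfolding len_def sum.distrib by simp
qed

text \<open>Using \<open>C i + 1\<close> guarantees growth by a factor
  \<open>1 + 1 / (2 * m)\<close> even on edges without flow, so every routing counts. The final 1
  makes up for rounding down. For the upper bound, the weighted flow is at most \<open>un\<close>
  times its cost, hence at most \<open>2 * W * (q + 1)\<close>; the extra unit of flow and the
  rounding contribute \<open>W / (2 * m)\<close> each.\<close>

lemma reweight_sum:
  assumes w: "wts wt W PW un R" and r: "routed (len wt un) L q C"
    and w': "\<forall>i<m. wt' i = wt i + wt i * (C i + 1) div (2 * m) + 1" and W': "W' = (\<Sum>i<m. wt' i)"
  shows "W' \<le> 3 * W" "real W * (1 + 1 / (2 * m)) \<le> W'" "real W' \<le> W * (1 + (real q + 2) / m)"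
    "\<And>i. i < m \<Longrightarrow> real (wt i) * (1 + C i / (2 * m)) \<le> wt' i"
proof -
  have W: "W = (\<Sum>i<m. wt i)" and w0: "\<And>i. i < m \<Longrightarrow> 2 * m \<le> wt i" and PW: "2 * m * m \<le> PW" "PW \<le> W"
    using w by (auto simp: wts_def)
  have C: "\<And>i. i < m \<Longrightarrow> C i \<le> 2 * m" and Cl: "(\<Sum>i<m. C i * len wt un i) \<le> 2 * m * (q + 1)"
    using r by (auto simp: routed_def)
  have lower: "real (wt i) * (1 + (C i + 1) / (2 * m)) \<le> wt' i" if "i < m" for i
  proof -
    have "wt i * (C i + 1) < 2 * m * (wt i * (C i + 1) div (2 * m)) + 2 * m"
      using dividend_less_times_div[of "2 * m" "wt i * (C i + 1)"] m by simp
    hence "wt i * (C i + 1) \<le> 2 * m * (wt i * (C i + 1) div (2 * m) + 1)" by simp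
    hence "real (wt i * (C i + 1)) \<le> real (2 * m * (wt i * (C i + 1) div (2 * m) + 1))"
      by (rule of_nat_mono)
    hence "real (wt i) * (C i + 1) / (2 * m) \<le> wt i * (C i + 1) div (2 * m) + 1"
      using m by (simp add: field_simps)
    thus ?thesis using w' that by (simp add: algebra_simps)
  qed
  show "real (wt i) * (1 + C i / (2 * m)) \<le> wt' i" if "i < m" for i
  proof -
    have "real (wt i) * (1 + C i / (2 * m)) \<le> real (wt i) * (1 + (C i + 1) / (2 * m))"
      by (intro mult_left_mono add_left_mono divide_right_mono) auto
    thus ?thesis using lower[OF that] by linarith
  qed
  have "real W * (1 + 1 / (2 * m)) = (\<Sum>i<m. real (wt i) * (1 + 1 / (2 * m)))"
    unfolding W by (simp add: sum_distrib_right)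
  also have "\<dots> \<le> (\<Sum>i<m. real (wt' i))"
  proof (rule sum_mono)
    fix i assume i: "i \<in> {..<m}"
    have "real (wt i) * (1 + 1 / (2 * m)) \<le> real (wt i) * (1 + (C i + 1) / (2 * m))"
      by (intro mult_left_mono add_left_mono divide_right_mono) auto
    thus "real (wt i) * (1 + 1 / (2 * m)) \<le> wt' i" using lower[of i] i by simp
  qed
  finally show "real W * (1 + 1 / (2 * m)) \<le> W'" by (simp add: W')
  have "wt' i \<le> 3 * wt i" if i: "i < m" for i
  proof -
    have "wt i * (C i + 1) div (2 * m) \<le> wt i * (2 * m + 1) div (2 * m)"
      using C[OF i] by (intro div_le_mono mult_left_mono) auto
    also have "\<dots> = (wt i + wt i * (2 * m)) div (2 * m)" by (simp add: algebra_simps)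
    also have "\<dots> = wt i div (2 * m) + wt i" using m by (subst div_mult_self1) auto
    finally have "wt i * (C i + 1) div (2 * m) \<le> wt i div (2 * m) + wt i" .
    moreover have "wt i div (2 * m) \<le> wt i div 2" using m by (intro div_le_mono2) auto
    ultimately show ?thesis using w'[rule_format, OF i] w0[OF i] m by linarith
  qed
  hence "W' \<le> (\<Sum>i<m. 3 * wt i)" unfolding W' by (intro sum_mono) auto
  thus "W' \<le> 3 * W" by (simp add: W sum_distrib_left)
  have un: "0 < un" "un * m \<le> W" using wts_unit[OF w] by auto
  have "(\<Sum>i<m. wt i * C i) \<le> (\<Sum>i<m. un * (C i * len wt un i))"
  proof (rule sum_mono)
    fix i
    have "wt i \<le> un * len wt un i"
      using dividend_less_times_div[OF un(1), of "wt i"] by (simp add: len_def)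
    hence "wt i * C i \<le> un * len wt un i * C i" by (rule mult_right_mono) simp
    thus "wt i * C i \<le> un * (C i * len wt un i)" by (simp add: mult_ac)
  qed
  also have "\<dots> \<le> un * (2 * m * (q + 1))" unfolding sum_distrib_left[symmetric] using Cl by simp
  also have "\<dots> = un * m * (2 * (q + 1))" by (simp add: algebra_simps)
  also have "\<dots> \<le> W * (2 * (q + 1))" using un(2) by (intro mult_right_mono) auto
  finally have "(\<Sum>i<m. wt i * C i) \<le> W * (2 * (q + 1))" .
  hence "real (\<Sum>i<m. wt i * C i) \<le> real (W * (2 * (q + 1)))" by (rule of_nat_mono)
  hence wC: "real (\<Sum>i<m. wt i * C i) \<le> real W * (2 * (real q + 1))"
    by (simp only: of_nat_mult of_nat_add of_nat_numeral of_nat_1)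
  have "real W' \<le> (\<Sum>i<m. real (wt i) + (real (wt i * C i) + wt i) / (2 * m) + 1)"
    unfolding W' of_nat_sum
  proof (rule sum_mono)
    fix i assume i: "i \<in> {..<m}"
    have "real (wt i * (C i + 1) div (2 * m)) \<le> real (wt i * (C i + 1)) / real (2 * m)"
      by (rule of_nat_div_le_of_nat)
    thus "real (wt' i) \<le> real (wt i) + (real (wt i * C i) + wt i) / (2 * m) + 1"
      using w' i by (simp add: algebra_simps)
  qed
  also have "\<dots> = real W + (real (\<Sum>i<m. wt i * C i) + W) / (2 * m) + m"
    by (simp add: sum.distrib W sum_divide_distrib add_divide_distrib)
  also have "\<dots> \<le> real W + (real W * (2 * (real q + 1)) + W) / (2 * m) + W / (2 * m)"
  proof -
    have "real (2 * m * m) \<le> W" using PW by (intro of_nat_mono) linarith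
    hence "real m \<le> W / (2 * m)" using m by (simp add: field_simps)
    thus ?thesis using wC by (intro add_mono divide_right_mono) auto
  qed
  also have "\<dots> = W * (1 + (real q + 2) / m)" using m by (simp add: field_simps)
  finally show "real W' \<le> W * (1 + (real q + 2) / m)" .
qed

text \<open>The ball misses volume at most \<open>2 * b * m\<close>, so the flow across
  \<open>X\<close> is at least the smaller volume minus this. Because
  \<open>C i \<le> 2 * m\<close>, multiplication by \<open>1 + C i / (2 * m)\<close> adds at least
  \<open>C i / (4 * m)\<close> to the logarithm of the weight.\<close>

lemma reweight_progress:
  assumes w: "wts wt W PW un R" and r: "routed (len wt un) L q C" and q: "q \<le> nsteps"
    and L: "vl (- L) \<le> 2 * b * m"
    and w': "\<forall>i<m. wt' i = wt i + wt i * (C i + 1) div (2 * m) + 1" and W': "W' = (\<Sum>i<m. wt' i)"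
    and p: "progress wt W"
  shows "progress wt' W'"
proof -
  note s = reweight_sum[OF w r w' W']
  have w0: "\<And>i. i < m \<Longrightarrow> 2 * m \<le> wt i" and PW: "2 * m * m \<le> PW" "PW \<le> W"
    using w by (auto simp: wts_def)
  have "0 < 2 * m * m" using m by simp
  hence W0: "0 < W" using PW by linarith
  obtain T where T: "0 \<le> T" "ln W \<le> ln (2 * real m * m) + T * (nsteps + 2) / m"
    "\<And>X. T * (min (vl X) (vl (- X)) - 2 * b * m) / (4 * m)
      \<le> (\<Sum>i<m. cross X i * (ln (wt i) - ln (2 * real m)))"
    using p unfolding progress_def by blast
  have "0 < real W * (1 + 1 / (2 * m))" using W0 by (auto intro!: mult_pos_pos add_pos_nonneg)
  hence W'0: "0 < real W'" using s(2) by linarith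
  have q1: "0 < 1 + (real q + 2) / m" by (auto intro!: add_pos_nonneg)
  have "ln (real W') \<le> ln (real W * (1 + (real q + 2) / m))" using W'0 s(3) by (intro ln_mono)
  also have "\<dots> = ln W + ln (1 + (real q + 2) / m)" using W0 q1 by (intro ln_mult_pos) auto
  also have "ln (1 + (real q + 2) / m) \<le> (real q + 2) / m" by (intro ln_add_one_self_le_self) auto
  also have "(real q + 2) / m \<le> (nsteps + 2) / m" using q by (intro divide_right_mono) auto
  finally have 1: "ln W' \<le> ln (2 * real m * m) + (T + 1) * (nsteps + 2) / m"
    using T(2) by (simp add: algebra_simps add_divide_distrib)
  have 2: "(T + 1) * (min (vl X) (vl (- X)) - 2 * b * m) / (4 * m)
      \<le> (\<Sum>i<m. cross X i * (ln (wt' i) - ln (2 * real m)))" for X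
  proof -
    have "vl X \<le> vl ((X \<inter> L) \<union> - L)" by (intro vl_mono) auto
    also have "\<dots> = vl (X \<inter> L) + vl (- L)" by (intro vl_Un) auto
    finally have "vl X \<le> vl (X \<inter> L) + vl (- L)" .
    moreover have "vl (- X) \<le> vl ((- X \<inter> L) \<union> - L)" by (intro vl_mono) auto
    moreover have "vl ((- X \<inter> L) \<union> - L) = vl (- X \<inter> L) + vl (- L)" by (intro vl_Un) auto
    moreover have "min (vl (X \<inter> L)) (vl (- X \<inter> L)) \<le> (\<Sum>i<m. cross X i * C i)"
      using r by (auto simp: routed_def)
    ultimately have "min (vl X) (vl (- X)) \<le> (\<Sum>i<m. cross X i * C i) + vl (- L)" by linarith
    hence "real (min (vl X) (vl (- X))) - 2 * b * m \<le> (\<Sum>i<m. cross X i * C i)" using L by linarith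
    hence "(real (min (vl X) (vl (- X))) - 2 * b * m) / (4 * m) \<le> real (\<Sum>i<m. cross X i * C i) / (4 * m)"
      by (intro divide_right_mono) auto
    also have "\<dots> = (\<Sum>i<m. cross X i * (real (C i) / (4 * m)))"
      by (simp only: of_nat_sum of_nat_mult sum_divide_distrib times_divide_eq_right)
    finally have "(T + 1) * (min (vl X) (vl (- X)) - 2 * b * m) / (4 * m)
      \<le> (\<Sum>i<m. cross X i * (ln (wt i) - ln (2 * real m))) + (\<Sum>i<m. cross X i * (real (C i) / (4 * m)))"
      using T(3)[of X] by (simp add: algebra_simps add_divide_distrib diff_divide_distrib)
    also have "\<dots> \<le> (\<Sum>i<m. cross X i * (ln (wt' i) - ln (2 * real m)))"
      unfolding sum.distrib[symmetric] distrib_left[symmetric]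
    proof (intro sum_mono mult_left_mono)
      fix i assume "i \<in> {..<m}"
      hence i: "i < m" by simp
      have wi: "0 < real (wt i)" using w0[OF i] m by simp
      have c: "real (C i) / (2 * m) \<le> 1" using r i m by (auto simp: routed_def)
      have "ln (real (wt i)) + ln (1 + C i / (2 * m)) = ln (real (wt i) * (1 + C i / (2 * m)))"
        using wi by (intro ln_mult_pos[symmetric]) (auto intro!: add_pos_nonneg)
      also have "\<dots> \<le> ln (wt' i)"
      proof -
        have "0 < real (wt i) * (1 + C i / (2 * m))"
          using wi by (auto intro!: mult_pos_pos add_pos_nonneg)
        thus ?thesis using s(4)[OF i] by simp
      qed
      finally have "ln (real (wt i)) + ln (1 + C i / (2 * m)) \<le> ln (wt' i)" .
      moreover have "C i / (2 * m) / 2 \<le> ln (1 + real (C i) / (2 * m))" using c by (intro ln_1_plus_ge) auto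
      ultimately show "ln (wt i) - ln (2 * real m) + C i / (4 * m) \<le> ln (wt' i) - ln (2 * real m)" by simp
    qed auto
    finally show ?thesis .
  qed
  show ?thesis unfolding progress_def by (rule exI[of _ "T + 1"]) (use 1 2 T(1) in auto)
qed

text \<open>The gain is \<open>4 * m\<close> times \<open>ln (1 + 1 / (2 * m))\<close>, which is at
  least 1. If \<open>R\<close> is emptied, \<open>PW\<close> has at least doubled, and
  \<open>4 * m * ln 2\<close> exceeds the lost \<open>vl R\<close>, which is below
  \<open>m / 2\<close>.\<close>

lemma reweight_wts:
  assumes w: "wts wt W PW un R" and r: "routed (len wt un) L q C"
    and w': "\<forall>i<m. wt' i = wt i + wt i * (C i + 1) div (2 * m) + 1" and W': "W' = (\<Sum>i<m. wt' i)"
  shows "W' < 2 * PW \<Longrightarrow> wts wt' W' PW un R \<and> clock W PW R + 1 \<le> clock W' PW R"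
    "2 * PW \<le> W' \<Longrightarrow> wts wt' W' W' (W' div m) {} \<and> clock W PW R + 1 \<le> clock W' W' {}"
proof -
  note s = reweight_sum[OF w r w' W']
  have w0: "\<And>i. i < m \<Longrightarrow> 2 * m \<le> wt i" and PW: "2 * m * m \<le> PW" "PW \<le> W" and R: "2 * vl R < m" "R \<subseteq> ends"
    and un: "un = PW div m" and sp: "sparse (len wt un) R"
    using w by (auto simp: wts_def)
  have mm: "0 < 2 * m * m" using m by simp
  hence W0: "0 < W" "0 < PW" using PW by linarith+
  have mono: "wt i \<le> wt' i" if "i < m" for i using w' that by simp
  hence w'0: "\<And>i. i < m \<Longrightarrow> 2 * m \<le> wt' i" using w0 le_trans by blast
  have "real W * 1 \<le> real W * (1 + 1 / (2 * m))" by (intro mult_left_mono) auto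
  hence "W \<le> W'" using s(2) by linarith
  have lnW: "4 * m * ln W + 1 \<le> 4 * m * ln W'"
  proof -
    have "ln (real W) + ln (1 + 1 / (2 * m)) = ln (real W * (1 + 1 / (2 * m)))"
      using W0 by (intro ln_mult_pos[symmetric]) (auto intro!: add_pos_nonneg)
    also have "\<dots> \<le> ln W'"
    proof -
      have "0 < real W * (1 + 1 / (2 * m))" using W0 by (auto intro!: mult_pos_pos add_pos_nonneg)
      thus ?thesis using s(2) by simp
    qed
    finally have "ln (real W) + ln (1 + 1 / (2 * m)) \<le> ln W'" .
    moreover have "1 / (2 * real m) / 2 \<le> ln (1 + 1 / (2 * real m))" using m by (intro ln_1_plus_ge) auto
    ultimately have "1 / (4 * real m) \<le> ln W' - ln W" by simp
    thus ?thesis using m by (simp add: field_simps)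
  qed
  {
    assume lt: "W' < 2 * PW"
    have "(\<Sum>i<m. touch R i * len wt un i) \<le> (\<Sum>i<m. touch R i * len wt' un i)"
      using mono by (intro sum_mono mult_left_mono) (auto simp: len_def div_le_mono)
    hence "\<phi> * real (vl R + (\<Sum>i<m. touch R i * len wt un i)) \<le> \<phi> * real (vl R + (\<Sum>i<m. touch R i * len wt' un i))"
      using phi by (intro mult_left_mono of_nat_mono) auto
    hence "sparse (len wt' un) R" using sp unfolding sparse_def by linarith
    thus "wts wt' W' PW un R \<and> clock W PW R + 1 \<le> clock W' PW R"
      using lt PW \<open>W \<le> W'\<close> R un w'0 lnW by (auto simp: wts_def W' clock_def)
  }
  {
    assume ge: "2 * PW \<le> W'"
    have "wts wt' W' W' (W' div m) {}"
      using ge PW w'0 m \<open>W \<le> W'\<close> mm W0 by (auto simp: wts_def W' sparse_def)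
    moreover have "ln (real (2 * PW)) \<le> ln (real W')" using ge W0 by simp
    hence "1 / 2 + ln (real PW) \<le> ln W'"
      using W0 ln_1_plus_ge[of 1] by (simp add: ln_mult)
    hence "4 * m * (1 / 2 + ln (real PW)) \<le> 4 * m * ln W'" by (intro mult_left_mono) auto
    hence "vl R + 4 * m * ln PW \<le> 4 * m * ln W'" using R by (simp add: algebra_simps)
    ultimately show "wts wt' W' W' (W' div m) {} \<and> clock W PW R + 1 \<le> clock W' W' {}"
      using lnW by (simp add: clock_def)
  }
qed

text \<open>Total growth by \<open>4 * m\<close> forces
  \<open>T * (nsteps + 2) \<ge> m * ln (4 * m)\<close>. A single weight, which starts at
  \<open>2 * m\<close> and ends below \<open>2 * m * (4 * m)^2\<close>, gains at most
  \<open>2 * ln (4 * m)\<close> in the logarithm. By the hypothesis on \<open>X\<close>, the missed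
  volume is at most half of the smaller side. Comparing the two bounds, \<open>ln (4 * m)\<close>
  cancels and the factor 16 is left.\<close>

lemma certificate:
  assumes p: "progress wt W" and W: "8 * m * m * m \<le> W" "W \<le> 32 * m * m * m"
    and w: "\<And>i. i < m \<Longrightarrow> 2 * m \<le> wt i" "W = (\<Sum>i<m. wt i)"
    and X: "4 * b * m \<le> min (vl X) (vl (- X))"
  shows "min (vl X) (vl (- X)) \<le> 16 * (nsteps + 2) * ct X"
proof -
  let ?v = "real (min (vl X) (vl (- X)))"
  let ?L = "ln (4 * real m)"
  have m1: "1 \<le> real m" using m by simp
  hence L: "0 < ?L" by simp
  obtain T where T: "0 \<le> T" "ln W \<le> ln (2 * real m * m) + T * (nsteps + 2) / m"
    "T * (?v - 2 * b * m) / (4 * m) \<le> (\<Sum>i<m. cross X i * (ln (wt i) - ln (2 * real m)))"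
    using p unfolding progress_def by blast
  have "0 \<le> potl" using m1 by (simp add: potl_def)
  hence nsteps: "0 < nsteps + 2" using psi by (simp add: nsteps_def add_nonneg_pos)
  have "0 < 8 * m * m * m" using m by simp
  hence "0 < W" using W(1) by linarith
  have "real (8 * m * m * m) \<le> real W" using W(1) by (rule of_nat_mono)
  hence "ln (4 * real m * (2 * real m * m)) \<le> ln (real W)"
    using m1 \<open>0 < W\<close> by (subst ln_le_cancel_iff) (auto simp: mult_ac intro!: mult_pos_pos)
  moreover have "ln (4 * real m * (2 * real m * m)) = ?L + ln (2 * real m * m)"
    using m1 by (intro ln_mult_pos) auto
  ultimately have "?L \<le> T * (nsteps + 2) / m" using T(2) by linarith
  hence TQ: "m * ?L \<le> T * (nsteps + 2)" using m1 by (simp add: field_simps)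
  have "ln (wt i) - ln (2 * real m) \<le> 2 * ?L" if i: "i < m" for i
  proof -
    have "wt i \<le> W" unfolding w(2) using i by (intro member_le_sum) auto
    hence "wt i \<le> 32 * m * m * m" using W(2) by linarith
    hence "real (wt i) \<le> real (32 * m * m * m)" by (rule of_nat_mono)
    hence "real (wt i) \<le> (2 * real m) * ((4 * real m) * (4 * real m))" by simp
    moreover have "0 < real (wt i)" using w(1)[OF i] m by simp
    ultimately have "ln (wt i) \<le> ln ((2 * real m) * ((4 * real m) * (4 * real m)))"
      by (subst ln_le_cancel_iff) auto
    also have "\<dots> = ln (2 * real m) + ln ((4 * real m) * (4 * real m))"
      using m1 by (intro ln_mult_pos) auto
    also have "ln ((4 * real m) * (4 * real m)) = ?L + ?L" using m1 by (intro ln_mult_pos) auto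
    finally show ?thesis by simp
  qed
  hence "(\<Sum>i<m. cross X i * (ln (wt i) - ln (2 * real m))) \<le> (\<Sum>i<m. cross X i * (2 * ?L))"
    by (intro sum_mono mult_left_mono) auto
  also have "\<dots> = ct X * (2 * ?L)" by (simp add: ct_def sum_distrib_right)
  finally have "T * (?v - 2 * b * m) / (4 * m) \<le> ct X * (2 * ?L)" using T(3) by linarith
  moreover have "T * (?v / 2) / (4 * m) \<le> T * (?v - 2 * b * m) / (4 * m)"
    using X T(1) by (intro divide_right_mono mult_left_mono) auto
  ultimately have "T * ?v \<le> ct X * (2 * ?L) * (8 * m)" using m1 by (simp add: field_simps)
  hence "T * ?v * (nsteps + 2) \<le> ct X * (2 * ?L) * (8 * m) * (nsteps + 2)" using nsteps by (intro mult_right_mono) auto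
  moreover have "m * ?L * ?v \<le> T * (nsteps + 2) * ?v" using TQ by (intro mult_right_mono) auto
  ultimately have "(m * ?L) * ?v \<le> (m * ?L) * (16 * (nsteps + 2) * ct X)" by (simp add: algebra_simps)
  thus ?thesis using m1 L by (simp add: mult_le_cancel_left)
qed

end

section \<open>Correctness and running time of the program\<close>

lemma frame_refl: "frame A s s"
  by (simp add: frame_def)

lemma frame_trans: "frame A s s1 \<Longrightarrow> frame B s1 s2 \<Longrightarrow> A \<union> B \<subseteq> C \<Longrightarrow> frame C s s2"
  unfolding frame_def by (metis UnCI subsetD)

lemma frameD: "frame A s s' \<Longrightarrow> a \<notin> A \<Longrightarrow> s' a = s a"
  by (simp add: frame_def)

lemma (in edges) tree_count:
  assumes "tree l rt D P O' c" shows "c \<le> 2 * m"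
proof -
  have "inj_on O' {..<c}" using assms by (auto simp: tree_def)
  hence "c = card (O' ` {..<c})" by (simp only: card_image card_lessThan)
  also have "\<dots> \<le> card ends"
    using assms tree_labelled_ends[OF assms] by (intro card_mono) (auto simp: tree_def ends_def)
  also have "\<dots> \<le> card (eu ` {..<m}) + card (ev ` {..<m})" unfolding ends_def by (rule card_Un_le)
  also have "\<dots> \<le> m + m" using card_image_le[of "{..<m}" eu] card_image_le[of "{..<m}" ev] by simp
  finally show ?thesis by simp
qed

text \<open>The largest intermediate values are products of a weight and a flow, of order
  \<open>m ^ 4\<close>; the power 7 leaves ample room. The bound on \<open>2 * n\<close> serves the
  sum of two vertex numbers in \<open>prog_push\<close>.\<close>

locale run = cut_instance +
  fixes n w :: nat
  assumes ends_lt: "\<And>i. i < m \<Longrightarrow> eu i < n \<and> ev i < n"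
    and words: "1000 * (m + 2) ^ 7 \<le> 2 ^ w" "2 * n \<le> 2 ^ w"
begin

definition \<rho> :: "nat \<Rightarrow> real" where "\<rho> = input_params \<phi> b"

lemma rho [simp]: "\<rho> 0 = \<phi>" "\<rho> (Suc 0) = b"
  by (auto simp: \<rho>_def input_params_def)

lemma words_lt:
  assumes "x \<le> 900 * (m + 2) ^ 6" shows "x < 2 ^ w"
proof -
  have "(m + 2) ^ 6 \<le> (m + 2) ^ 7" by (intro power_increasing) auto
  moreover have "0 < (m + 2) ^ 7" by simp
  ultimately show ?thesis using assms words by linarith
qed

lemma words_lt1: "x \<le> 900 * (m + 2) \<Longrightarrow> x < 2 ^ w"
proof (rule words_lt)
  assume "x \<le> 900 * (m + 2)"
  moreover have "(m + 2) ^ 1 \<le> (m + 2) ^ 6" by (intro power_increasing) auto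
  ultimately show "x \<le> 900 * (m + 2) ^ 6" by simp
qed

lemma words_lt3: "x \<le> 900 * (m + 2) ^ 3 \<Longrightarrow> x < 2 ^ w"
proof (rule words_lt)
  assume "x \<le> 900 * (m + 2) ^ 3"
  moreover have "(m + 2) ^ 3 \<le> (m + 2) ^ 6" by (intro power_increasing) auto
  ultimately show "x \<le> 900 * (m + 2) ^ 6" by linarith
qed

lemma w_pos [simp]: "0 < w"
proof -
  have "1 < (2 :: nat) ^ w" by (rule words_lt1) simp
  thus ?thesis by (metis less_irrefl neq0_conv power_0)
qed

lemma const_mod [simp]:
  "Suc 0 mod 2 ^ w = Suc 0" "2 mod 2 ^ w = (2 :: nat)" "3 mod 2 ^ w = (3 :: nat)"
  "8 mod 2 ^ w = (8 :: nat)" "16 mod 2 ^ w = (16 :: nat)" "m mod 2 ^ w = m"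
  "(2 * m) mod 2 ^ w = 2 * m"
  by (auto intro!: mod_less words_lt1)

definition inp :: "memory \<Rightarrow> bool" where
  "inp s \<longleftrightarrow> s 0 1 = m \<and> s 1 = eu \<and> s 2 = ev"

lemma inpD: assumes "inp s" shows "s 0 1 = m" "s 0 (Suc 0) = m" "s 1 = eu" "s (Suc 0) = eu" "s 2 = ev"
  using assms by (auto simp: inp_def)

lemma inp_frame: "inp s \<Longrightarrow> frame A s s' \<Longrightarrow> A \<inter> {0, 1, 2} = {} \<Longrightarrow> inp s'"
  unfolding inp_def frame_def by auto

lemma wp_edges:
  assumes "inp s" "I 0 s"
    and "\<And>k s x. I k s \<Longrightarrow> I k (s(ix_a := x))"
    and "\<And>k s. I k s \<Longrightarrow> inp s"
    and "\<And>k s. I k s \<Longrightarrow> k < m \<Longrightarrow> s ix_a 0 = k \<Longrightarrow> inp s \<Longrightarrow>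
      wp w \<rho> c (\<lambda>t s'. t \<le> \<tau> \<and> s' ix_a 0 = k \<and> I (Suc k) s') s"
    and "\<And>t s. I m s \<Longrightarrow> t \<le> 2 + m * (\<tau> + 2) \<Longrightarrow> Q t s"
  shows "wp w \<rho> (for_edges c) Q s"
proof (rule wp_for_edges[where m = m and I = I and \<tau> = \<tau>])
  show "s 0 1 = m" using assms(1) by (simp add: inp_def)
  show "m < 2 ^ w" by (rule words_lt1) simp
  fix k s assume I: "I k s" "k < m" "s ix_a 0 = k"
  show "wp w \<rho> c (\<lambda>t s'. t \<le> \<tau> \<and> s' ix_a 0 = k \<and> s' 0 1 = m \<and> I (Suc k) s') s"
    by (rule wp_mono[OF assms(5)[OF I assms(4)[OF I(1)]]]) (use assms(4) in \<open>auto simp: inp_def\<close>)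
qed (use assms w_pos in auto)

abbreviation "removed s \<equiv> {v. s rem_a v \<noteq> (0 :: nat)}"

section \<open>Execution of the growing phase\<close>

lemma wp_scan:
  assumes "inp s"
  shows "wp w \<rho> prog_scan (\<lambda>t s'. t \<le> 40 * m + 40 \<and> frame {ix_a, out_a, cut_a, cutr_a} s s' \<and>
    s' out_a 0 = out (s lab_a) \<and> s' cut_a 0 = ct (labelled (s lab_a)) \<and>
    s' cutr_a 0 = ctr (removed s) (labelled (s lab_a))) s"
proof -
  let ?B = "labelled (s lab_a)" and ?R = "removed s"
  define U where "U k = (\<Sum>i<k. of_bool (eu i \<in> - ?B) + of_bool (ev i \<in> - ?B) :: nat)" for k
  define A where "A k = (\<Sum>i<k. of_bool ((eu i \<in> ?B) \<noteq> (ev i \<in> ?B)) :: nat)" for k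
  define A' where "A' k = (\<Sum>i<k. of_bool ((eu i \<in> ?B) \<noteq> (ev i \<in> ?B) \<and> eu i \<notin> ?R \<and> ev i \<notin> ?R) :: nat)" for k
  have z: "U 0 = 0" "A 0 = 0" "A' 0 = 0" by (auto simp: U_def A_def A'_def)
  have f: "U m = out (s lab_a)" "A m = ct ?B" "A' m = ctr ?R ?B"
    by (auto simp: U_def A_def A'_def vl_def ct_def ctr_def)
  have S: "U (Suc k) = U k + (of_bool (s lab_a (eu k) = 0) + of_bool (s lab_a (ev k) = 0))"
    "A (Suc k) = A k + of_bool ((s lab_a (eu k) = 0) \<noteq> (s lab_a (ev k) = 0))"
    "A' (Suc k) = A' k + of_bool ((s lab_a (eu k) = 0) \<noteq> (s lab_a (ev k) = 0) \<and> s rem_a (eu k) = 0 \<and> s rem_a (ev k) = 0)" for k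
    by (auto simp: U_def A_def A'_def labelled_def)
  have b: "U k \<le> 2 * k \<and> A k \<le> k \<and> A' k \<le> k" for k
    by (induction k) (use z S in \<open>auto simp: of_bool_def\<close>)
  let ?I = "\<lambda>k s'. frame {ix_a, out_a, cut_a, cutr_a} s s' \<and> s' out_a 0 = U k \<and> s' cut_a 0 = A k \<and> s' cutr_a 0 = A' k"
  show ?thesis
    unfolding prog_scan_def wp_Seq wp_Store
  proof (rule wp_edges[where I = ?I and \<tau> = 20], goal_cases)
    case 1 show ?case using assms by (auto simp: inp_def)
  next
    case 2 show ?case by (auto simp: frame_def z)
  next
    case (3 k s' x) thus ?case by (auto simp: frame_def)
  next
    case (4 k s') thus ?case using inp_frame[OF assms] by auto
  next
    case (5 k s')
    note i = inpD[OF 5(4)]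
    have fr: "s' lab_a = s lab_a" "s' rem_a = s rem_a" using 5(1) by (auto simp: frame_def)
    have lt: "Suc (Suc (U k)) < 2 ^ w" "Suc (A k) < 2 ^ w" "Suc (A' k) < 2 ^ w"
      using b[of k] 5(2) by (auto intro!: words_lt1)
    show ?case
      using 5(1,3) lt by (auto simp: i fr S frame_def)
  next
    case (6 t s') thus ?case using f by auto
  qed
qed

text \<open>The quantified clauses of the postcondition are the hypotheses \<open>old\<close>,
  \<open>new\<close> and \<open>relaxed\<close> of \<open>grow_step\<close>. They refer to the
  labels before the pass, so labels set during the pass need no separate treatment there.\<close>

lemma wp_relax:
  assumes inp: "inp s" and u: "0 < s out_a 0" and un: "0 < s unit_a 0"
    and l: "l = len (s wt_a) (s unit_a 0)" "\<And>i. i < m \<Longrightarrow> l i \<le> 5 * m"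
    and t: "tree l rt (s lab_a) (s par_a) (s ord_a) (s cnt_a 0)"
    and r: "\<And>v. s lab_a v \<le> s rad_a 0" "s rad_a 0 + 7 * m < 2 ^ w" "0 < s rad_a 0"
    and r': "r' = s rad_a 0 + 2 * m div s out_a 0"
  shows "wp w \<rho> prog_relax (\<lambda>t s'. t \<le> 20 * m + 20 \<and>
    frame {lab_a, par_a, ord_a, ix_a, rad_a, cnt_a} s s' \<and> s' rad_a 0 = r' \<and>
    tree l rt (s' lab_a) (s' par_a) (s' ord_a) (s' cnt_a 0) \<and>
    (\<forall>v. s lab_a v \<noteq> 0 \<longrightarrow> s' lab_a v = s lab_a v) \<and>
    (\<forall>v. s lab_a v = 0 \<longrightarrow> s' lab_a v = 0 \<or> s' lab_a v = r' \<and> (m < s out_a 0 \<longrightarrow> s rem_a v = 0)) \<and>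
    (\<forall>i<m. \<forall>x y. (x = eu i \<and> y = ev i \<or> x = ev i \<and> y = eu i) \<longrightarrow> s lab_a x \<noteq> 0 \<longrightarrow>
       (m < s out_a 0 \<longrightarrow> s rem_a y = 0) \<longrightarrow> s lab_a x + l i \<le> r' \<longrightarrow> s' lab_a y \<noteq> 0)) s"
proof -
  let ?D = "s lab_a" and ?u = "s out_a 0"
  have r'b: "r' + 5 * m < 2 ^ w" "0 < r'" "s rad_a 0 \<le> r'" "r' < 2 ^ w"
    using r(2,3) r' div_le_dividend[of "2 * m" ?u] by linarith+
  let ?I = "\<lambda>k s'. frame {lab_a, par_a, ord_a, ix_a, rad_a, cnt_a} s s' \<and> s' rad_a 0 = r' \<and>
    tree l rt (s' lab_a) (s' par_a) (s' ord_a) (s' cnt_a 0) \<and>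
    (\<forall>v. ?D v \<noteq> 0 \<longrightarrow> s' lab_a v = ?D v) \<and>
    (\<forall>v. ?D v = 0 \<longrightarrow> s' lab_a v = 0 \<or> s' lab_a v = r' \<and> (m < ?u \<longrightarrow> s rem_a v = 0)) \<and>
    (\<forall>i<k. \<forall>x y. (x = eu i \<and> y = ev i \<or> x = ev i \<and> y = eu i) \<longrightarrow> ?D x \<noteq> 0 \<longrightarrow>
       (m < ?u \<longrightarrow> s rem_a y = 0) \<longrightarrow> ?D x + l i \<le> r' \<longrightarrow> s' lab_a y \<noteq> 0)"
  show ?thesis
    unfolding prog_relax_def wp_Seq wp_Store
  proof (rule wp_edges[where I = ?I and \<tau> = 10], goal_cases)
    case 1 show ?case using inp by (auto simp: inp_def)
  next
    case 2
    show ?case using inpD[OF inp] r'b(4) t by (auto simp: frame_def r')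
  next
    case (3 k s' x) thus ?case by (auto simp: frame_def)
  next
    case (4 k s') thus ?case using inp_frame[OF inp] by auto
  next
    case (5 k s')
    note i = inpD[OF 5(4)]
    let ?D' = "s' lab_a" and ?x = "eu k" and ?y = "ev k"
    have fr: "s' wt_a = s wt_a" "s' unit_a = s unit_a" "s' rem_a = s rem_a" "s' out_a = s out_a"
      and rad: "s' rad_a 0 = r'" and tr: "tree l rt ?D' (s' par_a) (s' ord_a) (s' cnt_a 0)"
      and old: "\<And>v. ?D v \<noteq> 0 \<Longrightarrow> ?D' v = ?D v"
      and new: "\<And>v. ?D v = 0 \<Longrightarrow> ?D' v = 0 \<or> ?D' v = r' \<and> (m < ?u \<longrightarrow> s rem_a v = 0)"
      and prev: "\<And>i x y. i < k \<Longrightarrow> x = eu i \<and> y = ev i \<or> x = ev i \<and> y = eu i \<Longrightarrow> ?D x \<noteq> 0 \<Longrightarrow>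
        (m < ?u \<Longrightarrow> s rem_a y = 0) \<Longrightarrow> ?D x + l i \<le> r' \<Longrightarrow> ?D' y \<noteq> 0"
      using 5(1) by (auto simp: frame_def)
    have D'r: "?D' v \<le> r'" for v using old[of v] new[of v] r(1)[of v] r'b by (cases "?D v = 0") auto
    have lk: "s wt_a k div s unit_a 0 = l k - 1" "Suc (l k - 1) = l k" "0 < l k" by (auto simp: l len_def)
    have lb: "l k < 2 ^ w" using l(2)[OF 5(2)] by (intro words_lt1) simp
    have Dl: "?D' v + l k < 2 ^ w" for v using D'r[of v] l(2)[OF 5(2)] r'b by linarith
    have cb: "Suc (s' cnt_a 0) < 2 ^ w" using tree_count[OF tr] by (intro words_lt1) simp
    let ?c = "\<lambda>x y. ?D' x \<noteq> 0 \<and> ?D' y = 0 \<and> \<not> (s rem_a y \<noteq> 0 \<and> m < ?u) \<and> ?D' x + l k \<le> r'"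
    have can: "holds w \<rho> s' (can_label uX vX) = ?c ?x ?y" "holds w \<rho> s' (can_label vX uX) = ?c ?y ?x"
      using Dl lb lk by (auto simp: i fr rad 5(3))
    have ins: "tree l rt (?D'(y := r')) ((s' par_a)(y := k)) ((s' ord_a)(s' cnt_a 0 := y)) (Suc (s' cnt_a 0))"
      if "?c x y" "x = ?x \<and> y = ?y \<or> x = ?y \<and> y = ?x" for x y
      using that r'b 5(2) by (intro tree_insert[OF tr, of x]) auto
    have post: "?I (Suc k) s''" if s'': "frame {lab_a, par_a, ord_a, cnt_a} s' s''" "s'' lab_a = ?D'(y := r')"
      "s'' par_a = (s' par_a)(y := k)" "s'' ord_a = (s' ord_a)(s' cnt_a 0 := y)" "s'' cnt_a 0 = Suc (s' cnt_a 0)"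
      "?c x y" "x = ?x \<and> y = ?y \<or> x = ?y \<and> y = ?x" for s'' x y
    proof (intro conjI)
      show "frame {lab_a, par_a, ord_a, ix_a, rad_a, cnt_a} s s''"
        using 5(1) s''(1) by (auto intro: frame_trans)
      show "s'' rad_a 0 = r'" using s''(1) rad by (simp add: frame_def)
      show "tree l rt (s'' lab_a) (s'' par_a) (s'' ord_a) (s'' cnt_a 0)" using s'' ins by simp
      show "\<forall>v. ?D v \<noteq> 0 \<longrightarrow> s'' lab_a v = ?D v" using s'' old by auto
      show "\<forall>v. ?D v = 0 \<longrightarrow> s'' lab_a v = 0 \<or> s'' lab_a v = r' \<and> (m < ?u \<longrightarrow> s rem_a v = 0)"
        using s'' new by auto
      have ge: "?D' v \<noteq> 0 \<Longrightarrow> s'' lab_a v \<noteq> 0" for v using s''(2) r'b by simp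
      have xy: "s'' lab_a ?x \<noteq> 0 \<and> s'' lab_a ?y \<noteq> 0" using s''(2,6,7) r'b by auto
      show "\<forall>i<Suc k. \<forall>x y. (x = eu i \<and> y = ev i \<or> x = ev i \<and> y = eu i) \<longrightarrow> ?D x \<noteq> 0 \<longrightarrow>
        (m < ?u \<longrightarrow> s rem_a y = 0) \<longrightarrow> ?D x + l i \<le> r' \<longrightarrow> s'' lab_a y \<noteq> 0"
      proof (intro allI impI)
        fix i x y assume a: "i < Suc k" "x = eu i \<and> y = ev i \<or> x = ev i \<and> y = eu i" "?D x \<noteq> 0"
          "m < ?u \<longrightarrow> s rem_a y = 0" "?D x + l i \<le> r'"
        show "s'' lab_a y \<noteq> 0"
        proof (cases "i = k")
          case True thus ?thesis using xy a(2) by auto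
        next
          case False thus ?thesis using a prev[of i x y] by (intro ge) auto
        qed
      qed
    qed
    have lab: "wp w \<rho> (prog_label e) (\<lambda>t s''. t \<le> 8 \<and> s'' ix_a 0 = k \<and> ?I (Suc k) s'') s'"
      if c: "?c x y" "x = ?x \<and> y = ?y \<and> e = vX \<or> x = ?y \<and> y = ?x \<and> e = uX" for x y e
    proof -
      have e: "eval w (s'(par_a := p, ord_a := q, cnt_a := q')) e = y"
        "eval w (s'(par_a := p, ord_a := q)) e = y" "eval w (s'(par_a := p)) e = y" "eval w s' e = y" for p q q'
        using c(2) 5(3) by (auto simp: i)
      show ?thesis
        unfolding prog_label_def wp_Seq wp_Store
        by (rule conjI[OF _ conjI[OF _ post[where x = x and y = y]]])
          (use c cb 5(3) rad in \<open>simp_all add: e frame_def del: fun_upd_apply, auto\<close>)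
    qed
    show ?case
    proof (cases "?c ?x ?y \<or> ?c ?y ?x")
      case True
      show ?thesis
      proof (cases "?c ?x ?y")
        case xy: True
        show ?thesis unfolding wp_If can if_P[OF xy] by (rule wp_mono[OF lab[OF xy]]) auto
      next
        case xy: False
        hence yx: "?c ?y ?x" using True by blast
        show ?thesis unfolding wp_If can if_not_P[OF xy] if_P[OF yx] by (rule wp_mono[OF lab[OF yx]]) auto
      qed
    next
      case False
      have "?I (Suc k) s'"
      proof -
        have "?D' y \<noteq> 0" if "x = eu i \<and> y = ev i \<or> x = ev i \<and> y = eu i" "?D x \<noteq> 0" "i < Suc k"
          "m < ?u \<longrightarrow> s rem_a y = 0" "?D x + l i \<le> r'" for i x y
        proof (cases "i = k")
          case True thus ?thesis using False that old[of x] by auto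
        next
          case False thus ?thesis using that prev[of i x y] by auto
        qed
        thus ?thesis using 5(1) by blast
      qed
      thus ?thesis unfolding wp_If can using False 5(3) by auto
    qed
  next
    case (6 t s') thus ?case by auto
  qed
qed

lemma nsteps_le: "nsteps \<le> 180 * real m * m"
proof -
  have m1: "1 \<le> real m" using m by simp
  have p: "potl \<le> 15 * m"
    using ln_le_minus_one[of "6 * real m"] ln_le_minus_one[of "3 * real m"] m1
    unfolding potl_def by simp
  have p0: "0 \<le> potl" using m1 by (simp add: potl_def)
  have "1 / (6 * real m) \<le> \<psi>" by (simp add: \<psi>_def)
  hence "2 * potl / \<psi> \<le> 2 * potl / (1 / (6 * real m))"
    using m1 psi p0 by (intro divide_left_mono mult_pos_pos) auto
  also have "\<dots> = 12 * real m * potl" by simp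
  also have "\<dots> \<le> 12 * real m * (15 * m)" using p by (intro mult_left_mono) auto
  finally show ?thesis by (simp add: nsteps_def)
qed

lemma grow_radius:
  assumes g: "grow l R rt D P O' c r f q" "(\<Sum>i<m. l i) \<le> 5 * m"
  shows "r + 7 * m < 2 ^ w"
proof (rule words_lt3)
  have "real q \<le> real (180 * m * m)" using grow_q_le[OF g] nsteps_le by simp
  hence "q \<le> 180 * m * m" by (simp only: of_nat_le_iff)
  hence "2 * m * q \<le> 2 * m * (180 * m * m)" by (rule mult_left_mono) simp
  moreover have "r \<le> 1 + 2 * m * q" using g by (simp add: grow_def)
  ultimately have "r + 7 * m \<le> 1 + 2 * m * (180 * m * m) + 7 * m" by linarith
  also have "\<dots> \<le> 900 * (m + 2) ^ 3" by (simp add: power3_eq_cube algebra_simps)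
  finally show "r + 7 * m \<le> 900 * (m + 2) ^ 3" .
qed

abbreviation (input) "growing l s q \<equiv>
  grow l (removed s) (s root_a 0) (s lab_a) (s par_a) (s ord_a) (s cnt_a 0) (s rad_a 0) (s f_a 0) q"

text \<open>The bound \<open>f\<close> is quantified because \<open>f_a\<close> has already been
  increased when the test decides to stop; the witness is its value before the step.\<close>

definition grown :: "(nat \<Rightarrow> nat) \<Rightarrow> memory \<Rightarrow> nat \<Rightarrow> bool" where
  "grown l s q \<longleftrightarrow> (\<exists>f.
    grow l (removed s) (s root_a 0) (s lab_a) (s par_a) (s ord_a) (s cnt_a 0) (s rad_a 0) f q \<and>
    (s mode_a 0 = 1 \<and> m < out (s lab_a) \<and>
      16 * real (ctr (removed s) (labelled (s lab_a))) \<le> \<phi> * f \<or>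
     s mode_a 0 = 2 \<and> out (s lab_a) \<le> m \<and> out (s lab_a) \<le> 2 * b * m \<or>
     s mode_a 0 = 3 \<and> out (s lab_a) \<le> m \<and> 2 * m * b \<le> out (s lab_a) \<and>
      16 * real (ct (labelled (s lab_a))) \<le> \<phi> * out (s lab_a)))"

abbreviation "grow_vars \<equiv> {lab_a, par_a, ord_a, ix_a, out_a, cut_a, cutr_a, g_a, cc_a, f_a, rad_a, cnt_a, mode_a}"

text \<open>The growth invariant refers to \<open>s\<close>, the memory before the scan; the
  relaxation starts in \<open>s2\<close>, where the scan results and the new \<open>f_a\<close> have
  been stored.\<close>

lemma wp_grow_relax:
  assumes inp: "inp s" and l: "l = len (s wt_a) (s unit_a 0)" "(\<Sum>i<m. l i) \<le> 5 * m" "0 < s unit_a 0"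
    and g: "growing l s q"
    and s2: "frame {ix_a, out_a, cut_a, cutr_a, g_a, cc_a, f_a} s s2" "s2 out_a 0 = out (s lab_a)"
      "0 < out (s lab_a)"
      "s2 f_a 0 = (if m < out (s lab_a) then s f_a 0 + ctr (removed s) (labelled (s lab_a)) else s f_a 0)"
    and go: "if m < out (s lab_a) then \<psi> * s f_a 0 \<le> ctr (removed s) (labelled (s lab_a))
      else \<psi> * out (s lab_a) \<le> ct (labelled (s lab_a))"
  shows "wp w \<rho> prog_relax (\<lambda>t s'. t \<le> 20 * m + 20 \<and> frame grow_vars s s' \<and> s' mode_a 0 = s mode_a 0 \<and>
    growing l s' (q + 1)) s2"
proof -
  have e: "s2 lab_a = s lab_a" "s2 par_a = s par_a" "s2 ord_a = s ord_a" "s2 cnt_a = s cnt_a"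
    "s2 rad_a = s rad_a" "s2 wt_a = s wt_a" "s2 unit_a = s unit_a" "s2 rem_a = s rem_a"
    using s2(1) by (auto simp: frame_def)
  have t: "tree l (s root_a 0) (s lab_a) (s par_a) (s ord_a) (s cnt_a 0)"
    and r: "\<And>v. s lab_a v \<le> s rad_a 0" "0 < s rad_a 0" using g by (auto simp: grow_def)
  have l5: "l i \<le> 5 * m" if "i < m" for i
    using member_le_sum[of i "{..<m}" l] that l(2) by auto
  have l0: "0 < l i" for i by (simp add: l(1) len_def)
  show ?thesis
  proof (rule wp_mono[OF wp_relax[where l = l and rt = "s root_a 0" and r' = "s rad_a 0 + 2 * m div out (s lab_a)"]], goal_cases)
    case 1 show ?case using inp_frame[OF inp s2(1)] by simp
  next
    case 2 show ?case using s2 by simp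
  next
    case 3 show ?case using l e by simp
  next
    case 4 show ?case using l e by simp
  next
    case (5 i) thus ?case by (rule l5)
  next
    case 6 show ?case using t e by simp
  next
    case (7 v) show ?case using r e by simp
  next
    case 8 show ?case using grow_radius[OF g l(2)] e by simp
  next
    case 9 show ?case using r e by simp
  next
    case 10 show ?case using s2 e by simp
  next
    case (11 t' s')
    note p = 11[unfolded e s2(2)]
    have fr: "frame grow_vars s s'" using p s2(1) by (auto intro: frame_trans)
    have e': "s' rem_a = s rem_a" "s' root_a = s root_a" "s' f_a = s2 f_a" "s' mode_a = s mode_a"
      using fr frameD[of _ s2 s' f_a] frameD[of _ s2 s' mode_a] frameD[OF s2(1), of mode_a] p
      by (auto simp: frame_def)
    have "growing l s' (q + 1)"
      unfolding e'
    proof (rule grow_step[OF g l0 l(2) s2(3)])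
      show "s' rad_a 0 = s rad_a 0 + 2 * m div out (s lab_a)" using p by simp
      show "s2 f_a 0 = (if m < out (s lab_a) then s f_a 0 + ctr (removed s) (labelled (s lab_a)) else s f_a 0)"
        by (rule s2(4))
      show "tree l (s root_a 0) (s' lab_a) (s' par_a) (s' ord_a) (s' cnt_a 0)" using p by simp
      show "s' lab_a v = s lab_a v" if "s lab_a v \<noteq> 0" for v using p that by blast
      show "s' lab_a v = 0 \<or> s' lab_a v = s' rad_a 0 \<and> (m < out (s lab_a) \<longrightarrow> v \<notin> removed s)"
        if "s lab_a v = 0" for v using p that by auto
      show "s' lab_a y \<noteq> 0" if "i < m" "x = eu i \<and> y = ev i \<or> x = ev i \<and> y = eu i" "s lab_a x \<noteq> 0"
        "m < out (s lab_a) \<Longrightarrow> y \<notin> removed s" "s lab_a x + l i \<le> s' rad_a 0" for i x y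
        using p that by auto
    qed (rule go)
    thus ?case using p fr e' by auto
  qed
qed

lemma wp_grow_body:
  assumes inp: "inp s" and l: "l = len (s wt_a) (s unit_a 0)" "(\<Sum>i<m. l i) \<le> 5 * m" "0 < s unit_a 0"
    and g: "growing l s q" and mode: "s mode_a 0 = 0"
  shows "wp w \<rho> prog_grow_step (\<lambda>t s'. t \<le> 80 * m + 80 \<and> frame grow_vars s s' \<and>
    (s' mode_a 0 = 0 \<and> growing l s' (q + 1) \<or> s' mode_a 0 \<noteq> 0 \<and> grown l s' q)) s"
  unfolding prog_grow_step_def wp_Seq
proof (rule wp_mono[OF wp_scan[OF inp]], goal_cases)
  case (1 t s1)
  let ?B = "labelled (s lab_a)" and ?R = "removed s" and ?u = "out (s lab_a)"
  have t: "t \<le> 40 * m + 40" and fr1: "frame {ix_a, out_a, cut_a, cutr_a} s s1"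
    and u: "s1 out_a 0 = ?u" "s1 cut_a 0 = ct ?B" "s1 cutr_a 0 = ctr ?R ?B" using 1 by auto
  have inp1: "inp s1" using inp_frame[OF inp fr1] by simp
  note i = inpD[OF inp1]
  have e: "s1 f_a = s f_a" "s1 mode_a = s mode_a" using fr1 by (auto simp: frame_def)
  have f0: "0 < s f_a 0" using g by (simp add: grow_def)
  have cm: "ct ?B \<le> m" "ctr ?R ?B \<le> m"
  proof -
    have "ct ?B \<le> (\<Sum>i<m. 1)" unfolding ct_def by (intro sum_mono) auto
    thus "ct ?B \<le> m" by simp
    have "ctr ?R ?B \<le> (\<Sum>i<m. 1)" unfolding ctr_def by (intro sum_mono) auto
    thus "ctr ?R ?B \<le> m" by simp
  qed
  have lt: "16 * ct ?B < 2 ^ w" "16 * ctr ?R ?B < 2 ^ w" "ct ?B < 2 ^ w" "ctr ?R ?B < 2 ^ w"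
    using cm by (auto intro!: words_lt1)
  have fb: "m < ?u \<Longrightarrow> s f_a 0 \<le> 6 * m" using grow_f_le[OF g _ l(2)] .
  hence lt': "m < ?u \<Longrightarrow> s f_a 0 + ctr ?R ?B < 2 ^ w" using cm by (intro words_lt1) fastforce
  \<comment> \<open>Source of the second term of \<psi>: a passed test with \<open>0 < x\<close>
    forces the integer \<open>y\<close> to be at least 1, hence at least
    \<open>x / (6 * m)\<close>.\<close>
  have psi_le: "\<psi> * real x \<le> real y" if "real x * \<phi> \<le> 16 * real y" "0 < x" "x \<le> 6 * m" for x y :: nat
  proof -
    have "0 < real x * \<phi>" using that phi by simp
    hence "0 < y" using that(1) by (cases y) auto
    hence "6 * m * 1 \<le> 6 * m * y" by (intro mult_left_mono) auto
    hence "x \<le> 6 * m * y" using that(3) by linarith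
    hence "real x \<le> real (6 * m * y)" by (rule of_nat_mono)
    hence "1 / (6 * real m) * x \<le> y" using m by (simp add: field_simps)
    moreover have "\<phi> / 16 * x \<le> y" using that(1) by (simp add: mult.commute)
    ultimately show ?thesis unfolding \<psi>_def by (auto simp: max_def)
  qed
  have R1: "removed s1 = ?R" "s1 lab_a = s lab_a" "s1 par_a = s par_a" "s1 ord_a = s ord_a" "s1 cnt_a = s cnt_a"
    "s1 rad_a = s rad_a" "s1 root_a = s root_a"
    using fr1 by (auto simp: frame_def)
  show ?case
  proof (cases "?u \<le> m \<and> \<not> 2 * real m * b \<le> ?u")
    case True
    have "grown l (s1(mode_a := (s1 mode_a)(0 := 2))) q"
      unfolding grown_def using True g R1 by (intro exI[of _ "s f_a 0"]) (auto simp: mult_ac)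
    moreover have "frame grow_vars s (s1(mode_a := (s1 mode_a)(0 := 2)))"
      using fr1 by (auto simp: frame_def)
    ultimately show ?thesis
      using True t u by (simp add: i e)
  next
    case False
    \<comment> \<open>If the outer volume is not below the threshold, it is positive because
      \<open>b\<close> is; the step width divides by it.\<close>
    have u0: "0 < ?u"
    proof (cases "m < ?u")
      case False
      hence "0 < 2 * real m * b" "2 * real m * b \<le> ?u" using \<open>\<not> (_ \<and> _)\<close> m b by auto
      thus ?thesis by linarith
    qed simp
    show ?thesis
    proof (cases "m < ?u")
      case mu: True
      let ?s2 = "s1(g_a := (s1 g_a)(0 := s f_a 0), cc_a := (s1 cc_a)(0 := ctr ?R ?B),
        f_a := (s f_a)(0 := s f_a 0 + ctr ?R ?B))"
      have fr2: "frame {ix_a, out_a, cut_a, cutr_a, g_a, cc_a, f_a} s ?s2"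
        using fr1 by (auto simp: frame_def)
      show ?thesis
      proof (cases "real (s f_a 0) * \<phi> \<le> 16 * real (ctr ?R ?B)")
        case go: True
        have r: "wp w \<rho> prog_relax (\<lambda>t s'. t \<le> 20 * m + 20 \<and> frame grow_vars s s' \<and> s' mode_a 0 = s mode_a 0 \<and>
            growing l s' (q + 1)) ?s2"
          using mu go fb f0 psi_le u0 u fr2 by (intro wp_grow_relax[OF inp l g]) auto
        show ?thesis
          using mu go lt lt' u
          by (simp add: i e) (rule wp_mono[OF r[simplified]], use t mode in auto)
      next
        case stop: False
        have "grown l (?s2(mode_a := (s1 mode_a)(0 := 1))) q"
          unfolding grown_def using mu stop g R1 by (intro exI[of _ "s f_a 0"]) (auto simp: mult_ac)
        moreover have "frame grow_vars s (?s2(mode_a := (s1 mode_a)(0 := 1)))"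
          using fr2 by (auto simp: frame_def)
        ultimately show ?thesis
          using mu stop lt lt' u t by (simp add: i e)
      qed
    next
      case mu: False
      let ?s2 = "s1(g_a := (s1 g_a)(0 := ?u), cc_a := (s1 cc_a)(0 := ct ?B))"
      have fr2: "frame {ix_a, out_a, cut_a, cutr_a, g_a, cc_a, f_a} s ?s2"
        using fr1 by (auto simp: frame_def)
      have ub: "2 * real m * b \<le> ?u" using False mu by simp
      show ?thesis
      proof (cases "real ?u * \<phi> \<le> 16 * real (ct ?B)")
        case go: True
        have r: "wp w \<rho> prog_relax (\<lambda>t s'. t \<le> 20 * m + 20 \<and> frame grow_vars s s' \<and> s' mode_a 0 = s mode_a 0 \<and>
            growing l s' (q + 1)) ?s2"
          using mu go psi_le u0 u fr2 e by (intro wp_grow_relax[OF inp l g]) auto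
        show ?thesis
          using mu go lt u ub
          by (simp add: i e) (rule wp_mono[OF r[simplified]], use t mode in auto)
      next
        case stop: False
        have "grown l (?s2(mode_a := (s1 mode_a)(0 := 3))) q"
          unfolding grown_def using mu stop g R1 ub by (intro exI[of _ "s f_a 0"]) (auto simp: mult_ac)
        moreover have "frame grow_vars s (?s2(mode_a := (s1 mode_a)(0 := 3)))"
          using fr2 by (auto simp: frame_def)
        ultimately show ?thesis
          using mu stop lt u t ub by (simp add: i e)
      qed
    qed
  qed
qed

definition ends_upto :: "nat \<Rightarrow> nat set" where
  "ends_upto k = eu ` {..<k} \<union> ev ` {..<k}"

lemma ends_upto_Suc: "v \<in> ends_upto (Suc k) \<longleftrightarrow> v \<in> ends_upto k \<or> v = eu k \<or> v = ev k"
  by (auto simp: lessThan_Suc ends_upto_def)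

lemma ends_upto_0 [simp]: "ends_upto 0 = {}" and ends_upto_m [simp]: "ends_upto m = ends"
  by (auto simp: ends_upto_def ends_def)

text \<open>Only ends of edges are cleared, so labels elsewhere have to be 0 beforehand.\<close>

lemma wp_start:
  assumes inp: "inp s" and z: "z \<in> ends" "s rem_a z = 0" and D: "\<And>v. v \<notin> ends \<Longrightarrow> s lab_a v = 0"
  shows "wp w \<rho> prog_start (\<lambda>t s'. t \<le> 20 * m + 20 \<and>
    frame {lab_a, ord_a, ix_a, f_a, rad_a, cnt_a, mode_a, root_a} s s' \<and>
    s' root_a 0 \<in> ends \<and> s rem_a (s' root_a 0) = 0 \<and>
    s' lab_a = (\<lambda>v. if v = s' root_a 0 then 1 else 0) \<and> s' ord_a 0 = s' root_a 0 \<and>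
    s' cnt_a 0 = 1 \<and> s' rad_a 0 = 1 \<and> s' f_a 0 = 1 \<and> s' mode_a 0 = 0) s"
proof -
  let ?I = "\<lambda>k s'. frame {lab_a, ix_a, root_a} s s' \<and>
    s' lab_a = (\<lambda>v. if v \<in> ends_upto k then 0 else s lab_a v) \<and>
    ((\<exists>v\<in>ends_upto k. s rem_a v = 0) \<longrightarrow> s' root_a 0 \<in> ends \<and> s rem_a (s' root_a 0) = 0)"
  show ?thesis
    unfolding prog_start_def wp_Seq
  proof (rule wp_edges[where I = ?I and \<tau> = 10], goal_cases)
    case 1 show ?case by (rule inp)
  next
    case 2 show ?case by (auto simp: frame_def)
  next
    case (3 k s' x) thus ?case by (auto simp: frame_def)
  next
    case (4 k s') thus ?case using inp_frame[OF inp] by auto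
  next
    case (5 k s')
    note i = inpD[OF 5(4)]
    have rem: "s' rem_a = s rem_a" using 5(1) by (auto simp: frame_def)
    have e: "eu k \<in> ends" "ev k \<in> ends" using 5(2) by (auto simp: ends_def)
    have lab: "(s' lab_a)(eu k := 0, ev k := 0) = (\<lambda>v. if v \<in> ends_upto (Suc k) then 0 else s lab_a v)"
      using 5(1) unfolding ends_upto_Suc by auto
    have ex: "(\<exists>v\<in>ends_upto (Suc k). s rem_a v = 0) \<longleftrightarrow>
        (\<exists>v\<in>ends_upto k. s rem_a v = 0) \<or> s rem_a (eu k) = 0 \<or> s rem_a (ev k) = 0"
      by (auto simp: ends_upto_Suc Bex_def)
    have fr: "frame {lab_a, ix_a, root_a} s s'" using 5(1) by blast
    have root: "(\<exists>v\<in>ends_upto k. s rem_a v = 0) \<longrightarrow> s' root_a 0 \<in> ends \<and> s rem_a (s' root_a 0) = 0"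
      using 5(1) by blast
    have fr': "frame {lab_a, ix_a, root_a} s (s'(lab_a := f, root_a := g))" "frame {lab_a, ix_a, root_a} s (s'(lab_a := f))" for f g
      using fr by (auto simp: frame_def)
    show ?case
      using 5(3) e fr' root by (simp add: i rem lab ex)
  next
    case (6 t s')
    have lab: "s' lab_a = (\<lambda>v. 0)" using 6(1) D by auto
    have fr: "frame {lab_a, ix_a, root_a} s s'" using 6(1) by blast
    have root: "s' root_a 0 \<in> ends" "s rem_a (s' root_a 0) = 0" using 6(1) z by auto
    show ?case
      using 6(2) fr root by (auto simp: lab frame_def)
  qed
qed

lemma wp_grow_loop:
  assumes inp: "inp s0" and w0: "wts (s0 wt_a) W PW (s0 unit_a 0) (removed s0)"
    and l: "l = len (s0 wt_a) (s0 unit_a 0)" and g: "growing l s0 0" and mode: "s0 mode_a 0 = 0"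
  shows "wp w \<rho> (While (Less (var mode_a) (Const 1)) prog_grow_step)
    (\<lambda>t s'. real t \<le> 1 + (nsteps + 1) * (80 * m + 81) \<and> frame grow_vars s0 s' \<and> (\<exists>q. grown l s' q)) s0"
proof -
  let ?I = "\<lambda>k s. frame grow_vars s0 s \<and>
    (s mode_a 0 = 0 \<and> growing l s k \<or> s mode_a 0 \<noteq> 0 \<and> (\<exists>q. Suc q = k \<and> grown l s q))"
  \<comment> \<open>One iteration more than growing steps: the last one only sets the mode and does
    not advance \<open>q\<close>.\<close>
  define N where "N = nat \<lfloor>nsteps\<rfloor> + 1"
  have sl: "(\<Sum>i<m. l i) \<le> 5 * m" unfolding l by (rule sum_len_le[OF w0])
  have un: "0 < s0 unit_a 0" by (rule wts_unit[OF w0])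
  show ?thesis
  proof (rule wp_While[where I = ?I and N = N and \<tau> = "80 * m + 80" and k = 0], goal_cases)
    case (1 k s)
    hence mode: "s mode_a 0 = 0" and g: "growing l s k" and fr: "frame grow_vars s0 s" by auto
    have e: "s wt_a = s0 wt_a" "s unit_a = s0 unit_a" using fr by (auto simp: frame_def)
    have inp': "inp s" using inp_frame[OF inp fr] by simp
    have "wp w \<rho> prog_grow_step (\<lambda>t s'. t \<le> 80 * m + 80 \<and> frame grow_vars s s' \<and>
      (s' mode_a 0 = 0 \<and> growing l s' (k + 1) \<or> s' mode_a 0 \<noteq> 0 \<and> grown l s' k)) s"
      by (rule wp_grow_body[OF inp' _ sl _ g mode]) (use e un l in auto)
    thus ?case
      by (rule wp_mono) (use fr in \<open>auto intro: frame_trans\<close>)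
  next
    case (2 k s)
    have q: "q \<le> nat \<lfloor>nsteps\<rfloor>" if "real q \<le> nsteps" for q
      using that by (simp add: le_nat_floor)
    show ?case
    proof (cases "s mode_a 0 = 0")
      case True
      hence "growing l s k" using 2 by blast
      thus ?thesis using q[OF grow_q_le[OF _ sl]] by (fastforce simp: N_def)
    next
      case False
      then obtain q where "Suc q = k" "grown l s q" using 2 by auto
      thus ?thesis using q[OF grow_q_le[OF _ sl]] unfolding grown_def by (fastforce simp: N_def)
    qed
  next
    case 3 show ?case using g mode frame_refl by blast
  next
    case (4 k t s)
    have "0 \<le> nsteps" using grow_q_le[OF g sl] by simp
    hence "real N \<le> nsteps + 1" by (simp add: N_def)
    hence "real N * (80 * m + 81) \<le> (nsteps + 1) * (80 * m + 81)" by (intro mult_right_mono) auto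
    moreover have "real t \<le> real (1 + N * (80 * m + 80 + 1))" using 4(3) by (rule of_nat_mono)
    moreover have "real (1 + N * (80 * m + 80 + 1)) = 1 + real N * (80 * m + 81)" by (simp add: algebra_simps)
    ultimately have "real t \<le> 1 + (nsteps + 1) * (80 * m + 81)" by linarith
    thus ?case using 4 by auto
  qed
qed

section \<open>Execution of the follow-up phases: cutting off, emitting, routing,
  reweighting\<close>

lemma wp_remove:
  assumes inp: "inp s" and R: "removed s \<subseteq> ends" "labelled (s lab_a) \<subseteq> ends"
  shows "wp w \<rho> prog_remove (\<lambda>t s'. t \<le> 30 * m + 30 \<and> frame {rem_a, ix_a, hv_a, flag_a} s s' \<and>
    removed s' = removed s \<union> labelled (s lab_a) \<and>
    s' flag_a 0 = (if 2 * vl (removed s') < m then s flag_a 0 else 1)) s"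
proof -
  define R where "R = removed s \<union> labelled (s lab_a)"
  let ?I = "\<lambda>k s'. frame {rem_a, ix_a} s s' \<and>
    s' rem_a = (\<lambda>v. if v \<in> ends_upto k \<and> s lab_a v \<noteq> 0 then 1 else s rem_a v)"
  define U where "U k = (\<Sum>i<k. of_bool (eu i \<in> R) + of_bool (ev i \<in> R) :: nat)" for k
  have U: "U 0 = 0" "U m = vl R" "\<And>k. U (Suc k) = U k + (of_bool (eu k \<in> R) + of_bool (ev k \<in> R))"
    by (auto simp: U_def vl_def)
  have Ub: "U k \<le> 2 * k" for k by (induction k) (auto simp: U)
  show ?thesis
    unfolding prog_remove_def wp_Seq
  proof (rule wp_edges[where I = ?I and \<tau> = 10], goal_cases)
    case 1 show ?case by (rule inp)
  next
    case 2 show ?case by (auto simp: frame_def)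
  next
    case (3 k s' x) thus ?case by (auto simp: frame_def)
  next
    case (4 k s') thus ?case using inp_frame[OF inp] by auto
  next
    case (5 k s')
    note i = inpD[OF 5(4)]
    have lab: "s' lab_a = s lab_a" using 5(1) by (auto simp: frame_def)
    have fr: "frame {rem_a, ix_a} s (s'(rem_a := f))" for f using 5(1) by (auto simp: frame_def)
    have rem: "s' rem_a = (\<lambda>v. if v \<in> ends_upto k \<and> s lab_a v \<noteq> 0 then 1 else s rem_a v)" using 5(1) by blast
    have eq: "(\<lambda>v. if v \<in> ends_upto (Suc k) \<and> s lab_a v \<noteq> 0 then 1 else s rem_a v) =
        (let f = if s lab_a (eu k) = 0 then s' rem_a else (s' rem_a)(eu k := 1)
         in if s lab_a (ev k) = 0 then f else f(ev k := 1))"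
      by (auto simp: rem ends_upto_Suc fun_eq_iff Let_def)
    have fr0: "frame {rem_a, ix_a} s s'" using 5(1) by blast
    show ?case
      unfolding eq using 5(3) fr fr0 by (simp add: i lab Let_def)
  next
    case (6 t s1)
    have inp1: "inp s1" using inp_frame[OF inp] 6(1) by auto
    have rem: "removed s1 = R" using 6(1) R by (auto simp: labelled_def R_def)
    have fr: "frame {rem_a, ix_a} s s1" using 6(1) by blast
    let ?J = "\<lambda>k s'. frame {hv_a, ix_a} s1 s' \<and> s' hv_a 0 = U k"
    show ?case
      unfolding wp_Store
    proof (rule wp_edges[where I = ?J and \<tau> = 10], goal_cases)
      case 1 show ?case using inp1 by (auto simp: inp_def)
    next
      case 2 show ?case by (auto simp: frame_def U)
    next
      case (3 k s' x) thus ?case by (auto simp: frame_def)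
    next
      case (4 k s') thus ?case using inp_frame[OF inp1] by auto
    next
      case (5 k s')
      note i = inpD[OF 5(4)]
      have e: "s' rem_a = s1 rem_a" using 5(1) by (auto simp: frame_def)
      have in': "v \<in> R \<longleftrightarrow> s1 rem_a v \<noteq> 0" for v using rem by auto
      have lt: "Suc (Suc (U k)) < 2 ^ w" using Ub[of k] 5(2) by (intro words_lt1) auto
      have fr: "frame {hv_a, ix_a} s1 (s'(hv_a := f))" for f using 5(1) by (auto simp: frame_def)
      have hv: "s' hv_a 0 = U k" and fr0: "frame {hv_a, ix_a} s1 s'" using 5(1) by blast+
      show ?case
        using 5(3) lt fr fr0 hv by (simp add: i e U(3) in')
    next
      case (6 t' s')
      have inp': "inp s'" using inp_frame[OF inp1] 6(1) by auto
      note i = inpD[OF inp']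
      have e: "s' rem_a = s1 rem_a" "s' flag_a = s flag_a" using 6(1) fr by (auto simp: frame_def)
      have lt: "2 * vl R < 2 ^ w" using vl_le[of R] by (intro words_lt1) simp
      have fr': "frame {rem_a, ix_a, hv_a, flag_a} s s'" using fr 6(1) by (auto intro: frame_trans)
      hence fr'': "frame {rem_a, ix_a, hv_a, flag_a} s (s'(flag_a := f))" for f by (auto simp: frame_def)
      have hv: "s' hv_a 0 = vl R" using 6(1) U by simp
      have rem': "removed s' = R" using rem e by simp
      show ?case
        using 6(2) \<open>t \<le> _\<close> fr' fr'' hv lt rem' by (simp add: i e R_def)
    qed
  qed
qed

lemma wp_emit:
  assumes inp: "inp s" and R: "removed s \<subseteq> ends" "labelled (s lab_a) \<subseteq> ends"
  shows "wp w \<rho> prog_emit (\<lambda>t s'. t \<le> 20 * m + 20 \<and> frame {rem_a, ix_a, flag_a} s s' \<and>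
    removed s' = labelled (s lab_a) \<and> s' flag_a 0 = 1) s"
proof -
  let ?I = "\<lambda>k s'. frame {rem_a, ix_a} s s' \<and>
    s' rem_a = (\<lambda>v. if v \<in> ends_upto k then s lab_a v else s rem_a v)"
  show ?thesis
    unfolding prog_emit_def wp_Seq
  proof (rule wp_edges[where I = ?I and \<tau> = 10], goal_cases)
    case 1 show ?case by (rule inp)
  next
    case 2 show ?case by (auto simp: frame_def)
  next
    case (3 k s' x) thus ?case by (auto simp: frame_def)
  next
    case (4 k s') thus ?case using inp_frame[OF inp] by auto
  next
    case (5 k s')
    note i = inpD[OF 5(4)]
    have lab: "s' lab_a = s lab_a" using 5(1) by (auto simp: frame_def)
    have fr: "frame {rem_a, ix_a} s (s'(rem_a := f))" for f using 5(1) by (auto simp: frame_def)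
    have rem: "(s' rem_a)(eu k := s lab_a (eu k), ev k := s lab_a (ev k)) =
        (\<lambda>v. if v \<in> ends_upto (Suc k) then s lab_a v else s rem_a v)"
      using 5(1) unfolding ends_upto_Suc by (auto simp: fun_eq_iff)
    show ?case using 5(3) fr by (simp add: i lab rem)
  next
    case (6 t s')
    have fr: "frame {rem_a, ix_a, flag_a} s (s'(flag_a := f))" for f using 6(1) by (auto simp: frame_def)
    have "removed s' = labelled (s lab_a)" using 6(1) R by (auto simp: labelled_def)
    thus ?case using 6(2) fr by simp
  qed
qed

lemma wp_degrees:
  assumes inp: "inp s"
  shows "wp w \<rho> prog_degrees
    (\<lambda>t s'. t \<le> 30 * m + 30 \<and> frame {sub_a, con_a, ix_a} s s' \<and>
      (\<forall>v\<in>ends. s' sub_a v = vl {v}) \<and> (\<forall>i<m. s' con_a i = 0)) s"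
proof -
  let ?I = "\<lambda>k s'. frame {sub_a, con_a, ix_a} s s' \<and> (\<forall>v\<in>ends_upto k. s' sub_a v = 0) \<and> (\<forall>i<k. s' con_a i = 0)"
  show ?thesis
    unfolding prog_degrees_def wp_Seq
  proof (rule wp_edges[where I = ?I and \<tau> = 10], goal_cases)
    case 1 show ?case by (rule inp)
  next
    case 2 show ?case by (auto simp: frame_def)
  next
    case (3 k s' x) thus ?case by (auto simp: frame_def)
  next
    case (4 k s') thus ?case using inp_frame[OF inp] by auto
  next
    case (5 k s')
    note i = inpD[OF 5(4)]
    have fr: "frame {sub_a, con_a, ix_a} s (s'(sub_a := f, con_a := g))" for f g
      using 5(1) by (auto simp: frame_def)
    show ?case using 5(1,3) fr by (auto simp: i ends_upto_Suc less_Suc_eq)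
  next
    case (6 t s1)
    have inp1: "inp s1" using inp_frame[OF inp] 6(1) by auto
    have z: "s1 sub_a v = 0" if "v \<in> ends" for v using 6(1) that by auto
    define U where "U k v = (\<Sum>i<k. of_bool (eu i \<in> {v}) + of_bool (ev i \<in> {v}) :: nat)" for k v
    have U: "U 0 v = 0" "U m v = vl {v}" "U (Suc k) v = U k v + (of_bool (eu k = v) + of_bool (ev k = v))" for v k
      by (auto simp: U_def vl_def)
    have Ub: "U k v \<le> 2 * k" for k v by (induction k) (auto simp: U)
    let ?J = "\<lambda>k s'. frame {sub_a, ix_a} s1 s' \<and> (\<forall>v\<in>ends. s' sub_a v = U k v)"
    show ?case
    proof (rule wp_edges[where I = ?J and \<tau> = 10], goal_cases)
      case 1 show ?case by (rule inp1)
    next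
      case 2 show ?case using z by (auto simp: frame_def U)
    next
      case (3 k s' x) thus ?case by (auto simp: frame_def)
    next
      case (4 k s') thus ?case using inp_frame[OF inp1] by auto
    next
      case (5 k s')
      note i = inpD[OF 5(4)]
      have fr: "frame {sub_a, ix_a} s1 (s'(sub_a := f))" for f using 5(1) by (auto simp: frame_def)
      have lt: "Suc (Suc (U k v)) < 2 ^ w" "Suc (U k v) < 2 ^ w" for v
        using Ub[of k v] 5(2) by (auto intro!: words_lt1)
      have e: "eu k \<in> ends" "ev k \<in> ends" using 5(2) by (auto simp: ends_def)
      have sub: "s' sub_a v = U k v" if "v \<in> ends" for v using 5(1) that by blast
      show ?case using 5(3) fr lt e by (auto simp: i sub U(3))
    next
      case (6 t' s')
      have "frame {sub_a, con_a, ix_a} s s'" using \<open>?I m s1\<close> 6(1) by (auto intro: frame_trans)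
      moreover have "s' con_a = s1 con_a" using 6(1) by (auto simp: frame_def)
      ultimately show ?case using 6 \<open>?I m s1\<close> \<open>t \<le> _\<close> U(2) by auto
    qed
  qed
qed

lemma wp_push:
  assumes inp: "inp s" and t: "tree l rt (s lab_a) (s par_a) (s ord_a) (s cnt_a 0)" and l: "\<And>i. 0 < l i"
    and sub: "\<And>v. v \<in> ends \<Longrightarrow> s sub_a v = vl {v}" and con: "\<And>i. i < m \<Longrightarrow> s con_a i = 0"
  shows "wp w \<rho> prog_push (\<lambda>t s'. t \<le> 20 * m + 20 \<and> frame {sub_a, con_a, j_a, y_a, pe_a} s s' \<and>
    pushed l (s lab_a) (s par_a) (s ord_a) (s cnt_a 0) 1 (s' sub_a) (s' con_a)) s"
proof -
  let ?c = "s cnt_a 0"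
  have c: "0 < ?c" "?c \<le> 2 * m" using t tree_count[OF t] by (auto simp: tree_def)
  let ?I = "\<lambda>k s'. k < ?c \<and> s' j_a 0 = ?c - k \<and> frame {sub_a, con_a, j_a, y_a, pe_a} s s' \<and>
    pushed l (s lab_a) (s par_a) (s ord_a) ?c (?c - k) (s' sub_a) (s' con_a)"
  show ?thesis
    unfolding prog_push_def wp_Seq wp_Store
  proof (rule wp_While[where I = ?I and N = "2 * m" and \<tau> = 8 and k = 0], goal_cases)
    case (1 k s')
    hence fr: "frame {sub_a, con_a, j_a, y_a, pe_a} s s'"
      and p: "pushed l (s lab_a) (s par_a) (s ord_a) ?c (?c - k) (s' sub_a) (s' con_a)"
      and j: "s' j_a 0 = ?c - k" "1 < ?c - k" by auto
    define j where "j = ?c - k - 1"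
    have jj: "0 < j" "j < ?c" "?c - k = Suc j" "?c - Suc k = j" using j by (auto simp: j_def)
    have inp': "inp s'" using inp_frame[OF inp fr] by simp
    note i = inpD[OF inp']
    have e: "s' ord_a = s ord_a" "s' par_a = s par_a" using fr by (auto simp: frame_def)
    note step = pushed_step[OF t l p[unfolded jj(3)] jj(1,2) refl refl refl refl refl]
    let ?y = "s ord_a j" let ?e = "s par_a ?y" let ?q = "eu ?e + ev ?e - ?y"
    have qlt: "eu ?e + ev ?e < 2 ^ w" using ends_lt[OF step(2)] words(2) by linarith
    have q: "?q = eu ?e \<or> ?q = ev ?e" using step(4) by auto
    \<comment> \<open>No overflow: after the step the flow at \<open>?q\<close> is one summand of
      the flow at the unprocessed vertices, which is at most \<open>2 * m\<close> in total.\<close>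
    have lt: "s' sub_a ?q + s' sub_a ?y < 2 ^ w"
    proof (rule words_lt1)
      have "(\<Sum>x \<in> s ord_a ` {..<j}. ((s' sub_a)(?q := s' sub_a ?q + s' sub_a ?y)) x) \<le> 2 * m"
        using step(1) by (auto simp: pushed_def)
      moreover have "?q \<in> s ord_a ` {..<j}"
      proof -
        obtain x where x: "x \<in> s ord_a ` {..<j}" "{eu ?e, ev ?e} = {?y, x}"
          using t jj unfolding tree_def by blast
        hence "x = ev ?e \<and> ?y = eu ?e \<or> x = eu ?e \<and> ?y = ev ?e" by (metis doubleton_eq_iff)
        hence "?q = x" by auto
        thus ?thesis using x(1) by simp
      qed
      ultimately have "((s' sub_a)(?q := s' sub_a ?q + s' sub_a ?y)) ?q \<le> 2 * m"
        using member_le_sum[of ?q "s ord_a ` {..<j}" "(s' sub_a)(?q := s' sub_a ?q + s' sub_a ?y)"] by simp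
      thus "s' sub_a ?q + s' sub_a ?y \<le> 900 * (m + 2)" by simp
    qed
    have fr': "frame {sub_a, con_a, j_a, y_a, pe_a} s (s'(j_a := f1, y_a := f2, pe_a := f3, con_a := f4, y_a := f5, sub_a := f6))"
      for f1 f2 f3 f4 f5 f6 using fr by (auto simp: frame_def)
    have d: "s' j_a 0 - 1 = j" "s' j_a 0 - Suc 0 = j" using j jj by auto
    have kc: "Suc k < ?c" using j(2) by simp
    show ?case
      using step(1) fr' qlt lt jj kc by (simp add: i e d)
  next
    case (2 k s') thus ?case using c by linarith
  next
    case 3
    have "frame {sub_a, con_a, j_a, y_a, pe_a} s (s(j_a := f))" for f by (simp add: frame_def)
    thus ?case using pushed_init[OF t, where S = "s sub_a" and C = "s con_a"] sub con c by simp
  next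
    case (4 k t' s')
    have k: "?c - k = 1" using 4(1,2) by auto
    show ?case using 4(1,3) unfolding k by auto
  qed
qed

lemma wp_reweight_loop:
  assumes inp: "inp s" and W: "wts (s wt_a) (s tw_a 0) PW un R" "s tw_a 0 \<le> 8 * m * m * m"
    and r: "routed (len (s wt_a) un) L q (s con_a)"
  shows "wp w \<rho> (for_edges
     (Store wt_a (var ix_a) (Add (Add (Cell wt_a (var ix_a))
         (Div (Mul (Cell wt_a (var ix_a)) (Add (Cell con_a (var ix_a)) (Const 1))) (Mul (Const 2) mX)))
         (Const 1)) ;;
      set_var tw_a (Add (var tw_a) (Cell wt_a (var ix_a)))))
    (\<lambda>t s'. t \<le> 10 * m + 10 \<and> frame {wt_a, tw_a, ix_a} s s' \<and>
      (\<forall>i<m. s' wt_a i = s wt_a i + s wt_a i * (s con_a i + 1) div (2 * m) + 1) \<and>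
      s' tw_a 0 = (\<Sum>i<m. s' wt_a i)) (s(tw_a := (s tw_a)(0 := 0)))"
proof -
  define wt' where "wt' i = s wt_a i + s wt_a i * (s con_a i + 1) div (2 * m) + 1" for i
  have "(\<Sum>i<m. wt' i) \<le> 3 * s tw_a 0"
    by (rule reweight_sum(1)[OF W(1) r]) (auto simp: wt'_def)
  hence sum': "(\<Sum>i<m. wt' i) \<le> 24 * m * m * m" using W(2) by linarith
  have part: "(\<Sum>i<k. wt' i) \<le> 24 * m * m * m" if "k \<le> m" for k
  proof -
    have "(\<Sum>i<k. wt' i) \<le> (\<Sum>i<m. wt' i)" using that by (intro sum_mono2) auto
    thus ?thesis using sum' by linarith
  qed
  have p3: "24 * m * m * m \<le> 900 * (m + 2) ^ 3" by (simp add: power3_eq_cube algebra_simps)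
  let ?I = "\<lambda>k s'. frame {wt_a, tw_a, ix_a} s s' \<and>
    s' wt_a = (\<lambda>i. if i < k then wt' i else s wt_a i) \<and> s' tw_a 0 = (\<Sum>i<k. wt' i)"
  show ?thesis
  proof (rule wp_edges[where I = ?I and \<tau> = 5], goal_cases)
    case 1 show ?case using inp by (auto simp: inp_def)
  next
    case 2 show ?case by (auto simp: frame_def)
  next
    case (3 k s' x) thus ?case by (auto simp: frame_def)
  next
    case (4 k s') thus ?case using inp_frame[OF inp] by auto
  next
    case (5 k s')
    note i = inpD[OF 5(4)]
    have con: "s' con_a = s con_a" using 5(1) by (auto simp: frame_def)
    have wt: "s' wt_a k = s wt_a k" and tw: "s' tw_a 0 = (\<Sum>i<k. wt' i)" using 5(1) by auto
    have C: "s con_a k \<le> 2 * m" using r 5(2) by (auto simp: routed_def)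
    have wk: "s wt_a k \<le> 8 * m * m * m"
    proof -
      have "s wt_a k \<le> (\<Sum>i<m. s wt_a i)" using 5(2) by (intro member_le_sum) auto
      thus ?thesis using W by (simp add: wts_def)
    qed
    have l1: "Suc (s con_a k) < 2 ^ w" using C by (intro words_lt1) simp
    have "s wt_a k * Suc (s con_a k) \<le> 8 * m * m * m * (2 * m + 1)"
      using wk C by (intro mult_mono) auto
    also have "\<dots> \<le> 900 * (m + 2) ^ 6"
    proof -
      have "8 * m * m * m * (2 * m + 1) \<le> 8 * (m + 2) * (m + 2) * (m + 2) * (2 * (m + 2))"
        by (intro mult_mono) auto
      also have "\<dots> = 16 * (m + 2) ^ 4" unfolding power4_eq_xxxx by (simp only: mult_ac)
      also have "\<dots> \<le> 900 * (m + 2) ^ 6" by (intro mult_mono power_increasing) auto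
      finally show ?thesis .
    qed
    finally have l2: "s wt_a k * Suc (s con_a k) < 2 ^ w" by (rule words_lt)
    have "wt' k \<le> (\<Sum>i<Suc k. wt' i)" by simp
    hence "wt' k \<le> 24 * m * m * m" using part[of "Suc k"] 5(2) by linarith
    hence l3: "wt' k < 2 ^ w" using p3 by (intro words_lt3) linarith
    have l4: "(\<Sum>i<k. wt' i) + wt' k < 2 ^ w" using part[of "Suc k"] 5(2) p3 by (intro words_lt3) simp
    have val: "eval w s' (Add (Add (Cell wt_a (var ix_a))
         (Div (Mul (Cell wt_a (var ix_a)) (Add (Cell con_a (var ix_a)) (Const 1))) (Mul (Const 2) mX)))
         (Const 1)) = wt' k"
    proof -
      have "s wt_a k + s wt_a k * Suc (s con_a k) div (2 * m) < 2 ^ w" using l3 by (simp add: wt'_def)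
      thus ?thesis using l1 l2 l3 by (simp add: i con wt 5(3) wt'_def)
    qed
    have fr: "frame {wt_a, tw_a, ix_a} s (s'(wt_a := f, tw_a := g))" for f g
      using 5(1) by (auto simp: frame_def)
    have wt2: "(s' wt_a)(k := wt' k) = (\<lambda>i. if i < Suc k then wt' i else s wt_a i)"
      using 5(1) by (auto simp: fun_eq_iff less_Suc_eq)
    have ix: "eval w s' (var ix_a) = k" using 5(3) by simp
    show ?case
      unfolding wp_Seq wp_Store val ix using fr l4 5(3) by (simp add: tw wt2)
  next
    case (6 t s')
    thus ?case by (auto simp: wt'_def)
  qed
qed

lemma wp_clear_removed:
  assumes inp: "inp s" and R: "removed s \<subseteq> ends"
  shows "wp w \<rho> (for_edges (Store rem_a uX (Const 0) ;; Store rem_a vX (Const 0)))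
    (\<lambda>t s'. t \<le> 10 * m + 10 \<and> frame {rem_a, ix_a} s s' \<and> removed s' = {}) s"
proof (rule wp_edges[where \<tau> = 5 and
    I = "\<lambda>k s'. frame {rem_a, ix_a} s s' \<and> s' rem_a = (\<lambda>v. if v \<in> ends_upto k then 0 else s rem_a v)"], goal_cases)
  case 1 show ?case by (rule inp)
next
  case 2 show ?case by (auto simp: frame_def)
next
  case (3 k s' x) thus ?case by (auto simp: frame_def)
next
  case (4 k s') thus ?case using inp_frame[OF inp] by auto
next
  case (5 k s')
  note i = inpD[OF 5(4)]
  have fr: "frame {rem_a, ix_a} s (s'(rem_a := f))" for f using 5(1) by (auto simp: frame_def)
  have rem: "(s' rem_a)(eu k := 0, ev k := 0) = (\<lambda>v. if v \<in> ends_upto (Suc k) then 0 else s rem_a v)"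
    using 5(1) unfolding ends_upto_Suc by (auto simp: fun_eq_iff)
  show ?case using 5(3) fr by (simp add: i rem)
next
  case (6 t s')
  have "removed s' = {}" using 6(1) R by auto
  thus ?case using 6 by auto
qed

section \<open>One attempt\<close>

definition ready :: "memory \<Rightarrow> bool" where
  "ready s \<longleftrightarrow> inp s \<and> labelled (s lab_a) \<subseteq> ends \<and> s flag_a 0 = 0 \<and>
    wts (s wt_a) (s tw_a 0) (s pw_a 0) (s unit_a 0) (removed s) \<and>
    progress (s wt_a) (s tw_a 0) \<and> s tw_a 0 \<le> 24 * m * m * m"

definition halted :: "memory \<Rightarrow> bool" where
  "halted s \<longleftrightarrow> s flag_a 0 \<noteq> 0 \<and> good_cut (removed s)"

definition clk :: "memory \<Rightarrow> real" where
  "clk s = clock (s tw_a 0) (s pw_a 0) (removed s)"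

lemma root_exists:
  assumes "2 * vl R < m" shows "\<exists>z\<in>ends. z \<notin> R"
proof (rule ccontr)
  assume "\<not> ?thesis"
  hence "vl R = vl UNIV" by (intro vl_cong) auto
  also have "\<dots> = 2 * m" using vl_compl[of "{}"] by simp
  finally show False using assms by simp
qed

text \<open>The ball is disjoint from the removed set and has positive volume, so the clock advances
  through \<open>vl R\<close> alone. As soon as \<open>vl R\<close> reaches \<open>m / 2\<close>,
  the union is itself a good cut.\<close>

lemma wp_finish_remove:
  assumes s: "ready s" and fr: "frame (insert root_a grow_vars) s s2" and g: "grown l s2 q" and l: "l = len (s wt_a) (s unit_a 0)"
    and mode: "s2 mode_a 0 = 1"
  shows "wp w \<rho> prog_remove (\<lambda>t s'. t \<le> 30 * m + 30 \<and> (ready s' \<and> clk s + 1 \<le> clk s' \<or> halted s')) s2"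
proof -
  let ?B = "labelled (s2 lab_a)" and ?R = "removed s"
  have inp: "inp s" and w: "wts (s wt_a) (s tw_a 0) (s pw_a 0) (s unit_a 0) ?R" and fl: "s flag_a 0 = 0"
    and pr: "progress (s wt_a) (s tw_a 0)" "s tw_a 0 \<le> 24 * m * m * m"
    using s by (auto simp: ready_def)
  have inp2: "inp s2" using inp_frame[OF inp fr] by simp
  have e: "s2 rem_a = s rem_a" "s2 flag_a = s flag_a" "s2 wt_a = s wt_a" "s2 tw_a = s tw_a" "s2 pw_a = s pw_a"
    "s2 unit_a = s unit_a" using fr by (auto simp: frame_def)
  have R: "?R \<subseteq> ends" "2 * vl ?R < m" "sparse l ?R" using w l by (auto simp: wts_def)
  obtain f where g: "grow l ?R (s2 root_a 0) (s2 lab_a) (s2 par_a) (s2 ord_a) (s2 cnt_a 0) (s2 rad_a 0) f q"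
    and c: "m < out (s2 lab_a)" "16 * real (ctr ?R ?B) \<le> \<phi> * f"
    using g mode unfolding grown_def e by auto
  have B: "?B \<subseteq> ends" using g unfolding grow_def by (blast dest: tree_labelled_ends)
  have sl: "(\<Sum>i<m. l i) \<le> 5 * m" unfolding l by (rule sum_len_le[OF w])
  note sp = sparse_Un[OF R(3) g c]
  show ?thesis
  proof (rule wp_mono[OF wp_remove[OF inp2]], goal_cases)
    case 1 show ?case using R e by simp
  next
    case 2 show ?case by (rule B)
  next
    case (3 t s')
    have fr': "frame {rem_a, ix_a, hv_a, flag_a} s2 s'" and R': "removed s' = ?R \<union> ?B" and t: "t \<le> 30 * m + 30"
      and flag: "s' flag_a 0 = (if 2 * vl (removed s') < m then s2 flag_a 0 else 1)"
      using 3 e by auto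
    have e': "s' lab_a = s2 lab_a" "s' wt_a = s wt_a" "s' tw_a = s tw_a" "s' pw_a = s pw_a" "s' unit_a = s unit_a"
      using fr' e by (auto simp: frame_def)
    show ?case
    proof (cases "2 * vl (?R \<union> ?B) < m")
      case True
      have inp': "inp s'" using inp_frame[OF inp2 fr'] by simp
      have "wts (s' wt_a) (s' tw_a 0) (s' pw_a 0) (s' unit_a 0) (removed s')"
        using w True sp R B unfolding wts_def e' R' l by auto
      hence "ready s'" using True flag fl pr B inp' unfolding ready_def e' R' e by auto
      moreover have "clk s + 1 \<le> clk s'"
        using sp unfolding clk_def clock_def e' R' by simp
      ultimately show ?thesis using t by simp
    next
      case False
      have "good_cut (?R \<union> ?B)"
        using False sp R by (intro good_cut_sparse[OF sp(1) sl]) auto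
      thus ?thesis using False flag t unfolding halted_def R' by simp
    qed
  qed
qed

lemma wp_finish_emit:
  assumes s: "ready s" and fr: "frame (insert root_a grow_vars) s s2" and g: "grown l s2 q"
    and mode: "s2 mode_a 0 = 3"
  shows "wp w \<rho> prog_emit (\<lambda>t s'. t \<le> 20 * m + 20 \<and> (ready s' \<and> clk s + 1 \<le> clk s' \<or> halted s')) s2"
proof -
  have inp: "inp s" and R: "removed s \<subseteq> ends" using s by (auto simp: ready_def wts_def)
  have inp2: "inp s2" using inp_frame[OF inp fr] by simp
  have e: "s2 rem_a = s rem_a" using fr by (auto simp: frame_def)
  obtain f where "tree l (s2 root_a 0) (s2 lab_a) (s2 par_a) (s2 ord_a) (s2 cnt_a 0)"
    and c: "out (s2 lab_a) \<le> m" "2 * m * b \<le> out (s2 lab_a)"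
      "16 * real (ct (labelled (s2 lab_a))) \<le> \<phi> * out (s2 lab_a)"
    using g mode unfolding grown_def grow_def by auto
  hence B: "labelled (s2 lab_a) \<subseteq> ends" by (blast dest: tree_labelled_ends)
  have "good_cut (labelled (s2 lab_a))" using c by (rule good_cut_outer)
  thus ?thesis
    using R B e by (intro wp_mono[OF wp_emit[OF inp2]]) (auto simp: halted_def)
qed

lemma wp_finish_route:
  assumes s: "ready s" and W: "s tw_a 0 < 8 * m * m * m"
    and fr: "frame (insert root_a grow_vars) s s2" and g: "grown l s2 q" and l: "l = len (s wt_a) (s unit_a 0)"
    and mode: "s2 mode_a 0 = 2"
  shows "wp w \<rho> (prog_degrees ;; prog_push ;; prog_reweight)
    (\<lambda>t s'. t \<le> 80 * m + 80 \<and> (ready s' \<and> clk s + 1 \<le> clk s' \<or> halted s')) s2"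
proof -
  let ?B = "labelled (s2 lab_a)" and ?R = "removed s"
  have inp: "inp s" and w: "wts (s wt_a) (s tw_a 0) (s pw_a 0) (s unit_a 0) ?R" and fl: "s flag_a 0 = 0"
    and pr: "progress (s wt_a) (s tw_a 0)" "s tw_a 0 \<le> 24 * m * m * m"
    using s by (auto simp: ready_def)
  have inp2: "inp s2" using inp_frame[OF inp fr] by simp
  have e: "s2 rem_a = s rem_a" "s2 flag_a = s flag_a" "s2 wt_a = s wt_a" "s2 tw_a = s tw_a" "s2 pw_a = s pw_a"
    "s2 unit_a = s unit_a" using fr by (auto simp: frame_def)
  have R: "?R \<subseteq> ends" using w by (auto simp: wts_def)
  have sl: "(\<Sum>i<m. l i) \<le> 5 * m" unfolding l by (rule sum_len_le[OF w])
  have l0: "0 < l i" for i by (simp add: l len_def)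
  obtain f where g: "grow l ?R (s2 root_a 0) (s2 lab_a) (s2 par_a) (s2 ord_a) (s2 cnt_a 0) (s2 rad_a 0) f q"
    and c: "real (vl (- ?B)) \<le> 2 * b * m"
    using g mode unfolding grown_def e by auto
  have t: "tree l (s2 root_a 0) (s2 lab_a) (s2 par_a) (s2 ord_a) (s2 cnt_a 0)"
    and cost: "(\<Sum>i<m. s2 lab_a (eu i) + s2 lab_a (ev i)) \<le> 2 * m * (q + 1)"
    using g by (auto simp: grow_def)
  have q: "real q \<le> nsteps" by (rule grow_q_le[OF g sl])
  have B: "?B \<subseteq> ends" using t by (rule tree_labelled_ends)
  have PW: "s pw_a 0 \<le> s tw_a 0" using w by (simp add: wts_def)
  show ?thesis
    unfolding wp_Seq
  proof (rule wp_mono[OF wp_degrees[OF inp2]], goal_cases)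
    case (1 t1 s3)
    hence fr3: "frame {sub_a, con_a, ix_a} s2 s3" and time1: "t1 \<le> 30 * m + 30"
      and sub: "\<And>v. v \<in> ends \<Longrightarrow> s3 sub_a v = vl {v}" and con: "\<And>i. i < m \<Longrightarrow> s3 con_a i = 0"
      by auto
    have inp3: "inp s3" using inp_frame[OF inp2 fr3] by simp
    have e3: "s3 lab_a = s2 lab_a" "s3 par_a = s2 par_a" "s3 ord_a = s2 ord_a" "s3 cnt_a = s2 cnt_a"
      using fr3 by (auto simp: frame_def)
    have t3': "tree l (s2 root_a 0) (s3 lab_a) (s3 par_a) (s3 ord_a) (s3 cnt_a 0)" using t e3 by simp
    show ?case
    proof (rule wp_mono[OF wp_push[OF inp3 t3' l0 sub con]], goal_cases)
      case (3 t2 s4)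
      have fr4: "frame {sub_a, con_a, j_a, y_a, pe_a} s3 s4"
        and pd: "pushed l (s2 lab_a) (s2 par_a) (s2 ord_a) (s2 cnt_a 0) 1 (s4 sub_a) (s4 con_a)"
        using 3 e3 by auto
      have inp4: "inp s4" using inp_frame[OF inp3 fr4] by simp
      have rt: "routed l ?B q (s4 con_a)" by (rule pushed_final[OF t pd cost])
      have e4: "s4 rem_a = s rem_a" "s4 flag_a = s flag_a" "s4 wt_a = s wt_a" "s4 tw_a = s tw_a" "s4 pw_a = s pw_a"
        "s4 unit_a = s unit_a" "s4 lab_a = s2 lab_a" using fr3 fr4 e by (auto simp: frame_def)
      have w4: "wts (s4 wt_a) (s4 tw_a 0) (s pw_a 0) (s unit_a 0) ?R" using w e4 by simp
      have W4: "s4 tw_a 0 \<le> 8 * m * m * m" using W e4 by simp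
      have rt4: "routed (len (s4 wt_a) (s unit_a 0)) ?B q (s4 con_a)" using rt l e4 by simp
      have z: "eval w s4 (Const 0) = 0" by simp
      show ?case
        unfolding prog_reweight_def wp_Seq wp_Store z
      proof (rule wp_mono[OF wp_reweight_loop[OF inp4 w4 W4 rt4, unfolded wp_Seq]], goal_cases)
        case (1 t3 s5)
        have fr5: "frame {wt_a, tw_a, ix_a} s4 s5" and t3: "t3 \<le> 10 * m + 10"
          and wt': "\<forall>i<m. s5 wt_a i = s wt_a i + s wt_a i * (s4 con_a i + 1) div (2 * m) + 1"
          and W': "s5 tw_a 0 = (\<Sum>i<m. s5 wt_a i)" using 1 e4 by auto
        have inp5: "inp s5" using inp_frame[OF inp4 fr5] by simp
        note i = inpD[OF inp5]
        have e5: "s5 rem_a = s rem_a" "s5 flag_a = s flag_a" "s5 pw_a = s pw_a"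
          "s5 unit_a = s unit_a" "s5 lab_a = s2 lab_a" using fr5 e4 by (auto simp: frame_def)
        note rs = rt4[unfolded e4]
        note rw = reweight_wts[OF w rs wt' W']
        have "s5 tw_a 0 \<le> 3 * s tw_a 0" by (rule reweight_sum(1)[OF w rs wt' W'])
        \<comment> \<open>The attempt starts below \<open>8 * m * m * m\<close>, and one reweighting
          at most triples the total weight.\<close>
        hence Wb: "s5 tw_a 0 \<le> 24 * m * m * m" using W by linarith
        have pr': "progress (s5 wt_a) (s5 tw_a 0)" by (rule reweight_progress[OF w rs q c wt' W' pr(1)])
        have "2 * s pw_a 0 \<le> 16 * m * m * m" using PW W by linarith
        also have "\<dots> \<le> 900 * (m + 2) ^ 3" by (simp add: power3_eq_cube algebra_simps)
        finally have lt: "2 * s pw_a 0 < 2 ^ w" by (rule words_lt3)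
        have time: "t1 \<le> 30 * m + 30" "t2 \<le> 20 * m + 20" using time1 3 by blast+
        show ?case
        proof (cases "s5 tw_a 0 < 2 * s pw_a 0")
          case True
          have "ready s5" using rw(1)[OF True] pr' Wb inp5 B fl unfolding ready_def e5 by auto
          moreover have "clk s + 1 \<le> clk s5" using rw(1)[OF True] unfolding clk_def e5 by simp
          ultimately show ?thesis using True time t3 lt by (simp add: e5)
        next
          case False
          \<comment> \<open>The new unit may shorten edges, after which the removed set need not be
            sparse any more; hence it is cleared.\<close>
          let ?s6 = "s5(pw_a := (s pw_a)(0 := s5 tw_a 0), unit_a := (s unit_a)(0 := s5 tw_a 0 div m))"
          have inp6: "inp ?s6" using inp5 by (auto simp: inp_def)
          have R6: "removed ?s6 \<subseteq> ends" using R e5 by simp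
          have fin: "ready s7 \<and> clk s + 1 \<le> clk s7" if fr7: "frame {rem_a, ix_a} ?s6 s7" and R7: "removed s7 = {}" for s7
          proof -
            have inp7: "inp s7" using inp_frame[OF inp6 fr7] by simp
            have e7: "s7 wt_a = s5 wt_a" "s7 tw_a = s5 tw_a" "s7 pw_a 0 = s5 tw_a 0" "s7 unit_a 0 = s5 tw_a 0 div m"
              "s7 flag_a = s flag_a" "s7 lab_a = s2 lab_a"
              using fr7 e5 by (auto simp: frame_def)
            have "ready s7" using rw(2) False pr' Wb inp7 B fl unfolding ready_def e7 R7 by auto
            moreover have "clk s + 1 \<le> clk s7" using rw(2) False unfolding clk_def e7 R7 by simp
            ultimately show ?thesis by simp
          qed
          have "wp w \<rho> (for_edges (Store rem_a uX (Const 0) ;; Store rem_a vX (Const 0)))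
            (\<lambda>t s'. t \<le> 10 * m + 10 \<and> ready s' \<and> clk s + 1 \<le> clk s') ?s6"
            by (rule wp_mono[OF wp_clear_removed[OF inp6 R6]]) (use fin in blast)
          note cl = this[simplified]
          show ?thesis
            using False time t3 lt by (simp add: e5 i) (rule wp_mono[OF cl], auto)
        qed
      qed
    qed
  qed
qed

definition attempt_time :: real where
  "attempt_time = (nsteps + 4) * (81 * m + 81)"

lemma nsteps_nonneg: "0 \<le> nsteps"
proof -
  have "1 \<le> real m" using m by simp
  hence "0 \<le> potl" by (simp add: potl_def)
  thus ?thesis using psi by (simp add: nsteps_def)
qed

lemma wp_attempt:
  assumes s: "ready s" and W: "s tw_a 0 < 8 * m * m * m"
  shows "wp w \<rho> prog_attempt (\<lambda>t s'. real t \<le> attempt_time \<and> (ready s' \<and> clk s + 1 \<le> clk s' \<or> halted s')) s"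
proof -
  let ?R = "removed s"
  have inp: "inp s" and w: "wts (s wt_a) (s tw_a 0) (s pw_a 0) (s unit_a 0) ?R"
    and D: "labelled (s lab_a) \<subseteq> ends"
    using s by (auto simp: ready_def)
  have "2 * vl ?R < m" using w by (simp add: wts_def)
  then obtain z where z: "z \<in> ends" "s rem_a z = 0" using root_exists by blast
  have D0: "s lab_a v = 0" if "v \<notin> ends" for v using D that by (auto simp: labelled_def)
  define l where "l = len (s wt_a) (s unit_a 0)"
  have sl: "(\<Sum>i<m. l i) \<le> 5 * m" unfolding l_def by (rule sum_len_le[OF w])
  have l0: "0 < l i" for i by (simp add: l_def len_def)
  show ?thesis
    unfolding prog_attempt_def wp_Seq
  proof (rule wp_mono[OF wp_start[OF inp z D0]], goal_cases)
    case (2 t1 s1)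
    have fr1: "frame {lab_a, ord_a, ix_a, f_a, rad_a, cnt_a, mode_a, root_a} s s1"
      and rt: "s1 root_a 0 \<in> ends" "s rem_a (s1 root_a 0) = 0"
      and lab: "s1 lab_a = (\<lambda>v. if v = s1 root_a 0 then 1 else 0)" and o0: "s1 ord_a 0 = s1 root_a 0"
      and v: "s1 cnt_a 0 = 1" "s1 rad_a 0 = 1" "s1 f_a 0 = 1" "s1 mode_a 0 = 0" and t1: "t1 \<le> 20 * m + 20"
      using 2 by blast+
    have inp1: "inp s1" using inp_frame[OF inp fr1] by simp
    have e: "s1 rem_a = s rem_a" "s1 wt_a = s wt_a" "s1 tw_a = s tw_a" "s1 pw_a = s pw_a" "s1 unit_a = s unit_a"
      using fr1 by (auto simp: frame_def)
    have g: "growing l s1 0"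
      unfolding v e by (rule grow_init[where rt = "s1 root_a 0" and D = "s1 lab_a" and O' = "s1 ord_a" and R = "removed s" and l = l, OF lab o0 rt(1) _ l0 sl]) (use rt in simp)
    have w1: "wts (s1 wt_a) (s tw_a 0) (s pw_a 0) (s1 unit_a 0) (removed s1)" using w e by simp
    have l1: "l = len (s1 wt_a) (s1 unit_a 0)" by (simp add: l_def e)
    show ?case
    proof (rule wp_mono[OF wp_grow_loop[OF inp1 w1 l1 g v(4)]], goal_cases)
      case (1 t2 s2)
      then obtain q where t2: "real t2 \<le> 1 + (nsteps + 1) * (80 * m + 81)" and fr2: "frame grow_vars s1 s2"
        and q: "grown l s2 q" by blast
      have fr: "frame (insert root_a grow_vars) s s2" using fr1 fr2 by (auto intro: frame_trans)
      have time: "real t1 + real t2 + 80 * real m + 82 \<le> attempt_time"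
      proof -
        have "real t1 \<le> 20 * m + 20" using t1 by simp
        moreover have "(nsteps + 1) * (80 * m + 81) \<le> (nsteps + 1) * (81 * m + 81)"
          using nsteps_nonneg by (intro mult_left_mono) auto
        moreover have "attempt_time = (nsteps + 1) * (81 * m + 81) + 3 * (81 * real m + 81)"
          by (simp add: attempt_time_def algebra_simps)
        ultimately show ?thesis using t2 by simp
      qed
      have "s2 mode_a 0 = 1 \<or> s2 mode_a 0 = 2 \<or> s2 mode_a 0 = 3" using q by (auto simp: grown_def)
      thus ?case
      proof (elim disjE)
        assume mode: "s2 mode_a 0 = 1"
        show ?thesis using mode
          by simp (rule wp_mono[OF wp_finish_remove[OF s fr q l_def mode]], use time in auto)
      next
        assume mode: "s2 mode_a 0 = 2"
        show ?thesis using mode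
          by (simp del: wp_Seq) (rule wp_mono[OF wp_finish_route[OF s W fr q l_def mode]], use time in auto)
      next
        assume mode: "s2 mode_a 0 = 3"
        show ?thesis using mode
          by simp (rule wp_mono[OF wp_finish_emit[OF s fr q mode]], use time in auto)
      qed
    qed
  qed
qed

text \<open>Both weights are at most \<open>16 * m\<close> times the initial
  \<open>2 * m * m\<close>, so each logarithmic term of the clock is at most
  \<open>4 * m * ln (16 * m)\<close> above its initial value. This bounds the number of
  attempts.\<close>

lemma clk_le:
  assumes "ready s" shows "clk s \<le> 8 * m * ln (16 * m) + m"
proof -
  have w: "wts (s wt_a) (s tw_a 0) (s pw_a 0) (s unit_a 0) (removed s)" and W: "s tw_a 0 \<le> 24 * m * m * m"
    using assms by (auto simp: ready_def)
  have PW: "2 * m * m \<le> s pw_a 0" "s pw_a 0 \<le> s tw_a 0" "2 * vl (removed s) < m" using w by (auto simp: wts_def)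
  have m1: "1 \<le> real m" using m by simp
  have "0 < 2 * m * m" using m by simp
  hence p0: "0 < s pw_a 0" using PW by linarith
  have *: "ln (real x) \<le> ln (16 * real m) + ln (2 * real m * m)" if "0 < x" "x \<le> 24 * m * m * m" for x
  proof -
    have "real x \<le> real (24 * m * m * m)" using that by (intro of_nat_mono)
    hence "real x \<le> 16 * real m * (2 * real m * m)" by simp
    hence "ln (real x) \<le> ln (16 * real m * (2 * real m * m))" using that by (intro ln_mono) auto
    also have "\<dots> = ln (16 * real m) + ln (2 * real m * m)" using m1 by (intro ln_mult_pos) auto
    finally show ?thesis .
  qed
  have "4 * real m * ln (s tw_a 0) \<le> 4 * real m * (ln (16 * real m) + ln (2 * real m * m))"
    using PW p0 W by (intro mult_left_mono *) auto
  moreover have "4 * real m * ln (s pw_a 0) \<le> 4 * real m * (ln (16 * real m) + ln (2 * real m * m))"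
    using PW p0 W by (intro mult_left_mono *) auto
  ultimately show ?thesis using PW(3) unfolding clk_def clock_def by (simp add: algebra_simps)
qed

section \<open>The main loop and the total running time\<close>

definition certified :: bool where
  "certified \<longleftrightarrow> (\<forall>X. 4 * b * m \<le> min (vl X) (vl (- X)) \<longrightarrow>
    real (min (vl X) (vl (- X))) \<le> 16 * (nsteps + 2) * ct X)"

definition total_time :: real where
  "total_time = 7 * m + 8 + (8 * m * ln (16 * m) + m + 1) * (attempt_time + 1)"

lemma wp_main_loop:
  assumes s: "ready s" "0 \<le> clk s"
  shows "wp w \<rho> (While (And (Less (var flag_a) (Const 1))
      (Less (var tw_a) (Mul (Mul (Const 8) mX) (Mul mX mX)))) prog_attempt)
    (\<lambda>t s'. real t \<le> 1 + (8 * m * ln (16 * m) + m + 1) * (attempt_time + 1) \<and>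
      (halted s' \<or> s' flag_a 0 = 0 \<and> certified)) s"
proof -
  \<comment> \<open>No clock is tracked after halting. The second disjunct keeps the bound on the
    clock before the last attempt, plus 1 for that attempt.\<close>
  let ?I = "\<lambda>k s. ready s \<and> real k \<le> clk s \<or> halted s \<and> real k \<le> 8 * m * ln (16 * m) + m + 1"
  define N where "N = nat \<lfloor>8 * m * ln (16 * m) + m\<rfloor> + 1"
  define T where "T = nat \<lfloor>attempt_time\<rfloor>"
  have m1: "1 \<le> real m" using m by simp
  have at0: "0 \<le> attempt_time" using nsteps_nonneg by (simp add: attempt_time_def)
  have K0: "0 \<le> 8 * real m * ln (16 * m) + m" using m1 by simp
  have m2: "m * m < 2 ^ w" "8 * m < 2 ^ w" "8 * m * (m * m) < 2 ^ w"
  proof -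
    have "8 * m * (m * m) \<le> 900 * (m + 2) ^ 3" by (simp add: power3_eq_cube algebra_simps)
    thus "8 * m * (m * m) < 2 ^ w" by (rule words_lt3)
    have "m * m * 1 \<le> m * m * (8 * m)" using m by (intro mult_left_mono) auto
    hence "m * m \<le> 8 * m * (m * m)" by (simp only: mult_1_right mult_ac)
    thus "m * m < 2 ^ w" using \<open>8 * m * (m * m) < 2 ^ w\<close> by (rule le_less_trans)
    show "8 * m < 2 ^ w" by (rule words_lt1) simp
  qed
  have cond: "holds w \<rho> s (And (Less (var flag_a) (Const 1)) (Less (var tw_a) (Mul (Mul (Const 8) mX) (Mul mX mX))))
    \<longleftrightarrow> s flag_a 0 = 0 \<and> s tw_a 0 < 8 * m * m * m" if "inp s" for s
    using m2 inpD[OF that] by (simp add: mult.assoc)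
  show ?thesis
  proof (rule wp_While[where I = ?I and N = N and \<tau> = T and k = 0], goal_cases)
    case (1 k s)
    have f0: "s flag_a 0 = 0" using 1(2) by simp
    hence r: "ready s" "real k \<le> clk s" using 1(1) by (auto simp: halted_def)
    have "s tw_a 0 < 8 * m * m * m" using cond[of s] 1(2) r(1) unfolding ready_def by blast
    note a = wp_attempt[OF r(1) this]
    show ?case
    proof (rule wp_mono[OF a], goal_cases)
      case (1 t s')
      have "t \<le> T" using 1 by (simp add: T_def le_nat_floor)
      moreover have "?I (Suc k) s'" using 1 r clk_le[OF r(1)] by auto
      ultimately show ?case by simp
    qed
  next
    case (2 k s)
    hence "real k \<le> 8 * m * ln (16 * m) + m + 1" using clk_le[of s] by auto
    hence "k - 1 \<le> nat \<lfloor>8 * m * ln (16 * m) + m\<rfloor>" using K0 by (intro le_nat_floor) (cases k; simp)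
    thus ?case by (simp add: N_def)
  next
    case 3 show ?case using s by simp
  next
    case (4 k t s)
    have "real N \<le> 8 * m * ln (16 * m) + m + 1" unfolding N_def of_nat_add of_nat_1
      using of_nat_floor[OF K0] by linarith
    moreover have "real T + 1 \<le> attempt_time + 1" using at0 by (simp add: T_def)
    ultimately have "real N * (real T + 1) \<le> (8 * m * ln (16 * m) + m + 1) * (attempt_time + 1)"
      using K0 by (intro mult_mono) auto
    moreover have "real t \<le> real (1 + N * (T + 1))" using 4(3) by (rule of_nat_mono)
    moreover have "real (1 + N * (T + 1)) = 1 + real N * (real T + 1)" by (simp add: algebra_simps)
    ultimately have time: "real t \<le> 1 + (8 * m * ln (16 * m) + m + 1) * (attempt_time + 1)" by linarith
    have "s flag_a 0 = 0 \<and> certified" if nh: "\<not> halted s"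
    proof -
      have r: "ready s" using 4(1) nh by blast
      hence fl: "s flag_a 0 = 0" and inp: "inp s" and pr: "progress (s wt_a) (s tw_a 0)"
        and W: "s tw_a 0 \<le> 24 * m * m * m"
        and wt: "\<And>i. i < m \<Longrightarrow> 2 * m \<le> s wt_a i" "s tw_a 0 = (\<Sum>i<m. s wt_a i)"
        by (auto simp: ready_def wts_def)
      have "8 * m * m * m \<le> s tw_a 0" using cond[OF inp] 4(2) fl by simp
      moreover have "s tw_a 0 \<le> 32 * m * m * m" using W by linarith
      ultimately have "certified"
        unfolding certified_def using certificate[OF pr _ _ wt] by blast
      thus ?thesis using fl by simp
    qed
    thus ?case using time by blast
  qed
qed

lemma wp_main:
  assumes inp: "inp s" and z: "s flag_a 0 = 0" "s rem_a = (\<lambda>_. 0)" "s lab_a = (\<lambda>_. 0)"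
  shows "wp w \<rho> balanced_cut_prog (\<lambda>t s'. real t \<le> total_time \<and>
    (halted s' \<or> s' flag_a 0 = 0 \<and> certified)) s"
proof -
  have m2: "2 * m * m < 2 ^ w"
  proof (rule words_lt3)
    have "2 * m * m * 1 \<le> 2 * m * m * m" using m by (intro mult_left_mono) auto
    also have "\<dots> \<le> 900 * (m + 2) ^ 3" by (simp add: power3_eq_cube algebra_simps)
    finally show "2 * m * m \<le> 900 * (m + 2) ^ 3" by simp
  qed
  have m1: "1 \<le> real m" using m by simp
  have i0: "holds w \<rho> s (Less (Const 0) mX)" using inp m by (simp add: inp_def)
  let ?I = "\<lambda>k s'. frame {wt_a, ix_a} s s' \<and> (\<forall>i<k. s' wt_a i = 2 * m)"
  have "wp w \<rho> prog_init (\<lambda>t s'. t \<le> 5 * m + 5 \<and> ready s' \<and> 0 \<le> clk s') s"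
    unfolding prog_init_def wp_Seq
  proof (rule wp_edges[where I = ?I and \<tau> = 2], goal_cases)
    case 1 show ?case by (rule inp)
  next
    case 2 show ?case by (simp add: frame_def)
  next
    case (3 k s' x) thus ?case by (auto simp: frame_def)
  next
    case (4 k s') thus ?case using inp_frame[OF inp] by auto
  next
    case (5 k s')
    have fr: "frame {wt_a, ix_a} s (s'(wt_a := f))" for f using 5(1) by (auto simp: frame_def)
    show ?case using 5(1,3) fr by (auto simp: inpD[OF 5(4)] less_Suc_eq)
  next
    case (6 t s1)
    let ?W = "m * (2 * m)"
    let ?s2 = "s1(tw_a := (s1 tw_a)(0 := ?W), pw_a := (s1 pw_a)(0 := ?W), unit_a := (s1 unit_a)(0 := 2 * m))"
    have inp1: "inp s1" using inp_frame[OF inp] 6(1) by auto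
    have e: "s1 rem_a = s rem_a" "s1 lab_a = s lab_a" "s1 flag_a = s flag_a" using 6(1) by (auto simp: frame_def)
    have wt: "\<And>i. i < m \<Longrightarrow> s1 wt_a i = 2 * m" using 6(1) by blast
    have sum: "(\<Sum>i<m. s1 wt_a i) = ?W" using wt by simp
    have "wts (s1 wt_a) ?W ?W (2 * m) {}"
      using m wt by (auto simp: wts_def sparse_def sum)
    moreover have "progress (s1 wt_a) ?W"
    proof -
      have "(\<Sum>i<m. cross X i * (ln (real (s1 wt_a i)) - ln (2 * real m))) = 0" for X
        using wt by (intro sum.neutral) auto
      moreover have "ln (real ?W) = ln (2 * real m * m)" by (simp add: mult_ac)
      ultimately show ?thesis unfolding progress_def by (intro exI[of _ 0]) simp
    qed
    moreover have "inp ?s2" using inp1 by (auto simp: inp_def)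
    moreover have "?W \<le> 24 * m * m * m"
    proof -
      have "?W * 1 \<le> ?W * m" using m by (intro mult_left_mono) auto
      thus ?thesis by (simp add: mult_ac)
    qed
    ultimately have "ready ?s2" using z e by (auto simp: ready_def labelled_def)
    \<comment> \<open>The constant subtracted in \<open>clock\<close> is chosen to make it start at
      0.\<close>
    moreover have "clk ?s2 = 0" using z e by (simp add: clk_def clock_def algebra_simps)
    moreover have "m * (2 * m) < 2 ^ w" using m2 by (simp add: mult_ac)
    ultimately show ?case using 6(2) inpD[OF inp1] by simp
  qed
  note init = this
  show ?thesis
    unfolding balanced_cut_prog_def wp_If if_P[OF i0] wp_Seq
  proof (rule wp_mono[OF init], goal_cases)
    case (1 t s1)
    hence r: "ready s1" "0 \<le> clk s1" and t: "t \<le> 5 * m + 5" by auto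
    show ?case
    proof (rule wp_mono[OF wp_main_loop[OF r]], goal_cases)
      case (1 t' s')
      have "real (1 + (t + t')) \<le> total_time" using 1 t unfolding total_time_def by simp
      thus ?case using 1 by simp
    qed
  qed
qed

text \<open>\<open>L\<close> stands for \<open>ln n\<close>, and \<open>ln m \<le> 2 * L\<close>
  reflects that \<open>m\<close> is at most \<open>n * n\<close>. One factor \<open>L\<close> of the
  time comes from the number of attempts, the other from the number of growing steps per
  attempt.\<close>

lemma asymptotics:
  assumes L: "1 \<le> L" "ln m \<le> 2 * L"
  shows "nsteps + 2 \<le> 546 * L / \<phi>" "total_time \<le> 13000000 * L\<^sup>2 * (real m ^ 2 / \<phi>)"
proof -
  have m1: "1 \<le> real m" using m by simp
  have lnc: "ln (c * real m) \<le> c - 1 + 2 * L" if "0 < c" for c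
    using that m1 L(2) ln_le_minus_one[of c] by (simp add: ln_mult)
  have potl: "potl \<le> 17 * L"
    using lnc[of 6] lnc[of 3] L(1) unfolding potl_def by simp
  have L\<phi>: "L \<le> L / \<phi>" "1 \<le> L / \<phi>" using phi L by (auto simp: field_simps)
  have "\<phi> / 16 \<le> \<psi>" by (simp add: \<psi>_def)
  hence "nsteps \<le> 2 * (17 * L) / (\<phi> / 16)"
    unfolding nsteps_def using potl L phi psi by (intro frac_le) auto
  hence ns: "nsteps \<le> 544 * (L / \<phi>)" by simp
  thus "nsteps + 2 \<le> 546 * L / \<phi>" using L\<phi> by simp
  have "attempt_time \<le> (548 * (L / \<phi>)) * (162 * real m)"
    unfolding attempt_time_def using ns L\<phi> m1 by (intro mult_mono) auto
  moreover have "1 \<le> L / \<phi> * real m" using mult_mono[of 1 "L / \<phi>" 1 "real m"] L\<phi> m1 by simp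
  ultimately have a: "attempt_time + 1 \<le> 88777 * (L / \<phi> * real m)" by simp
  have Lm: "1 \<le> L * real m" "real m \<le> L * real m"
    using mult_mono[of 1 L 1 "real m"] mult_right_mono[of 1 L "real m"] L(1) m1 by auto
  have "8 * m * ln (16 * m) \<le> 8 * m * (17 * L)" using lnc[of 16] L(1) by (intro mult_left_mono) auto
  hence k: "8 * m * ln (16 * m) + m + 1 \<le> 138 * (L * m)" using Lm by simp
  have at0: "0 \<le> attempt_time" using nsteps_nonneg by (simp add: attempt_time_def)
  have "(8 * m * ln (16 * m) + m + 1) * (attempt_time + 1) \<le> 138 * (L * m) * (88777 * (L / \<phi> * real m))"
    using k a at0 Lm by (intro mult_mono) auto
  also have "\<dots> = 12251226 * (L\<^sup>2 * (real m ^ 2 / \<phi>))" by (simp add: power2_eq_square)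
  finally have "(8 * m * ln (16 * m) + m + 1) * (attempt_time + 1) \<le> 12251226 * (L\<^sup>2 * (real m ^ 2 / \<phi>))" .
  moreover have "real m \<le> L\<^sup>2 * (real m ^ 2 / \<phi>)"
  proof -
    have "1 \<le> L * (L * real m)" using mult_mono[of 1 L 1 "L * real m"] L(1) Lm by simp
    hence "real m * 1 \<le> real m * (L * (L * real m))" by (intro mult_left_mono) auto
    also have "\<dots> = L\<^sup>2 * real m ^ 2" by (simp add: power2_eq_square mult_ac)
    also have "\<dots> \<le> L\<^sup>2 * real m ^ 2 / \<phi>"
      using phi mult_left_le[of \<phi> "L\<^sup>2 * real m ^ 2"] by (simp add: le_divide_eq)
    finally show ?thesis by simp
  qed
  ultimately show "total_time \<le> 13000000 * L\<^sup>2 * (real m ^ 2 / \<phi>)"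
    unfolding total_time_def mult.assoc using m1 by linarith
qed

end

section \<open>Main result\<close>

lemma card_edges_le:
  assumes "ugraph {..<n} E" shows "finite E" "card E \<le> n * n"
proof -
  have sub: "E \<subseteq> (\<lambda>(u, v). {u, v}) ` ({..<n} \<times> {..<n})"
    using assms by (force simp: ugraph_def)
  thus "finite E" by (rule finite_subset) auto
  have "card E \<le> card ((\<lambda>(u, v). {u, v}) ` ({..<n} \<times> {..<n}))" using sub by (intro card_mono) auto
  also have "\<dots> \<le> card ({..<n} \<times> {..<n})" by (intro card_image_le) auto
  finally show "card E \<le> n * n" by (simp add: card_cartesian_product)
qed

text \<open>A list that is as long as its set of values is large has no repetitions, so positions
  correspond to edges.\<close>

lemma edge_list_bij:
  assumes "edge_list E es"
  shows "bij_betw (\<lambda>i. {input_memory n es eu_a i, input_memory n es ev_a i}) {..<card E} E"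
proof -
  let ?f = "\<lambda>(u, v). {u, v}"
  have s: "set (map ?f es) = E" and len: "length es = card E" using assms by (auto simp: edge_list_def)
  have "distinct (map ?f es)" using s len by (intro card_distinct) simp
  hence "bij_betw (\<lambda>i. map ?f es ! i) {..<length (map ?f es)} (set (map ?f es))"
    by (intro bij_betw_nth) auto
  hence "bij_betw (\<lambda>i. map ?f es ! i) {..<card E} E" using s len by simp
  thus ?thesis
    by (rule bij_betw_cong[THEN iffD1, rotated]) (auto simp: input_memory_def len split: prod.split)
qed

context edges
begin

text \<open>Without loops the two indicators of an edge at a vertex exclude each other, so counting
  edge ends is counting incident edges.\<close>

lemma
  assumes bij: "bij_betw (\<lambda>i. {eu i, ev i}) {..<m} E"
  shows vol_eq: "finite S \<Longrightarrow> vol E S = vl S" and cut_eq: "card (cut_edges E S) = ct S"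
proof -
  have fin: "finite E" using bij by (metis bij_betw_finite finite_lessThan)
  have "degree E v = vl {v}" for v
  proof -
    have "degree E v = (\<Sum>e\<in>E. of_bool (v \<in> e))" using fin by (simp add: degree_def Int_def)
    also have "\<dots> = (\<Sum>i<m. of_bool (v \<in> {eu i, ev i}))" by (rule sum.reindex_bij_betw[OF bij, symmetric])
    also have "\<dots> = vl {v}" unfolding vl_def by (intro sum.cong) (auto dest: loopfree)
    finally show ?thesis .
  qed
  thus "finite S \<Longrightarrow> vol E S = vl S" by (simp add: vol_def vl_sum[of S])
  have "card (cut_edges E S) = (\<Sum>e\<in>E. of_bool (card (e \<inter> S) = 1))" using fin by (simp add: cut_edges_def Int_def)
  also have "\<dots> = (\<Sum>i<m. of_bool (card ({eu i, ev i} \<inter> S) = 1))" by (rule sum.reindex_bij_betw[OF bij, symmetric])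
  also have "\<dots> = ct S" unfolding ct_def
  proof (rule sum.cong[OF refl])
    fix i assume "i \<in> {..<m}"
    hence "eu i \<noteq> ev i" using loopfree by simp
    thus "of_bool (card ({eu i, ev i} \<inter> S) = 1) = (of_bool ((eu i \<in> S) \<noteq> (ev i \<in> S)) :: nat)"
      by (cases "eu i \<in> S"; cases "ev i \<in> S") auto
  qed
  finally show "card (cut_edges E S) = ct S" .
qed

end

context run
begin

lemma output_correct:
  assumes bij: "bij_betw (\<lambda>i. {eu i, ev i}) {..<m} E" and h: "halted s"
  shows "outputs_cut s \<and> (let S = output_set n s in
      is_cut {..<n} S \<and>
      real (vol E S) \<ge> b * real (vol E {..<n}) \<and>
      real (vol E ({..<n} - S)) \<ge> b * real (vol E {..<n}) \<and>
      conductance {..<n} E S \<le> \<phi>)"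
proof -
  let ?S = "output_set n s"
  have en: "v \<in> ends \<Longrightarrow> v < n" for v using ends_lt by (auto simp: ends_def)
  have S: "vl ?S = vl (removed s)" "ct ?S = ct (removed s)" "vl ({..<n} - ?S) = vl (- removed s)"
    using en by (auto intro!: vl_cong ct_cong simp: output_set_def)
  have all: "vol E {..<n} = 2 * m"
  proof -
    have "vol E {..<n} = vl (- {})" unfolding vol_eq[OF bij finite_lessThan] using en by (intro vl_cong) auto
    thus ?thesis using vl_compl[of "{}"] by simp
  qed
  have fin: "finite ?S" by (simp add: output_set_def)
  have gc: "good_cut (removed s)" "outputs_cut s" using h by (auto simp: halted_def outputs_cut_def)
  hence pos: "0 < vl ?S" "0 < vl ({..<n} - ?S)" unfolding S by (auto simp: good_cut_def)
  \<comment> \<open>Positive volume on both sides makes the output a proper nonempty subset.\<close>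
  have "?S \<noteq> {}" using pos(1) by (metis less_irrefl vl_empty)
  moreover have "?S \<noteq> {..<n}" using pos(2) by (metis Diff_cancel less_irrefl vl_empty)
  moreover have "?S \<subseteq> {..<n}" by (auto simp: output_set_def)
  ultimately have "is_cut {..<n} ?S" by (auto simp: is_cut_def)
  moreover have "conductance {..<n} E ?S \<le> \<phi>"
    using gc(1) pos unfolding conductance_def cut_eq[OF bij] vol_eq[OF bij fin] vol_eq[OF bij finite_Diff[OF finite_lessThan]]
    by (simp add: S good_cut_def divide_le_eq)
  ultimately show ?thesis
    using gc unfolding Let_def all vol_eq[OF bij fin] vol_eq[OF bij finite_Diff[OF finite_lessThan]] S
    by (simp add: good_cut_def mult_ac)
qed

lemma certificate_correct:
  assumes bij: "bij_betw (\<lambda>i. {eu i, ev i}) {..<m} E" and cert: certified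
    and X: "is_cut {..<n} X" "real (vol E X) \<ge> 2 * b * real (vol E {..<n})"
      "real (vol E ({..<n} - X)) \<ge> 2 * b * real (vol E {..<n})"
  shows "1 / (16 * (nsteps + 2)) \<le> conductance {..<n} E X"
proof -
  have en: "v \<in> ends \<Longrightarrow> v < n" for v using ends_lt by (auto simp: ends_def)
  have all: "vol E {..<n} = 2 * m"
  proof -
    have "vol E {..<n} = vl (- {})" unfolding vol_eq[OF bij finite_lessThan] using en by (intro vl_cong) auto
    thus ?thesis using vl_compl[of "{}"] by simp
  qed
  have "finite X" using X(1) finite_subset[of X "{..<n}"] by (auto simp: is_cut_def)
  hence v: "vol E X = vl X" by (rule vol_eq[OF bij])
  have "vol E ({..<n} - X) = vl ({..<n} - X)" by (rule vol_eq[OF bij]) simp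
  also have "\<dots> = vl (- X)" using en by (intro vl_cong) auto
  finally have v': "vol E ({..<n} - X) = vl (- X)" .
  have "4 * b * m \<le> min (vl X) (vl (- X))" using X(2,3) unfolding v v' all by simp
  moreover have "0 < 4 * b * m" using b m by simp
  ultimately have mn: "real (min (vl X) (vl (- X))) \<le> 16 * (nsteps + 2) * ct X" "0 < real (min (vl X) (vl (- X)))"
    using cert unfolding certified_def by (blast, linarith)
  thus ?thesis
    using nsteps_nonneg unfolding conductance_def v v' cut_eq[OF bij]
    by (simp add: divide_le_eq le_divide_eq field_simps)
qed

end

text \<open>The \<open>max 1\<close> is for edgeless graphs, where \<open>m\<^sup>2 / \<phi>\<close>
  is 0. The word length may be any \<open>w\<close> with \<open>n ^ \<kappa> \<le> 2 ^ w\<close>,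
  that is, from a constant multiple of log n upwards.\<close>

theorem theorem2p4:
  shows "\<exists>(LowConductanceCutOrCertify :: com) (\<kappa> :: nat) (k :: nat) (C :: real) (c :: real) (c' :: real).
    C > 0 \<and> c > 0 \<and> c' > 0 \<and>
    (\<forall>(n :: nat) (E :: nat set set) (es :: (nat \<times> nat) list) (m :: nat) (\<phi> :: real) (b :: real) (w :: nat).
      n \<ge> 1 \<and> ugraph {..<n} E \<and> m = card E \<and> edge_list E es \<and>
      0 < \<phi> \<and> \<phi> \<le> 1 \<and> 1 / real n \<le> b \<and> b \<le> 1 / 4 \<and> n ^ \<kappa> \<le> 2 ^ w \<longrightarrow>
      (\<exists>(t :: nat) (s :: memory).
        exec w (input_params \<phi> b) LowConductanceCutOrCertify (input_memory n es) t s \<and>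
        real t \<le> C * (ln (real n)) ^ k * max 1 ((real m)\<^sup>2 / \<phi>) \<and>
        ((outputs_cut s \<and>
          (let S = output_set n s in
            is_cut {..<n} S \<and>
            real (vol E S) \<ge> b * real (vol E {..<n}) \<and>
            real (vol E ({..<n} - S)) \<ge> b * real (vol E {..<n}) \<and>
            conductance {..<n} E S \<le> \<phi>))
         \<or>
         (\<not> outputs_cut s \<and>
          (\<forall>X. is_cut {..<n} X \<and>
            real (vol E X) \<ge> c * b * real (vol E {..<n}) \<and>
            real (vol E ({..<n} - X)) \<ge> c * b * real (vol E {..<n}) \<longrightarrow>
            conductance {..<n} E X \<ge>
              \<phi> * (c' * (1 / (ln (real n) * ln (1 / b) * ln (ln (real n) / (\<phi> * b))))))))))"
\<comment> \<open>The exponent is \<open>26 = 5 + 3 * 7\<close>, from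
  \<open>1000 \<le> n ^ 5\<close> and \<open>m + 2 \<le> n ^ 3\<close> in the requirement on words.
  The balance factor 2 turns \<open>c * b * vol\<close> into the \<open>4 * b * m\<close> of the
  certificate, and \<open>8736 = 16 * 546\<close> combines the factor of the certificate with the
  bound on \<open>nsteps + 2\<close>.\<close>
proof (rule exI[of _ balanced_cut_prog], rule exI[of _ 26], rule exI[of _ 2], rule exI[of _ 13000000],
    rule exI[of _ 2], rule exI[of _ "1 / 8736"], intro conjI allI impI, goal_cases)
  case (4 n E es m \<phi> b w)
  hence E: "ugraph {..<n} E" "m = card E" "edge_list E es" and phi: "0 < \<phi>" "\<phi> \<le> 1"
    and b: "1 / real n \<le> b" "b \<le> 1 / 4" and n1: "1 \<le> n" and w: "n ^ 26 \<le> 2 ^ w" by auto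
  have "1 / real n \<le> 1 / 4" using b by simp
  \<comment> \<open>The range of \<open>b\<close> is nonempty only for \<open>n \<ge> 4\<close>;
    this makes \<open>ln n\<close> at least 1.\<close>
  hence n4: "4 \<le> n" using n1 by (simp add: divide_le_eq split: if_splits)
  have b0: "0 < b" using b(1) n1 by (intro less_le_trans[OF _ b(1)]) simp
  have ln4: "1 \<le> ln x" if "4 \<le> x" for x :: real
  proof -
    have "exp 1 \<le> x" using exp_le that by linarith
    thus ?thesis using that by (subst ln_ge_iff) auto
  qed
  let ?L = "ln (real n)"
  have L: "1 \<le> ?L" using n4 by (intro ln4) simp
  show ?case
  proof (cases "m = 0")
    case True
    hence E0: "E = {}" using E card_edges_le(1)[OF E(1)] by simp
    have es: "es = []" using E True by (simp add: edge_list_def)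
    have "(4 :: nat) ^ 26 \<le> n ^ 26" using n4 by (rule power_mono) simp
    hence "(4 :: nat) ^ 26 \<le> 2 ^ w" using w by (rule le_trans)
    hence w0: "0 < w" by (intro gr0I) simp
    \<comment> \<open>One test and two assignments make 3 steps. All volumes are 0, so the set
      \<open>{0}\<close> meets the volume bounds, and its conductance is 0 by the convention for
      division.\<close>
    have "wp w (input_params \<phi> b) balanced_cut_prog (\<lambda>t s. t = 3 \<and> s flag_a 0 = 1 \<and> s rem_a = (\<lambda>_. 0)(0 := 1))
      (input_memory n es)"
      using w0 by (simp add: balanced_cut_prog_def input_memory_def es)
    then obtain s where s: "exec w (input_params \<phi> b) balanced_cut_prog (input_memory n es) 3 s"
      "s flag_a 0 = 1" "s rem_a = (\<lambda>_. 0)(0 := 1)" by (auto simp: wp_def)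
    have S: "output_set n s = {0}" using s(3) n4 by (auto simp: output_set_def split: if_splits)
    have "card {0} \<noteq> card {..<n}" using n4 by simp
    hence "{0} \<noteq> {..<n}" by metis
    hence "is_cut {..<n} {0}" unfolding is_cut_def using n4 by auto
    moreover have "vol E X = 0" for X by (simp add: vol_def degree_def E0)
    moreover have "real 3 \<le> 13000000 * ?L\<^sup>2 * max 1 ((real m)\<^sup>2 / \<phi>)"
    proof -
      have "1 * 1 \<le> ?L\<^sup>2 * max 1 ((real m)\<^sup>2 / \<phi>)"
        using one_le_power[OF L, of 2] by (intro mult_mono) auto
      thus ?thesis by simp
    qed
    ultimately show ?thesis
      using s(1,2) phi by (intro exI[of _ 3] exI[of _ s] conjI disjI1) (simp_all add: S outputs_cut_def conductance_def)
  next
    case False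
    let ?eu = "input_memory n es eu_a" and ?ev = "input_memory n es ev_a"
    have bij: "bij_betw (\<lambda>i. {?eu i, ?ev i}) {..<m} E"
      unfolding E(2) by (rule edge_list_bij[OF E(3)])
    have ends: "?eu i < n \<and> ?ev i < n \<and> ?eu i \<noteq> ?ev i" if "i < m" for i
    proof -
      have "{?eu i, ?ev i} \<in> E" using bij that by (auto simp: bij_betw_def)
      then obtain u v where "u < n" "v < n" "u \<noteq> v" "{?eu i, ?ev i} = {u, v}"
        using E(1) by (auto simp: ugraph_def)
      thus ?thesis by (auto simp: doubleton_eq_iff)
    qed
    have mn: "m \<le> n * n" using card_edges_le(2)[OF E(1)] E(2) by simp
    have "m + 2 \<le> n ^ 3"
    proof -
      have "n * n * 4 \<le> n * n * n" using n4 by (intro mult_left_mono) auto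
      moreover have "16 \<le> n * n" using mult_mono[OF n4 n4] by simp
      ultimately show ?thesis using mn unfolding power3_eq_cube by linarith
    qed
    hence "(m + 2) ^ 7 \<le> (n ^ 3) ^ 7" by (rule power_mono) simp
    moreover have "1000 \<le> n ^ 5" 
    proof -
      have "(4 :: nat) ^ 5 \<le> n ^ 5" using n4 by (rule power_mono) simp
      thus ?thesis by simp
    qed
    ultimately have "1000 * (m + 2) ^ 7 \<le> n ^ 5 * (n ^ 3) ^ 7" by (intro mult_mono) auto
    also have "\<dots> = n ^ 26" unfolding power_mult[symmetric] power_add[symmetric] by simp
    finally have words1: "1000 * (m + 2) ^ 7 \<le> 2 ^ w" using w by linarith
    have "2 * n \<le> n * n" using n4 by (intro mult_right_mono) auto
    also have "\<dots> = n ^ 2" by (simp add: power2_eq_square)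
    also have "\<dots> \<le> n ^ 26" using n4 by (intro power_increasing) auto
    finally have words2: "2 * n \<le> 2 ^ w" using w by linarith
    interpret run m ?eu ?ev \<phi> b n w
      by unfold_locales (rule words1 words2 phi b0 | use False ends b in force)+
    have "input_memory n es 0 1 = m" using E(2,3) by (simp add: input_memory_def edge_list_def)
    hence "inp (input_memory n es)" by (simp only: inp_def)
    hence "wp w \<rho> balanced_cut_prog (\<lambda>t s'. real t \<le> total_time \<and>
        (halted s' \<or> s' flag_a 0 = 0 \<and> certified)) (input_memory n es)"
      by (rule wp_main) (simp_all add: input_memory_def fun_eq_iff)
    then obtain t s where s: "exec w (input_params \<phi> b) balanced_cut_prog (input_memory n es) t s"
      "real t \<le> total_time" "halted s \<or> s flag_a 0 = 0 \<and> certified"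
      by (auto simp only: wp_def \<rho>_def)
    have "real m \<le> real (n * n)" using mn by (rule of_nat_mono)
    hence "ln (real m) \<le> ln (real n * real n)" using False by (intro ln_mono) auto
    also have "\<dots> = 2 * ?L" using n4 by (simp add: ln_mult)
    finally have lnm: "ln (real m) \<le> 2 * ?L" .
    note as = asymptotics[OF L lnm]
    have "13000000 * ?L\<^sup>2 * ((real m)\<^sup>2 / \<phi>) \<le> 13000000 * ?L\<^sup>2 * max 1 ((real m)\<^sup>2 / \<phi>)"
      by (intro mult_left_mono) auto
    hence time: "real t \<le> 13000000 * ?L\<^sup>2 * max 1 ((real m)\<^sup>2 / \<phi>)" using as(2) s(2) by linarith
    have "conductance {..<n} E X \<ge> \<phi> * (1 / 8736 * (1 / (?L * ln (1 / b) * ln (?L / (\<phi> * b)))))"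
      if certified "is_cut {..<n} X" "real (vol E X) \<ge> 2 * b * real (vol E {..<n})"
        "real (vol E ({..<n} - X)) \<ge> 2 * b * real (vol E {..<n})" for X
    proof -
      have "4 \<le> 1 / b" using b b0 by (simp add: field_simps)
      hence B: "1 \<le> ln (1 / b)" by (rule ln4)
      have "\<phi> * b \<le> 1 * (1 / 4)" using phi b b0 by (intro mult_mono) auto
      hence "4 * (\<phi> * b) \<le> ?L" using L by simp
      hence "4 \<le> ?L / (\<phi> * b)" using phi b0 by (simp add: le_divide_eq)
      hence C: "1 \<le> ln (?L / (\<phi> * b))" by (rule ln4)
      \<comment> \<open>The other two logarithms are at least 1, so the bound with \<open>?L\<close>
        alone is the stronger one.\<close>
      have "?L * 1 * 1 \<le> ?L * ln (1 / b) * ln (?L / (\<phi> * b))" using L B C by (intro mult_mono) auto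
      hence "1 / (?L * ln (1 / b) * ln (?L / (\<phi> * b))) \<le> 1 / ?L"
        using L B C by (intro divide_left_mono mult_pos_pos) auto
      hence "\<phi> * (1 / 8736 * (1 / (?L * ln (1 / b) * ln (?L / (\<phi> * b))))) \<le> \<phi> * (1 / 8736 * (1 / ?L))"
        using phi by (intro mult_left_mono) auto
      also have "\<dots> = 1 / (16 * (546 * ?L / \<phi>))" using phi L by simp
      also have "\<dots> \<le> 1 / (16 * (nsteps + 2))"
        using as(1) nsteps_nonneg by (intro divide_left_mono mult_left_mono mult_pos_pos) auto
      also have "\<dots> \<le> conductance {..<n} E X" by (rule certificate_correct[OF bij that])
      finally show ?thesis .
    qed
    note cert = this
    show ?thesis
    proof (intro exI conjI)
      show "exec w (input_params \<phi> b) balanced_cut_prog (input_memory n es) t s" by (rule s(1))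
      show "real t \<le> 13000000 * ?L\<^sup>2 * max 1 ((real m)\<^sup>2 / \<phi>)" by (rule time)
      show "(outputs_cut s \<and>
          (let S = output_set n s in
            is_cut {..<n} S \<and>
            real (vol E S) \<ge> b * real (vol E {..<n}) \<and>
            real (vol E ({..<n} - S)) \<ge> b * real (vol E {..<n}) \<and>
            conductance {..<n} E S \<le> \<phi>))
         \<or>
         (\<not> outputs_cut s \<and>
          (\<forall>X. is_cut {..<n} X \<and>
            real (vol E X) \<ge> 2 * b * real (vol E {..<n}) \<and>
            real (vol E ({..<n} - X)) \<ge> 2 * b * real (vol E {..<n}) \<longrightarrow>
            conductance {..<n} E X \<ge>
              \<phi> * (1 / 8736 * (1 / (ln (real n) * ln (1 / b) * ln (ln (real n) / (\<phi> * b)))))))"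
        using s(3)
      proof
        assume "halted s"
        thus ?thesis by (intro disjI1 output_correct[OF bij])
      next
        assume "s flag_a 0 = 0 \<and> certified"
        hence "\<not> outputs_cut s" certified by (simp_all add: outputs_cut_def)
        thus ?thesis by (intro disjI2 conjI allI impI cert) blast+
      qed
    qed
  qed
qed simp_all

end
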